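(* Let $\mu=(\mu_1,\dots,\mu_h)\vdash n-1$ be an isoclinic partition that is symmetric ($\mu=\mu'$) and has an even number of distinct parts. Let $p_\mu:=\max\{i:\mu_i\ge i\}$ and let $\mathbb{F}:=\mathbb{R}$ if $(n-1-p_\mu)/2$ is an even integer and $\mathbb{F}:=\mathbb{C}$ otherwise. For $\delta\in\{0,1\}$ let $L_\delta$ be as below and $d_\delta:=\sum_{\lambda\in L_\delta}d_\lambda$. Then there exists an equi-isoclinic tight fusion frame of $n$ subspaces of dimension $d_\mu/2$ in $\mathbb{F}^{d_\delta/2}$ whose automorphism group contains the alternating group $A_n$.
   Context: Partitions $\lambda\vdash n$: nonincreasing positive integers summing to $n$; Young diagram boxes $(i,j)$ with $j\le\lambda_i$; transpose $\lambda'_i=|\{j:\lambda_j\ge i\}|$; box $(i,j)$ lies on superdiagonal $j-i$; axial distance $D((i,j),(k,l))=(j-i)-(l-k)$. $\operatorname{Tab}(\lambda)$: standard tableaux, $d_\lambda=|\operatorname{Tab}(\lambda)|$; $V_\lambda$ real Hilbert space with orthonormal basis $\{v_T\}$; $\pi_\lambda$ Young's orthogonal form, $\pi_\lambda(s_k)v_T=\frac1{D_T(k+1,k)}v_T+\sqrt{1-\frac1{D_T(k+1,k)^2}}v_{s_kT}$ ($s_k=(k\ k{+}1)$ acting on entries, $D_T(a,b)$ the axial distance from the box of $a$ to that of $b$). For $\mu\vdash n-1$: $\lfloor\mu\rfloor$ is the set of removable boxes, $\mu^\uparrow$ the set of $\lambda\vdash n$ obtained by adding one box ($\lambda-\mu$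 the added box); $R^\lambda$ places $n$ in box $\lambda-\mu$; $\Psi_{\lambda,\mu}v_R=v_{R^\lambda}$. For $L\subseteq\mu^\uparrow$: $V_L=\bigoplus_{\lambda\in L}V_\lambda$, $\pi_L=\bigoplus\pi_\lambda$, $d_L=\sum d_\lambda$, $W_L=\operatorname{im}\Psi_L$, $\Psi_L(v)=\{\sqrt{d_\lambda/d_L}\Psi_{\lambda,\mu}v\}$, $\mathcal{W}_L=\{\pi_L(t_k)W_L\}_{k\in[n]}$ with $t_k\in S_n$, $t_k(n)=k$. $\mu$ is isoclinic if some nonempty proper $L\subset\mu^\uparrow$ makes $\mathcal{W}_L$ equi-isoclinic. If $\mu$ has $m$ distinct parts, enumerate $\mu^\uparrow=\{\lambda_1,\dots,\lambda_{m+1}\}$ so the superdiagonal indices of $\lambda_p-\mu$ strictly decrease in $p$; $L_0=\{\lambda_p:p\text{ even}\}$, $L_1=\{\lambda_p:p\text{ odd}\}$. An ensemble of $r$-dim subspaces $\{W_k\}_{k\in[n]}$ with isometries $\Phi_k$ onto them is a tight fusion frame if the orthogonal projections sum to a multiple of the identity, equi-isoclinic if there is $\alpha$ with $(\Phi_k^*\Phi_\ell)^*(\Phi_k^*\Phi_\ell)=\alpha I$ for $k\ne\ell$; its automorphism group is the set of $\tau\in S_n$ with a unitary $U$ satisfying $UW_k=W_{\tau(k)}$ for all $k$. *)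

theory Defs
  imports
    "HOL-Algebra.Sym_Groups"
    "HOL-Library.Countable_Set"
    "Jordan_Normal_Form.Schur_Decomposition"
begin

section \<open>Partitions and Young diagrams\<close>

definition is_partition :: "nat \<Rightarrow> nat list \<Rightarrow> bool" where
  "is_partition n \<nu> \<longleftrightarrow> sorted_wrt (\<ge>) \<nu> \<and> (\<forall>x\<in>set \<nu>. 0 < x) \<and> sum_list \<nu> = n"

text \<open>Parts, rows and columns are numbered from 1; parts beyond the length are 0.\<close>

definition part :: "nat list \<Rightarrow> nat \<Rightarrow> nat" where
  "part \<nu> i = (if 1 \<le> i \<and> i \<le> length \<nu> then \<nu> ! (i - 1) else 0)"

definition diagram :: "nat list \<Rightarrow> (nat \<times> nat) set" where
  "diagram \<nu> = {(i, j). 1 \<le> i \<and> 1 \<le> j \<and> j \<le> part \<nu> i}"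

definition transpose_partition :: "nat list \<Rightarrow> nat list" where
  "transpose_partition \<nu> = map (\<lambda>i. card {j. 1 \<le> j \<and> i \<le> part \<nu> j}) [1..<Suc (part \<nu> 1)]"

definition durfee :: "nat list \<Rightarrow> nat" where
  "durfee \<mu> = Max {i \<in> {1..length \<mu>}. i \<le> part \<mu> i}"

definition superdiagonal :: "nat \<times> nat \<Rightarrow> int" where
  "superdiagonal b = int (snd b) - int (fst b)"

definition axial_dist :: "nat \<times> nat \<Rightarrow> nat \<times> nat \<Rightarrow> int" where
  "axial_dist b c = superdiagonal b - superdiagonal c"

definition up_set :: "nat list \<Rightarrow> nat list set" where
  "up_set \<mu> = {\<nu>. is_partition (Suc (sum_list \<mu>)) \<nu> \<and>
              (\<exists>b. b \<notin> diagram \<mu> \<and> diagram \<nu> = insert b (diagram \<mu>))}"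

definition added_box :: "nat list \<Rightarrow> nat list \<Rightarrow> nat \<times> nat" where
  "added_box \<nu> \<mu> = the_elem (diagram \<nu> - diagram \<mu>)"

definition up_enum :: "nat list \<Rightarrow> nat list list" where
  "up_enum \<mu> = (THE ls. set ls = up_set \<mu> \<and>
     sorted_wrt (\<lambda>\<kappa> \<nu>. superdiagonal (added_box \<kappa> \<mu>) > superdiagonal (added_box \<nu> \<mu>)) ls)"

definition L_parity :: "nat \<Rightarrow> nat list \<Rightarrow> nat list set" where
  "L_parity \<delta> \<mu> = {up_enum \<mu> ! (p - 1) | p. p \<in> {1..length (up_enum \<mu>)} \<and> p mod 2 = \<delta>}"


section \<open>Standard tableaux and Young's orthogonal form\<close>

text \<open>A tableau assigns entries to boxes and is 0 outside its diagram, so that tableaux of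
  different shapes are different functions.\<close>

type_synonym tableau = "nat \<times> nat \<Rightarrow> nat"

definition Tab :: "nat list \<Rightarrow> tableau set" where
  "Tab \<nu> = {T. bij_betw T (diagram \<nu>) {1..sum_list \<nu>} \<and> (\<forall>b. b \<notin> diagram \<nu> \<longrightarrow> T b = 0) \<and>
     (\<forall>i j. (i, j) \<in> diagram \<nu> \<and> (i, Suc j) \<in> diagram \<nu> \<longrightarrow> T (i, j) < T (i, Suc j)) \<and>
     (\<forall>i j. (i, j) \<in> diagram \<nu> \<and> (Suc i, j) \<in> diagram \<nu> \<longrightarrow> T (i, j) < T (Suc i, j))}"

definition d_tab :: "nat list \<Rightarrow> nat" where
  "d_tab \<nu> = card (Tab \<nu>)"

definition box_of :: "tableau \<Rightarrow> nat \<Rightarrow> nat \<times> nat" where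
  "box_of T a = (THE b. T b = a)"

definition D_tab :: "tableau \<Rightarrow> nat \<Rightarrow> nat \<Rightarrow> int" where
  "D_tab T a b = axial_dist (box_of T a) (box_of T b)"

definition adj_transp :: "nat \<Rightarrow> nat \<Rightarrow> nat" where
  "adj_transp k = Transposition.transpose k (Suc k)"

text \<open>The real Hilbert space with an orthonormal basis indexed by a finite set \<open>A\<close> is realised as
  \<open>\<real>\<^bsup>card A\<^esup>\<close> via the library enumeration \<open>from_nat_into A\<close> of \<open>A\<close>. \<open>mat_on A B K\<close> is the matrix
  of the operator whose coefficient from basis vector \<open>b \<in> B\<close> to basis vector \<open>a \<in> A\<close> is \<open>K a b\<close>;
  \<open>entry_on\<close> recovers these coefficients.\<close>

definition mat_on :: "'i set \<Rightarrow> 'j set \<Rightarrow> ('i \<Rightarrow> 'j \<Rightarrow> real) \<Rightarrow> real mat" where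
  "mat_on A B K = mat (card A) (card B) (\<lambda>(i, j). K (from_nat_into A i) (from_nat_into B j))"

definition entry_on :: "'i set \<Rightarrow> 'j set \<Rightarrow> real mat \<Rightarrow> 'i \<Rightarrow> 'j \<Rightarrow> real" where
  "entry_on A B M a b = M $$ (to_nat_on A a, to_nat_on B b)"

text \<open>If \<open>adj_transp k \<circ> T\<close> is not standard, then the axial distance is \<open>\<plusminus>1\<close> and its coefficient
  vanishes.\<close>

definition young_gen :: "nat list \<Rightarrow> nat \<Rightarrow> real mat" where
  "young_gen \<nu> k = mat_on (Tab \<nu>) (Tab \<nu>) (\<lambda>S T.
     if S = T then 1 / of_int (D_tab T (Suc k) k)
     else if S = adj_transp k \<circ> T then sqrt (1 - 1 / (of_int (D_tab T (Suc k) k))\<^sup>2)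
     else 0)"

text \<open>The representation of the symmetric group on \<open>{1..n}\<close>, \<open>n = sum_list \<nu>\<close>, determined by its
  values on the generators. (The condition at \<open>id\<close> matters only for \<open>n \<le> 1\<close>.)\<close>

definition young_rep :: "nat list \<Rightarrow> (nat \<Rightarrow> nat) \<Rightarrow> real mat" where
  "young_rep \<nu> = (THE \<pi>.
     \<pi> \<in> hom (sym_group (sum_list \<nu>)) (ring_mat TYPE(real) (d_tab \<nu>) ()) \<and>
     \<pi> \<in> extensional (carrier (sym_group (sum_list \<nu>))) \<and>
     \<pi> id = 1\<^sub>m (d_tab \<nu>) \<and>
     (\<forall>k\<in>{1..<sum_list \<nu>}. \<pi> (adj_transp k) = young_gen \<nu> k))"

text \<open>The direct sum over \<open>\<nu> \<in> L\<close> has the orthonormal basis \<open>Tabs L\<close>, the union being disjoint.\<close>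

definition Tabs :: "nat list set \<Rightarrow> tableau set" where
  "Tabs L = (\<Union>\<nu>\<in>L. Tab \<nu>)"

definition d_sum :: "nat list set \<Rightarrow> nat" where
  "d_sum L = (\<Sum>\<nu>\<in>L. d_tab \<nu>)"

definition rep_sum :: "nat list set \<Rightarrow> (nat \<Rightarrow> nat) \<Rightarrow> real mat" where
  "rep_sum L \<sigma> = mat_on (Tabs L) (Tabs L) (\<lambda>S T.
     \<Sum>\<nu>\<in>L. if S \<in> Tab \<nu> \<and> T \<in> Tab \<nu>
            then entry_on (Tab \<nu>) (Tab \<nu>) (young_rep \<nu> \<sigma>) S T else 0)"

definition extend_tab :: "nat list \<Rightarrow> nat list \<Rightarrow> tableau \<Rightarrow> tableau" where
  "extend_tab \<nu> \<mu> R = R(added_box \<nu> \<mu> := sum_list \<nu>)"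

definition Psi_sum :: "nat list set \<Rightarrow> nat list \<Rightarrow> real mat" where
  "Psi_sum L \<mu> = mat_on (Tabs L) (Tab \<mu>) (\<lambda>T R.
     \<Sum>\<nu>\<in>L. if T = extend_tab \<nu> \<mu> R then sqrt (real (d_tab \<nu>) / real (d_sum L)) else 0)"


section \<open>Fusion frames\<close>

text \<open>An ensemble of \<open>n\<close> subspaces of \<open>F\<^bsup>N\<^esup>\<close> is a function \<open>W\<close> on \<open>{1..n}\<close>, where \<open>F\<close> is the scalar
  type (here \<open>real\<close> or \<open>complex\<close>); \<open>conjugate\<close> is the identity on \<open>real\<close>.\<close>

definition mat_image :: "'a::conjugatable_field mat \<Rightarrow> 'a vec set \<Rightarrow> 'a vec set" where
  "mat_image A W = (\<lambda>w. A *\<^sub>v w) ` W"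

definition isometry_onto ::
    "nat \<Rightarrow> nat \<Rightarrow> 'a::conjugatable_field mat \<Rightarrow> 'a vec set \<Rightarrow> bool" where
  "isometry_onto N r \<Phi> W \<longleftrightarrow>
     \<Phi> \<in> carrier_mat N r \<and> mat_adjoint \<Phi> * \<Phi> = 1\<^sub>m r \<and> mat_image \<Phi> (carrier_vec r) = W"

text \<open>The condition on \<open>\<Phi>\<close> does not depend on the choice of the isometries, since \<open>\<Phi> k\<close> is
  determined by \<open>W k\<close> up to right multiplication by a unitary.\<close>

definition equi_isoclinic ::
    "nat \<Rightarrow> nat \<Rightarrow> nat \<Rightarrow> (nat \<Rightarrow> 'a::conjugatable_field vec set) \<Rightarrow> bool" where
  "equi_isoclinic n r N W \<longleftrightarrow>
     (\<exists>\<Phi>. (\<forall>k\<in>{1..n}. isometry_onto N r (\<Phi> k) (W k)) \<and>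
       (\<exists>\<alpha>. \<forall>k\<in>{1..n}. \<forall>l\<in>{1..n}. k \<noteq> l \<longrightarrow>
          mat_adjoint (mat_adjoint (\<Phi> k) * \<Phi> l) * (mat_adjoint (\<Phi> k) * \<Phi> l) = \<alpha> \<cdot>\<^sub>m 1\<^sub>m r))"

definition orthogonal_projection ::
    "nat \<Rightarrow> 'a::conjugatable_field mat \<Rightarrow> 'a vec set \<Rightarrow> bool" where
  "orthogonal_projection N P W \<longleftrightarrow>
     P \<in> carrier_mat N N \<and> P * P = P \<and> mat_adjoint P = P \<and> mat_image P (carrier_vec N) = W"

definition tight_fusion_frame ::
    "nat \<Rightarrow> nat \<Rightarrow> (nat \<Rightarrow> 'a::conjugatable_field vec set) \<Rightarrow> bool" where
  "tight_fusion_frame n N W \<longleftrightarrow>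
     (\<exists>P. (\<forall>k\<in>{1..n}. orthogonal_projection N (P k) (W k)) \<and>
       (\<exists>c. mat N N (\<lambda>(i, j). \<Sum>k\<in>{1..n}. P k $$ (i, j)) = c \<cdot>\<^sub>m 1\<^sub>m N))"

text \<open>\<open>n\<close> subspaces of dimension \<open>r\<close> in \<open>F\<^bsup>N\<^esup>\<close>.\<close>

definition equi_isoclinic_tff ::
    "nat \<Rightarrow> nat \<Rightarrow> nat \<Rightarrow> (nat \<Rightarrow> 'a::conjugatable_field vec set) \<Rightarrow> bool" where
  "equi_isoclinic_tff n r N W \<longleftrightarrow> equi_isoclinic n r N W \<and> tight_fusion_frame n N W"

definition unitary_mat :: "nat \<Rightarrow> 'a::conjugatable_field mat \<Rightarrow> bool" where
  "unitary_mat N U \<longleftrightarrow>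
     U \<in> carrier_mat N N \<and> mat_adjoint U * U = 1\<^sub>m N \<and> U * mat_adjoint U = 1\<^sub>m N"

definition fusion_aut ::
    "nat \<Rightarrow> nat \<Rightarrow> (nat \<Rightarrow> 'a::conjugatable_field vec set) \<Rightarrow> (nat \<Rightarrow> nat) set" where
  "fusion_aut n N W = {\<tau> \<in> carrier (sym_group n).
     \<exists>U. unitary_mat N U \<and> (\<forall>k\<in>{1..n}. mat_image U (W k) = W (\<tau> k))}"


section \<open>Isoclinic partitions\<close>

definition W_sub :: "nat list set \<Rightarrow> nat list \<Rightarrow> real vec set" where
  "W_sub L \<mu> = mat_image (Psi_sum L \<mu>) (carrier_vec (d_tab \<mu>))"

text \<open>The subspaces do not depend on the choice of the \<open>t k\<close>, because \<open>W_sub L \<mu>\<close> is invariant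
  under the stabiliser of \<open>n = Suc (sum_list \<mu>)\<close>.\<close>

definition isoclinic :: "nat list \<Rightarrow> bool" where
  "isoclinic \<mu> \<longleftrightarrow>
     (let n = Suc (sum_list \<mu>) in
      \<exists>L t. L \<noteq> {} \<and> L \<subset> up_set \<mu> \<and>
        (\<forall>k\<in>{1..n}. t k \<in> carrier (sym_group n) \<and> t k n = k) \<and>
        equi_isoclinic n (d_tab \<mu>) (d_sum L) (\<lambda>k. mat_image (rep_sum L (t k)) (W_sub L \<mu>)))"

end

theory Submission
  imports Defs
begin

text \<open>Young's orthogonal form is a representation (the Coxeter relations hold and present the symmetric
  group), and by Schur's lemma the projections onto \<open>\<W>\<^sub>L\<close> always sum to a scalar. Compressing the
  transposition \<open>(n-1 n)\<close> to \<open>W\<^sub>L\<close> gives a diagonal matrix whose entry at a tableau with \<open>n - 1\<close> in the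
  removable box \<open>x\<close> is \<open>h\<^sub>L(x) = \<Sum>\<^bsub>\<lambda>\<in>L\<^esub> (d\<^sub>\<lambda> / d\<^sub>L) / D(\<lambda> - \<mu>, x)\<close>, so \<open>\<W>\<^sub>L\<close> is equi-isoclinic iff
  \<open>\<bar>h\<^sub>L\<bar>\<close> is constant. For \<open>L = \<mu>\<^sup>\<up>\<close> the subspaces are orthogonal, hence the unnormalised sums for \<open>L\<close>
  and its complement are negatives of each other. As the contents of addable and removable boxes
  interlace and \<open>h\<^sub>L\<close> increases between its poles, constancy of \<open>\<bar>h\<^sub>L\<bar>\<close> forces \<open>L\<close> to be one of
  \<open>L\<^sub>0\<close>, \<open>L\<^sub>1\<close>; then both of them are equi-isoclinic.

  If \<open>\<mu> = \<mu>'\<close> has an even number of distinct parts, both \<open>L\<^sub>\<delta>\<close> are closed under transposition. The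
  operator \<open>J v\<^sub>T = \<plusminus>v\<^bsub>T'\<^esub>\<close> with suitable signs commutes with the alternating group, preserves \<open>W\<^bsub>L\<^sub>\<delta>\<^esub>\<close>
  and satisfies \<open>J\<^sup>2 = (-1)\<^bsup>e\<^esup>\<close>, where \<open>e = (n - 1 - p\<^sub>\<mu>) / 2\<close> is the number of boxes of \<open>\<mu>\<close> above the
  diagonal. Restricting to an eigenspace of \<open>J\<close>, which needs \<open>\<i>\<close> exactly if \<open>e\<close> is odd, halves all
  dimensions.\<close>

section \<open>Permutations and the Coxeter presentation\<close>

text \<open>Two facts make one number per removable box decisive: the stabiliser of n has only two
  double cosets in S_n, and the compression of (n-1 n) is diagonal because its off-diagonal part
  moves n out of the added box. One condition on contents therefore controls all pairs of subspaces.
  The obstacle in the halving is the sign in J. Transposition negates contents, so the sign must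
  change under every admissible swap, both on each V_\<lambda> with \<lambda> in L_\<delta> and on
  V_\<mu>, and the two must agree along \<Psi>. The inversion sign of \<lambda> itself may differ
  from that of \<mu> by a factor depending on \<lambda>. Hence the sign is always computed from the
  boxes of \<mu>, with the added box counted as last. Then J^2 depends on \<mu> alone, and one
  square root \<theta> of it serves \<mu> and L_\<delta> together. J commutes with a permutation
  only up to the sign of the latter, whence A_n. An even number of distinct parts makes the number
  of addable boxes odd, so reversing their order, which is the effect of transposition, preserves
  the parity of positions.\<close>

lemma adj_transp_involutive [simp]: "adj_transp k (adj_transp k x) = x"
  unfolding adj_transp_def by simp

lemma adj_transp_comp_self: "adj_transp k \<circ> adj_transp k = id"
  by (simp add: fun_eq_iff)

lemma adj_transp_comp_assoc: "adj_transp k \<circ> (adj_transp k \<circ> f) = f"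
  by (simp add: fun_eq_iff)

lemma adj_transp_simps [simp]: "adj_transp k k = Suc k" "adj_transp k (Suc k) = k"
  unfolding adj_transp_def by simp_all

lemma adj_transp_other [simp]: "x \<noteq> k \<Longrightarrow> x \<noteq> Suc k \<Longrightarrow> adj_transp k x = x"
  unfolding adj_transp_def by (simp add: transpose_apply_other)

lemma adj_transp_if: "adj_transp k x = (if x = k then Suc k else if x = Suc k then k else x)"
  by simp

lemma adj_transp_permutes: "1 \<le> k \<Longrightarrow> k < n \<Longrightarrow> adj_transp k permutes {1..n}"
  unfolding adj_transp_def by (rule permutes_swap_id) auto

lemma bij_adj_transp: "bij (adj_transp k)"
  unfolding adj_transp_def by simp

lemma evenperm_adj_transp_comp:
  assumes "permutation \<sigma>"
  shows "evenperm (adj_transp k \<circ> \<sigma>) \<longleftrightarrow> \<not> evenperm \<sigma>"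
proof -
  have "evenperm (adj_transp k) = False" unfolding adj_transp_def by (simp add: evenperm_swap)
  thus ?thesis using evenperm_comp[OF _ assms, of "adj_transp k"]
    by (simp add: adj_transp_def permutation_swap_id)
qed

text \<open>The product s_k s_(k+1) ... s_(k+l-1), a cycle that carries k + l to k. With k + l = n
  these cycles represent the cosets of the stabiliser of n.\<close>

primrec down_cycle :: "nat \<Rightarrow> nat \<Rightarrow> nat \<Rightarrow> nat" where
  "down_cycle k 0 = id"
| "down_cycle k (Suc l) = adj_transp k \<circ> down_cycle (Suc k) l"

lemma down_cycle_permutes:
  "1 \<le> k \<Longrightarrow> k + l \<le> n \<Longrightarrow> down_cycle k l permutes {1..n}"
proof (induction l arbitrary: k)
  case (Suc l)
  show ?case using Suc.IH[of "Suc k"] Suc.prems adj_transp_permutes[of k n]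
    unfolding down_cycle.simps by (intro permutes_compose) auto
qed (simp add: permutes_id)

lemma down_cycle_top: "down_cycle k l (k + l) = k"
proof (induction l arbitrary: k)
  case (Suc l)
  show ?case using Suc[of "Suc k"] by simp
qed simp

lemma perm_fixing_top:
  assumes "\<sigma> permutes {1..Suc n}" "\<sigma> (Suc n) = Suc n"
  shows "\<sigma> permutes {1..n}"
proof -
  have "\<sigma> permutes {1..Suc n} - {Suc n}"
    by (rule permutes_superset[OF assms(1)]) (use assms(2) in \<open>auto simp: not_less_eq_eq\<close>)
  moreover have "{1..Suc n} - {Suc n} = {1..n}" by auto
  ultimately show ?thesis by simp
qed

lemma permutes_mono_top: "\<sigma> permutes {1..n} \<Longrightarrow> \<sigma> permutes {1..Suc n}"
  by (rule permutes_subset) auto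

lemma down_cycle_inv_top:
  assumes "\<sigma> permutes {1..Suc n}" "\<sigma> (Suc n) = k"
  shows "inv' (down_cycle k (Suc n - k)) \<circ> \<sigma> permutes {1..n}"
proof -
  have k: "1 \<le> k" "k \<le> Suc n" using permutes_in_image[OF assms(1), of "Suc n"] assms(2) by auto
  have c: "down_cycle k (Suc n - k) permutes {1..Suc n}" using k by (intro down_cycle_permutes) auto
  have "inv' (down_cycle k (Suc n - k)) k = Suc n"
    using down_cycle_top[of k "Suc n - k"] k permutes_inverses(2)[OF c, of "Suc n"] by simp
  thus ?thesis
    by (intro perm_fixing_top[OF permutes_compose[OF assms(1) permutes_inv[OF c]]]) (simp add: assms(2))
qed

text \<open>Dividing by the coset representative of \<sigma> leaves a permutation that fixes the top
  point, which the induction on n covers; the representative is multiplied back one generator at a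
  time. The step multiplies on the left only, matching \<open>cox_ext_step\<close>.\<close>

lemma sym_group_generated [consumes 1, case_names id step]:
  assumes "\<sigma> permutes {1..n}"
    and id: "P id"
    and step: "\<And>k \<sigma>. 1 \<le> k \<Longrightarrow> k < n \<Longrightarrow> \<sigma> permutes {1..n} \<Longrightarrow> P \<sigma> \<Longrightarrow> P (adj_transp k \<circ> \<sigma>)"
  shows "P \<sigma>"
  using assms
proof (induction n arbitrary: \<sigma>)
  case 0
  thus ?case by simp
next
  case (Suc n)
  note step = Suc.prems(3)
  define k where "k = \<sigma> (Suc n)"
  have k: "1 \<le> k" "k \<le> Suc n" using permutes_in_image[OF Suc.prems(1), of "Suc n"] k_def by auto
  define \<tau> where "\<tau> = inv' (down_cycle k (Suc n - k)) \<circ> \<sigma>"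
  have \<tau>: "\<tau> permutes {1..n}" unfolding \<tau>_def k_def by (rule down_cycle_inv_top[OF Suc.prems(1) refl])
  have c: "down_cycle k (Suc n - k) permutes {1..Suc n}" using k by (intro down_cycle_permutes) auto
  have P\<tau>: "P \<tau>"
    by (rule Suc.IH[OF \<tau> Suc.prems(2)]) (use step permutes_mono_top in auto)
  have "P (down_cycle j l \<circ> \<tau>)" if "1 \<le> j" "j + l \<le> Suc n" for j l
    using that
  proof (induction l arbitrary: j)
    case (Suc l)
    have "down_cycle (Suc j) l \<circ> \<tau> permutes {1..Suc n}"
      using Suc.prems permutes_mono_top[OF \<tau>] by (intro permutes_compose down_cycle_permutes) auto
    hence "P (adj_transp j \<circ> (down_cycle (Suc j) l \<circ> \<tau>))"
      using Suc.IH[of "Suc j"] Suc.prems by (intro step) (auto simp del: o_apply)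
    thus ?case unfolding down_cycle.simps comp_assoc .
  qed (simp add: P\<tau>)
  from this[of k "Suc n - k"] have "P (down_cycle k (Suc n - k) \<circ> \<tau>)" using k by simp
  moreover have "down_cycle k (Suc n - k) \<circ> \<tau> = \<sigma>"
    unfolding \<tau>_def by (simp add: comp_assoc[symmetric] permutes_inv_o(1)[OF c])
  ultimately show ?case by simp
qed

text \<open>The Coxeter relations present the symmetric group: by induction on \<open>n\<close>, write a permutation
  as \<open>s\<^sub>k s\<^bsub>k+1\<^esub> \<cdots> s\<^sub>n \<tau>\<close> with \<open>\<tau>\<close> fixing \<open>n + 1\<close>, and push a further generator through the cycle.\<close>

primrec cox_cycle :: "(nat \<Rightarrow> 'a \<Rightarrow> 'a) \<Rightarrow> nat \<Rightarrow> nat \<Rightarrow> 'a \<Rightarrow> 'a" where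
  "cox_cycle g k 0 = id"
| "cox_cycle g k (Suc l) = g k \<circ> cox_cycle g (Suc k) l"

text \<open>Extends an action of the generators to the whole group by recursion along the coset
  decomposition. No word is chosen, so well-definedness is built in; the relations enter only in
  showing compatibility with left multiplication.\<close>

primrec cox_ext :: "(nat \<Rightarrow> 'a \<Rightarrow> 'a) \<Rightarrow> nat \<Rightarrow> (nat \<Rightarrow> nat) \<Rightarrow> 'a \<Rightarrow> 'a" where
  "cox_ext g 0 = (\<lambda>\<sigma>. id)"
| "cox_ext g (Suc n) = (\<lambda>\<sigma>. cox_cycle g (\<sigma> (Suc n)) (Suc n - \<sigma> (Suc n)) \<circ>
     cox_ext g n (inv' (down_cycle (\<sigma> (Suc n)) (Suc n - \<sigma> (Suc n))) \<circ> \<sigma>))"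

locale coxeter_action =
  fixes g :: "nat \<Rightarrow> 'a \<Rightarrow> 'a" and N :: nat
  assumes invol: "\<And>k x. 1 \<le> k \<Longrightarrow> k < N \<Longrightarrow> g k (g k x) = x"
    and braid: "\<And>k x. 1 \<le> k \<Longrightarrow> Suc k < N \<Longrightarrow>
      g k (g (Suc k) (g k x)) = g (Suc k) (g k (g (Suc k) x))"
    and commute: "\<And>k l x. 1 \<le> k \<Longrightarrow> Suc k < l \<Longrightarrow> l < N \<Longrightarrow> g k (g l x) = g l (g k x)"
begin

lemma cox_cycle_below:
  "1 \<le> j \<Longrightarrow> Suc j < k \<Longrightarrow> k + l \<le> N \<Longrightarrow> g j (cox_cycle g k l x) = cox_cycle g k l (g j x)"
proof (induction l arbitrary: k)
  case (Suc l)
  thus ?case using commute[of j k] by simp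
qed simp

text \<open>The generator s_j commutes with the factors before s_(j-1); the braid relation turns s_j
  s_(j-1) s_j into s_(j-1) s_j s_(j-1); the last s_(j-1) commutes with the remaining
  factors.\<close>

lemma cox_cycle_inside:
  "1 \<le> k \<Longrightarrow> k < j \<Longrightarrow> j < k + l \<Longrightarrow> k + l \<le> N \<Longrightarrow>
     g j (cox_cycle g k l x) = cox_cycle g k l (g (j - 1) x)"
proof (induction l arbitrary: k)
  case (Suc l)
  show ?case
  proof (cases "j = Suc k")
    case True
    then obtain l' where l: "l = Suc l'" using Suc.prems by (cases l) auto
    have "g (Suc k) (g k (g (Suc k) (cox_cycle g (Suc (Suc k)) l' x)))
        = g k (g (Suc k) (g k (cox_cycle g (Suc (Suc k)) l' x)))"
      using braid[of k] Suc.prems l by simp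
    also have "g k (cox_cycle g (Suc (Suc k)) l' x) = cox_cycle g (Suc (Suc k)) l' (g k x)"
      using Suc.prems l by (intro cox_cycle_below) auto
    finally show ?thesis using True l by simp
  next
    case False
    hence "g j (g k y) = g k (g j y)" for y using commute[of k j] Suc.prems by simp
    thus ?thesis using Suc.IH[of "Suc k"] Suc.prems False by simp
  qed
qed simp

end

lemma down_cycle_conv: "down_cycle k l = cox_cycle (\<lambda>k. adj_transp k) k l"
  by (induction l arbitrary: k) auto

text \<open>The transpositions acting on points satisfy the same relations, so the lemmas on
  \<open>cox_cycle\<close> also tell how a generator moves past \<open>down_cycle\<close>. The
  permutation side and the operator side can thus be compared case by case.\<close>

lemma coxeter_action_adj_transp: "coxeter_action adj_transp N"
  by unfold_locales (simp_all add: adj_transp_if)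

text \<open>The image k of the top point decides. For j > k and for j + 1 < k the coset
  representative stays and s_j passes through it, as s_(j-1) or unchanged; for j = k the
  representative loses its first factor, and for j + 1 = k it gains one.\<close>

lemma (in coxeter_action) cox_ext_step:
  assumes "n \<le> N" "\<sigma> permutes {1..n}" "1 \<le> j" "j < n"
  shows "cox_ext g n (adj_transp j \<circ> \<sigma>) = g j \<circ> cox_ext g n \<sigma>"
  using assms
proof (induction n arbitrary: \<sigma> j)
  case (Suc n)
  interpret s: coxeter_action adj_transp "Suc n" by (rule coxeter_action_adj_transp)
  define k where "k = \<sigma> (Suc n)"
  define l where "l = Suc n - k"
  have k: "1 \<le> k" "k \<le> Suc n" using permutes_in_image[OF Suc.prems(2), of "Suc n"] k_def by auto
  have kl: "k + l = Suc n" using k l_def by simp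
  define c where "c = down_cycle k l"
  have cp: "c permutes {1..Suc n}" unfolding c_def using k kl by (intro down_cycle_permutes) auto
  define \<tau> where "\<tau> = inv' c \<circ> \<sigma>"
  have \<tau>: "\<tau> permutes {1..n}"
    using down_cycle_inv_top[OF Suc.prems(2) refl] by (simp add: \<tau>_def c_def l_def k_def)
  have E: "cox_ext g (Suc n) \<sigma> = cox_cycle g k l \<circ> cox_ext g n \<tau>"
    by (simp add: k_def l_def c_def \<tau>_def)
  have swap: "inv' c \<circ> (adj_transp j \<circ> \<sigma>) = adj_transp i \<circ> \<tau>"
    if "\<And>x. adj_transp j (c x) = c (adj_transp i x)" for i
  proof
    fix x
    have "adj_transp j (\<sigma> x) = c (adj_transp i (\<tau> x))"
      using that[of "\<tau> x"] permutes_inverses(1)[OF cp] by (simp add: \<tau>_def)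
    thus "(inv' c \<circ> (adj_transp j \<circ> \<sigma>)) x = (adj_transp i \<circ> \<tau>) x"
      using permutes_inverses(2)[OF cp] by simp
  qed
  consider "j > k" | "j = k" | "Suc j = k" | "Suc j < k" by linarith
  thus ?case
  proof cases
    case 1
    have top: "(adj_transp j \<circ> \<sigma>) (Suc n) = k" using 1 by (simp add: k_def)
    have "cox_ext g (Suc n) (adj_transp j \<circ> \<sigma>) =
        cox_cycle g k l \<circ> cox_ext g n (inv' c \<circ> (adj_transp j \<circ> \<sigma>))"
      by (simp only: cox_ext.simps top l_def c_def)
    also have "inv' c \<circ> (adj_transp j \<circ> \<sigma>) = adj_transp (j - 1) \<circ> \<tau>"
      by (rule swap) (use s.cox_cycle_inside[of k j l] 1 k kl Suc.prems in \<open>simp add: c_def down_cycle_conv\<close>)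
    also have "cox_ext g n \<dots> = g (j - 1) \<circ> cox_ext g n \<tau>"
      using 1 k Suc.prems \<tau> by (intro Suc.IH) auto
    also have "cox_cycle g k l \<circ> \<dots> = g j \<circ> (cox_cycle g k l \<circ> cox_ext g n \<tau>)"
      using cox_cycle_inside[of k j l] 1 k kl Suc.prems by (simp add: fun_eq_iff)
    finally show ?thesis unfolding E .
  next
    case 2
    then obtain l' where l': "l = Suc l'" using kl Suc.prems by (cases l) auto
    have top: "(adj_transp j \<circ> \<sigma>) (Suc n) = Suc k" using 2 by (simp add: k_def)
    have lk: "Suc n - Suc k = l'" using kl l' by simp
    define c' where "c' = down_cycle (Suc k) l'"
    have cc: "c = adj_transp k \<circ> c'" by (simp add: c_def c'_def l')
    have cp': "c' permutes {1..Suc n}" unfolding c'_def using kl l' by (intro down_cycle_permutes) auto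
    have "inv' c = inv' c' \<circ> adj_transp k"
      unfolding cc using cp' bij_adj_transp
      by (subst o_inv_distrib) (auto simp: permutes_bij inv_unique_comp[of "adj_transp k" "adj_transp k"] adj_transp_comp_self)
    hence "\<tau> = inv' c' \<circ> (adj_transp j \<circ> \<sigma>)" by (simp add: \<tau>_def 2 comp_assoc adj_transp_comp_assoc)
    hence "cox_ext g (Suc n) (adj_transp j \<circ> \<sigma>) = cox_cycle g (Suc k) l' \<circ> cox_ext g n \<tau>"
      by (simp only: cox_ext.simps top c'_def lk)
    also have "\<dots> = g j \<circ> (cox_cycle g k l \<circ> cox_ext g n \<tau>)"
      using 2 l' invol k Suc.prems by (simp add: fun_eq_iff)
    finally show ?thesis unfolding E .
  next
    case 3
    have top: "(adj_transp j \<circ> \<sigma>) (Suc n) = j" using 3 by (simp add: k_def[symmetric] flip: 3)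
    have lj: "Suc n - j = Suc l" using kl 3 by simp
    have cc: "down_cycle j (Suc l) = adj_transp j \<circ> c" using 3 by (simp add: c_def)
    have "inv' (adj_transp j \<circ> c) = inv' c \<circ> adj_transp j"
      using cp bij_adj_transp
      by (subst o_inv_distrib) (auto simp: permutes_bij inv_unique_comp[of "adj_transp j" "adj_transp j"] adj_transp_comp_self)
    hence "inv' (down_cycle j (Suc l)) \<circ> (adj_transp j \<circ> \<sigma>) = \<tau>"
      by (simp only: cc \<tau>_def) (simp add: comp_assoc adj_transp_comp_assoc)
    hence "cox_ext g (Suc n) (adj_transp j \<circ> \<sigma>) = cox_cycle g j (Suc l) \<circ> cox_ext g n \<tau>"
      by (simp only: cox_ext.simps top lj)
    also have "\<dots> = g j \<circ> (cox_cycle g k l \<circ> cox_ext g n \<tau>)" using 3 by (simp add: comp_assoc adj_transp_comp_assoc)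
    finally show ?thesis unfolding E .
  next
    case 4
    have top: "(adj_transp j \<circ> \<sigma>) (Suc n) = k" using 4 by (simp add: k_def)
    have "cox_ext g (Suc n) (adj_transp j \<circ> \<sigma>) =
        cox_cycle g k l \<circ> cox_ext g n (inv' c \<circ> (adj_transp j \<circ> \<sigma>))"
      by (simp only: cox_ext.simps top l_def c_def)
    also have "inv' c \<circ> (adj_transp j \<circ> \<sigma>) = adj_transp j \<circ> \<tau>"
      by (rule swap) (use s.cox_cycle_below[of j k l] 4 k kl Suc.prems in \<open>simp add: c_def down_cycle_conv\<close>)
    also have "cox_ext g n \<dots> = g j \<circ> cox_ext g n \<tau>"
      using 4 k Suc.prems \<tau> by (intro Suc.IH) auto
    also have "cox_cycle g k l \<circ> \<dots> = g j \<circ> (cox_cycle g k l \<circ> cox_ext g n \<tau>)"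
      using cox_cycle_below[of j k l] 4 k kl Suc.prems by (simp add: fun_eq_iff)
    finally show ?thesis unfolding E .
  qed
qed simp

lemma cox_ext_id: "cox_ext g n id = id"
  by (induction n) auto

section \<open>Young diagrams\<close>

text \<open>Shapes are handled as sets of boxes: adding or removing a box and reflecting in the
  diagonal become set operations, and lists of parts appear only at the interface to the
  definitions.\<close>

definition young :: "(nat \<times> nat) set \<Rightarrow> bool" where
  "young Y \<longleftrightarrow> finite Y \<and> (\<forall>i j. (i, j) \<in> Y \<longrightarrow> 1 \<le> i \<and> 1 \<le> j) \<and>
     (\<forall>i j i' j'. (i, j) \<in> Y \<longrightarrow> 1 \<le> i' \<longrightarrow> i' \<le> i \<longrightarrow> 1 \<le> j' \<longrightarrow> j' \<le> j \<longrightarrow> (i', j') \<in> Y)"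

lemma young_finite: "young Y \<Longrightarrow> finite Y"
  by (simp add: young_def)

lemma young_pos: "young Y \<Longrightarrow> (i, j) \<in> Y \<Longrightarrow> 1 \<le> i \<and> 1 \<le> j"
proof -
  assume "young Y" and *: "(i, j) \<in> Y"
  from \<open>young Y\<close> have "\<forall>i j. (i, j) \<in> Y \<longrightarrow> 1 \<le> i \<and> 1 \<le> j" unfolding young_def by (elim conjE)
  from this[rule_format, OF *] show ?thesis .
qed

lemma young_down:
  "young Y \<Longrightarrow> (i, j) \<in> Y \<Longrightarrow> 1 \<le> i' \<Longrightarrow> i' \<le> i \<Longrightarrow> 1 \<le> j' \<Longrightarrow> j' \<le> j \<Longrightarrow> (i', j') \<in> Y"
proof -
  assume "young Y" and *: "(i, j) \<in> Y" "1 \<le> i'" "i' \<le> i" "1 \<le> j'" "j' \<le> j"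
  from \<open>young Y\<close> have "\<forall>i j i' j'. (i, j) \<in> Y \<longrightarrow> 1 \<le> i' \<longrightarrow> i' \<le> i \<longrightarrow> 1 \<le> j' \<longrightarrow> j' \<le> j \<longrightarrow> (i', j') \<in> Y"
    unfolding young_def by (elim conjE)
  from this[rule_format, OF *] show ?thesis .
qed

lemma youngI:
  assumes "finite Y" "\<And>i j. (i, j) \<in> Y \<Longrightarrow> 1 \<le> i \<and> 1 \<le> j"
    "\<And>i j. (i, j) \<in> Y \<Longrightarrow> 1 < i \<Longrightarrow> (i - 1, j) \<in> Y"
    "\<And>i j. (i, j) \<in> Y \<Longrightarrow> 1 < j \<Longrightarrow> (i, j - 1) \<in> Y"
  shows "young Y"
proof -
  have up: "(i - d, j) \<in> Y" if "(i, j) \<in> Y" "d < i" for i j d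
    using that
  proof (induction d)
    case (Suc d)
    thus ?case using assms(3)[of "i - d" j] by simp
  qed simp
  have left: "(i, j - d) \<in> Y" if "(i, j) \<in> Y" "d < j" for i j d
    using that
  proof (induction d)
    case (Suc d)
    thus ?case using assms(4)[of i "j - d"] by simp
  qed simp
  show ?thesis unfolding young_def
  proof (intro conjI allI impI)
    fix i j i' j'
    assume "(i, j) \<in> Y" "1 \<le> i'" "i' \<le> i" "1 \<le> j'" "j' \<le> j"
    thus "(i', j') \<in> Y" using up[of i j "i - i'"] left[of i' j "j - j'"] by auto
  qed (use assms(1,2) in blast)+
qed

lemma initial_segment:
  fixes S :: "nat set"
  assumes "finite S" "0 \<notin> S" "\<And>x y. x \<in> S \<Longrightarrow> 1 \<le> y \<Longrightarrow> y \<le> x \<Longrightarrow> y \<in> S"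
  shows "S = {1..card S}"
proof (cases "S = {}")
  case False
  have "S = {1..Max S}"
  proof
    show "S \<subseteq> {1..Max S}" using assms(1,2) by (auto simp: Suc_le_eq intro: Nat.gr0I)
    show "{1..Max S} \<subseteq> S" using assms(3)[OF Max_in[OF assms(1) False]] by auto
  qed
  thus ?thesis by (metis card_atLeastAtMost diff_Suc_1)
qed simp

lemma mem_diagram: "(i, j) \<in> diagram \<nu> \<longleftrightarrow> 1 \<le> i \<and> 1 \<le> j \<and> j \<le> part \<nu> i"
  by (simp add: diagram_def)

lemma part_mono: "is_partition n \<nu> \<Longrightarrow> 1 \<le> i \<Longrightarrow> i \<le> i' \<Longrightarrow> part \<nu> i' \<le> part \<nu> i"
proof (cases "i' \<le> length \<nu> \<and> i < i'")
  case True
  assume "is_partition n \<nu>" "1 \<le> i"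
  thus ?thesis using True sorted_wrt_nth_less[of "(\<ge>)" \<nu> "i - 1" "i' - 1"]
    by (force simp: part_def is_partition_def)
next
  case False
  assume "i \<le> i'"
  thus ?thesis using False by (cases "i = i'") (auto simp: part_def)
qed

lemma part_pos: "is_partition n \<nu> \<Longrightarrow> 1 \<le> i \<Longrightarrow> i \<le> length \<nu> \<Longrightarrow> 0 < part \<nu> i"
  by (auto simp: part_def is_partition_def)

lemma diagram_Sigma: "diagram \<nu> = Sigma {1..length \<nu>} (\<lambda>i. {1..part \<nu> i})"
  by (auto simp: diagram_def part_def split: if_splits)

lemma finite_diagram: "finite (diagram \<nu>)"
  unfolding diagram_Sigma by auto

lemma card_diagram: "card (diagram \<nu>) = sum_list \<nu>"
proof -
  have "card (diagram \<nu>) = (\<Sum>i\<in>{1..length \<nu>}. part \<nu> i)"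
    unfolding diagram_Sigma by (subst card_SigmaI) auto
  also have "\<dots> = (\<Sum>i\<in>{0..<length \<nu>}. \<nu> ! i)"
    by (rule sum.reindex_bij_witness[of _ Suc "\<lambda>i. i - 1"]) (auto simp: part_def)
  also have "\<dots> = sum_list \<nu>" by (simp add: sum_list_sum_nth)
  finally show ?thesis .
qed

lemma young_diagram: "is_partition n \<nu> \<Longrightarrow> young (diagram \<nu>)"
proof -
  assume p: "is_partition n \<nu>"
  show ?thesis unfolding young_def mem_diagram
    using part_mono[OF p] finite_diagram[of \<nu>] by (meson le_trans)
qed

lemma part_eq_card: "1 \<le> i \<Longrightarrow> part \<nu> i = card {j. (i, j) \<in> diagram \<nu>}"
proof -
  assume "1 \<le> i"
  hence "{j. (i, j) \<in> diagram \<nu>} = {1..part \<nu> i}" by (auto simp: mem_diagram)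
  thus ?thesis by simp
qed

lemma length_eq_card: "is_partition n \<nu> \<Longrightarrow> length \<nu> = card {i. (i, 1) \<in> diagram \<nu>}"
proof -
  assume a: "is_partition n \<nu>"
  have "{i. (i, 1) \<in> diagram \<nu>} = {1..length \<nu>}"
    using part_pos[OF a] by (force simp: mem_diagram part_def split: if_splits)
  thus ?thesis by simp
qed

lemma diagram_inj:
  assumes "is_partition n \<nu>" "is_partition m \<kappa>" "diagram \<nu> = diagram \<kappa>"
  shows "\<nu> = \<kappa>"
proof (rule nth_equalityI)
  show l: "length \<nu> = length \<kappa>" using length_eq_card assms by metis
  fix i assume i: "i < length \<nu>"
  have "part \<nu> (Suc i) = part \<kappa> (Suc i)" using part_eq_card[of "Suc i"] assms(3) by simp
  thus "\<nu> ! i = \<kappa> ! i" using i l by (simp add: part_def)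
qed

lemma partition_of_young:
  assumes "young Y"
  obtains \<nu> where "is_partition (card Y) \<nu>" "diagram \<nu> = Y"
proof -
  define r where "r i = card {j. (i, j) \<in> Y}" for i
  define h where "h = card {i. (i, 1) \<in> Y}"
  have fin: "finite Y" by (rule young_finite[OF assms])
  have row: "{j. (i, j) \<in> Y} = {1..r i}" for i
    unfolding r_def
  proof (rule initial_segment)
    show "finite {j. (i, j) \<in> Y}" by (rule finite_subset[of _ "snd ` Y"]) (use fin in force)+
    show "0 \<notin> {j. (i, j) \<in> Y}" using young_pos[OF assms, of i 0] by auto
    fix x y assume "x \<in> {j. (i, j) \<in> Y}" "1 \<le> y" "y \<le> x"
    thus "y \<in> {j. (i, j) \<in> Y}" using young_down[OF assms, of i x i y] young_pos[OF assms, of i x] by simp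
  qed
  have col: "{i. (i, 1) \<in> Y} = {1..h}"
    unfolding h_def
  proof (rule initial_segment)
    show "finite {i. (i, 1) \<in> Y}" by (rule finite_subset[of _ "fst ` Y"]) (use fin in force)+
    show "0 \<notin> {i. (i, 1) \<in> Y}" using young_pos[OF assms, of 0 1] by auto
    fix x y assume "x \<in> {i. (i, 1) \<in> Y}" "1 \<le> y" "y \<le> x"
    thus "y \<in> {i. (i, 1) \<in> Y}" using young_down[OF assms, of x 1 y 1] by simp
  qed
  have memY: "(i, j) \<in> Y \<longleftrightarrow> 1 \<le> j \<and> j \<le> r i" for i j using row[of i] by auto
  have memh: "(i, 1) \<in> Y \<longleftrightarrow> 1 \<le> i \<and> i \<le> h" for i using col by auto
  define \<nu> where "\<nu> = map r [1..<Suc h]"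
  have part: "part \<nu> i = (if 1 \<le> i \<and> i \<le> h then r i else 0)" for i
    by (auto simp: part_def \<nu>_def simp del: upt_Suc)
  have D: "diagram \<nu> = Y"
  proof (rule Set.set_eqI)
    fix x :: "nat \<times> nat"
    obtain i j where x: "x = (i, j)" by force
    have "(i, j) \<in> Y \<Longrightarrow> 1 \<le> i \<and> i \<le> h"
      using memh[of i] young_down[OF assms, of i j i 1] young_pos[OF assms, of i j] by auto
    thus "x \<in> diagram \<nu> \<longleftrightarrow> x \<in> Y" using memY[of i j] by (auto simp: x mem_diagram part)
  qed
  have mono: "r i' \<le> r i" if "1 \<le> i" "i \<le> i'" for i i'
  proof (cases "r i' = 0")
    case False
    hence "(i', r i') \<in> Y" using memY[of i' "r i'"] by simp
    hence "(i, r i') \<in> Y" using young_down[OF assms, of i' "r i'" i "r i'"] that False by auto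
    thus ?thesis using memY by simp
  qed simp
  have "is_partition (card Y) \<nu>" unfolding is_partition_def
  proof (intro conjI)
    show "sorted_wrt (\<ge>) \<nu>" using mono by (auto simp: \<nu>_def sorted_wrt_iff_nth_less simp del: upt_Suc)
    show "sum_list \<nu> = card Y" using card_diagram[of \<nu>] D by simp
    have "r i > 0" if "1 \<le> i" "i \<le> h" for i using memh[of i] memY[of i 1] that by simp
    thus "\<forall>x\<in>set \<nu>. 0 < x" by (auto simp: \<nu>_def)
  qed
  thus ?thesis using D that by blast
qed

lemma mem_swap_image: "(i, j) \<in> prod.swap ` Y \<longleftrightarrow> (j, i) \<in> Y"
  by force

lemma young_swap:
  assumes "young Y"
  shows "young (prod.swap ` Y)"
  unfolding young_def mem_swap_image
proof (intro conjI allI impI)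
  show "finite (prod.swap ` Y)" using young_finite[OF assms] by simp
qed (use young_pos[OF assms] young_down[OF assms] in blast)+

lemma diagram_transpose:
  assumes "is_partition n \<nu>"
  shows "diagram (transpose_partition \<nu>) = prod.swap ` diagram \<nu>"
proof (rule Set.set_eqI)
  fix x :: "nat \<times> nat"
  obtain i j where x: "x = (i, j)" by force
  have seg: "{j. 1 \<le> j \<and> i \<le> part \<nu> j} = {1..card {j. 1 \<le> j \<and> i \<le> part \<nu> j}}" if "1 \<le> i" for i
  proof (rule initial_segment)
    show "finite {j. 1 \<le> j \<and> i \<le> part \<nu> j}"
      by (rule finite_subset[of _ "{1..length \<nu>}"]) (use that in \<open>auto simp: part_def split: if_splits\<close>)
    show "y \<in> {j. 1 \<le> j \<and> i \<le> part \<nu> j}" if "x \<in> {j. 1 \<le> j \<and> i \<le> part \<nu> j}" "1 \<le> y" "y \<le> x" for x y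
      using that part_mono[OF assms, of y x] by auto
  qed simp
  have p: "part (transpose_partition \<nu>) i = card {j. 1 \<le> j \<and> i \<le> part \<nu> j}" if "1 \<le> i"
  proof (cases "i \<le> part \<nu> 1")
    case True
    hence "[1..<Suc (part \<nu> 1)] ! (i - 1) = i" using that by (subst nth_upt) auto
    thus ?thesis using that True
      unfolding part_def[of "transpose_partition \<nu>"] by (simp add: transpose_partition_def del: upt_Suc)
  next
    case False
    have "{j. 1 \<le> j \<and> i \<le> part \<nu> j} = {}" using False part_mono[OF assms, of 1] by (auto intro: le_trans)
    hence "card {j. 1 \<le> j \<and> i \<le> part \<nu> j} = 0" by (simp only: card.empty)
    thus ?thesis using False
      unfolding part_def[of "transpose_partition \<nu>"] by (simp add: transpose_partition_def)
  qed
  have "(i, j) \<in> diagram (transpose_partition \<nu>) \<longleftrightarrow> (j, i) \<in> diagram \<nu>"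
    using p seg[of i] unfolding mem_diagram by (metis (no_types, lifting) atLeastAtMost_iff mem_Collect_eq)
  thus "x \<in> diagram (transpose_partition \<nu>) \<longleftrightarrow> x \<in> prod.swap ` diagram \<nu>"
    by (simp only: x mem_swap_image)
qed

section \<open>Standard tableaux\<close>

definition shape :: "tableau \<Rightarrow> (nat \<times> nat) set" where
  "shape T = {b. T b \<noteq> 0}"

text \<open>Tableaux of all shapes with n boxes at once, so that one family of operators serves
  every \<lambda> and every direct sum. The order condition compares arbitrary boxes instead of
  neighbours, which is the form used later.\<close>

definition SYT :: "nat \<Rightarrow> tableau set" where
  "SYT n = {T. young (shape T) \<and> bij_betw T (shape T) {1..n} \<and>
     (\<forall>b\<in>shape T. \<forall>c\<in>shape T. fst b \<le> fst c \<longrightarrow> snd b \<le> snd c \<longrightarrow> b \<noteq> c \<longrightarrow> T b < T c)}"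

definition content :: "tableau \<Rightarrow> nat \<Rightarrow> int" where
  "content T a = superdiagonal (box_of T a)"

lemma D_tab_content: "D_tab T a b = content T a - content T b"
  by (simp add: D_tab_def axial_dist_def content_def)

lemma SYT_young: "T \<in> SYT n \<Longrightarrow> young (shape T)"
  by (simp add: SYT_def)

lemma SYT_bij: "T \<in> SYT n \<Longrightarrow> bij_betw T (shape T) {1..n}"
  by (simp add: SYT_def)

lemma SYT_mono: "T \<in> SYT n \<Longrightarrow> b \<in> shape T \<Longrightarrow> c \<in> shape T \<Longrightarrow> fst b \<le> fst c \<Longrightarrow> snd b \<le> snd c \<Longrightarrow>
     b \<noteq> c \<Longrightarrow> T b < T c"
  by (simp add: SYT_def)

lemma not_in_shape: "b \<notin> shape T \<longleftrightarrow> T b = 0"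
  by (simp add: shape_def)

lemma SYT_mono': "T \<in> SYT n \<Longrightarrow> (i, j) \<in> shape T \<Longrightarrow> (k, l) \<in> shape T \<Longrightarrow> i \<le> k \<Longrightarrow> j \<le> l \<Longrightarrow>
     (i, j) \<noteq> (k, l) \<Longrightarrow> T (i, j) < T (k, l)"
  using SYT_mono[of T n "(i, j)" "(k, l)"] by simp

lemma SYT_inj: "T \<in> SYT n \<Longrightarrow> b \<in> shape T \<Longrightarrow> T b = T c \<Longrightarrow> b = c"
  using SYT_bij[of T n] unfolding bij_betw_def inj_on_def by (metis (mono_tags) not_in_shape)

lemma Tab_shape: "T \<in> Tab \<nu> \<Longrightarrow> shape T = diagram \<nu>"
proof -
  assume T: "T \<in> Tab \<nu>"
  have "T b \<in> {1..sum_list \<nu>}" if "b \<in> diagram \<nu>" for b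
    using T that unfolding Tab_def bij_betw_def by blast
  thus ?thesis using T unfolding shape_def Tab_def by force
qed

text \<open>Growth between neighbours gives weak growth along a path that runs down a column and
  then along a row; strictness for different boxes comes from injectivity.\<close>

lemma Tab_eq_SYT:
  assumes "is_partition n \<nu>"
  shows "Tab \<nu> = {T \<in> SYT n. shape T = diagram \<nu>}"
proof (intro Set.set_eqI iffI)
  fix T assume T: "T \<in> Tab \<nu>"
  have n: "sum_list \<nu> = n" using assms by (simp add: is_partition_def)
  note sh = Tab_shape[OF T]
  have Y: "young (diagram \<nu>)" by (rule young_diagram[OF assms])
  have row: "T (i, j) \<le> T (i, j + d)" if "(i, j + d) \<in> diagram \<nu>" "1 \<le> j" for i j d
    using that
  proof (induction d)
    case (Suc d)
    have "(i, j + d) \<in> diagram \<nu>" using young_down[OF Y Suc.prems(1), of i "j + d"] young_pos[OF Y Suc.prems(1)] Suc.prems by auto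
    moreover from this have "T (i, j + d) < T (i, Suc (j + d))" using Suc.prems T by (simp add: Tab_def)
    ultimately show ?case using Suc by simp
  qed simp
  have col: "T (i, j) \<le> T (i + d, j)" if "(i + d, j) \<in> diagram \<nu>" "1 \<le> i" for i j d
    using that
  proof (induction d)
    case (Suc d)
    have "(i + d, j) \<in> diagram \<nu>" using young_down[OF Y Suc.prems(1), of "i + d" j] young_pos[OF Y Suc.prems(1)] Suc.prems by auto
    moreover from this have "T (i + d, j) < T (Suc (i + d), j)" using Suc.prems T by (simp add: Tab_def)
    ultimately show ?case using Suc by simp
  qed simp
  have "T (i, j) < T (i', j')"
    if m: "(i, j) \<in> diagram \<nu>" "(i', j') \<in> diagram \<nu>" "i \<le> i'" "j \<le> j'" "(i, j) \<noteq> (i', j')" for i j i' j'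
  proof -
    have ij: "1 \<le> i" "1 \<le> j" using young_pos[OF Y m(1)] by auto
    have m2: "(i', j) \<in> diagram \<nu>" using young_down[OF Y m(2), of i' j] m ij by auto
    have "T (i, j) \<le> T (i', j)" using col[of i "i' - i" j] m m2 ij by simp
    also have "\<dots> \<le> T (i', j')" using row[of i' j "j' - j"] m ij by simp
    finally have "T (i, j) \<le> T (i', j')" .
    moreover have "inj_on T (diagram \<nu>)" using T by (simp add: Tab_def bij_betw_def)
    ultimately show ?thesis using m by (metis inj_onD le_neq_implies_less)
  qed
  thus "T \<in> {T \<in> SYT n. shape T = diagram \<nu>}"
    using T Y sh n by (simp add: SYT_def Tab_def split_paired_all split_paired_All)
next
  fix T assume "T \<in> {T \<in> SYT n. shape T = diagram \<nu>}"
  hence T: "T \<in> SYT n" and sh: "shape T = diagram \<nu>" by auto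
  have n: "sum_list \<nu> = n" using assms by (simp add: is_partition_def)
  have "T b = 0" if "b \<notin> diagram \<nu>" for b using that unfolding sh[symmetric] not_in_shape .
  thus "T \<in> Tab \<nu>"
    using SYT_bij[OF T] SYT_mono'[OF T] by (simp add: Tab_def n sh)
qed

lemma finite_SYT_shape: "finite Y \<Longrightarrow> finite {T \<in> SYT n. shape T = Y}"
proof -
  assume Y: "finite Y"
  have "{T \<in> SYT n. shape T = Y} \<subseteq> {T. \<forall>b. (b \<in> Y \<longrightarrow> T b \<in> {1..n}) \<and> (b \<notin> Y \<longrightarrow> T b = 0)}"
  proof (rule subsetI, rule CollectI, intro allI conjI impI)
    fix T b assume T: "T \<in> {T \<in> SYT n. shape T = Y}"
    show "T b \<in> {1..n}" if "b \<in> Y" using T SYT_bij[of T n] that by (auto simp: bij_betw_def)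
    show "T b = 0" if "b \<notin> Y" using T that not_in_shape[of b T] by simp
  qed
  moreover have "finite \<dots>" by (rule finite_set_of_finite_funs[OF Y]) simp
  ultimately show ?thesis by (rule finite_subset)
qed

lemma finite_Tab: "is_partition n \<nu> \<Longrightarrow> finite (Tab \<nu>)"
  using finite_SYT_shape[OF finite_diagram] by (simp add: Tab_eq_SYT)

lemma box_of_works:
  assumes "T \<in> SYT n" "1 \<le> a" "a \<le> n"
  shows "T (box_of T a) = a" "box_of T a \<in> shape T"
proof -
  have "a \<in> T ` shape T" using SYT_bij[OF assms(1)] assms(2,3) by (simp add: bij_betw_def)
  then obtain b where b: "b \<in> shape T" "T b = a" by auto
  have "box_of T a = b" unfolding box_of_def
    by (rule the_equality) (use b SYT_inj[OF assms(1)] in metis)+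
  thus "T (box_of T a) = a" "box_of T a \<in> shape T" using b by auto
qed

lemma box_of_T: "T \<in> SYT n \<Longrightarrow> b \<in> shape T \<Longrightarrow> box_of T (T b) = b"
  unfolding box_of_def by (rule the_equality) (metis SYT_inj)+

lemma SYT_range: "T \<in> SYT n \<Longrightarrow> b \<in> shape T \<Longrightarrow> 1 \<le> T b \<and> T b \<le> n"
  using SYT_bij[of T n] by (force simp: bij_betw_def)

lemma box_of_adj_transp: "box_of (adj_transp k \<circ> T) a = box_of T (adj_transp k a)"
proof -
  have "(adj_transp k \<circ> T) b = a \<longleftrightarrow> T b = adj_transp k a" for b by (metis adj_transp_involutive comp_apply)
  thus ?thesis by (simp add: box_of_def)
qed

lemma content_adj_transp [simp]: "content (adj_transp k \<circ> T) a = content T (adj_transp k a)"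
  by (simp add: content_def box_of_adj_transp)

lemma shape_adj_transp: "1 \<le> k \<Longrightarrow> shape (adj_transp k \<circ> T) = shape T"
  by (auto simp: shape_def adj_transp_if split: if_splits)

text \<open>If the box of k is weakly north-west of that of k + 1, every other box of the rectangle
  spanned by them would carry an entry strictly between k and k + 1, so the two boxes are adjacent.
  Otherwise they are incomparable: no order condition sees both of them, the swap is standard, and
  rows and columns both differ, which gives content distance at least 2.\<close>

lemma SYT_swap_cases:
  assumes T: "T \<in> SYT n" and k: "1 \<le> k" "k < n"
  obtains (adj) "\<bar>content T (Suc k) - content T k\<bar> = 1"
  | (down) "fst (box_of T k) < fst (box_of T (Suc k))" "snd (box_of T k) > snd (box_of T (Suc k))"
      "content T (Suc k) - content T k \<le> -2" "adj_transp k \<circ> T \<in> SYT n"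
  | (up) "fst (box_of T k) > fst (box_of T (Suc k))" "snd (box_of T k) < snd (box_of T (Suc k))"
      "content T (Suc k) - content T k \<ge> 2" "adj_transp k \<circ> T \<in> SYT n"
proof -
  obtain i j where x: "box_of T k = (i, j)" by force
  obtain i' j' where y: "box_of T (Suc k) = (i', j')" by force
  have X: "(i, j) \<in> shape T" "T (i, j) = k" using box_of_works[OF T, of k] k x by auto
  have Y: "(i', j') \<in> shape T" "T (i', j') = Suc k" using box_of_works[OF T, of "Suc k"] k y by auto
  note yg = SYT_young[OF T]
  have ne: "(i, j) \<noteq> (i', j')" using X(2) Y(2) by auto
  have c: "content T (Suc k) - content T k = (int j' - int i') - (int j - int i)"
    by (simp add: content_def x y superdiagonal_def)
  have nle: "\<not> (i' \<le> i \<and> j' \<le> j)" using SYT_mono'[OF T Y(1) X(1)] ne X Y by auto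
  have ij: "1 \<le> i" "1 \<le> j" using young_pos[OF yg X(1)] by auto
  show ?thesis
  proof (cases "i \<le> i' \<and> j \<le> j'")
    case True
    have mid: "(a, b) = (i, j) \<or> (a, b) = (i', j')" if "i \<le> a" "a \<le> i'" "j \<le> b" "b \<le> j'" for a b
    proof (rule ccontr)
      assume n: "\<not> ?thesis"
      have Z: "(a, b) \<in> shape T" using young_down[OF yg Y(1), of a b] that ij by auto
      have "T (i, j) < T (a, b)" using SYT_mono'[OF T X(1) Z] that n by auto
      moreover have "T (a, b) < T (i', j')" using SYT_mono'[OF T Z Y(1)] that n by auto
      ultimately show False using X Y by simp
    qed
    show ?thesis
    proof (cases "i = i'")
      case True
      hence "j < j'" using ne \<open>i \<le> i' \<and> j \<le> j'\<close> by auto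
      hence "j' = Suc j" using mid[of i "Suc j"] True by auto
      thus ?thesis using True c by (intro adj) simp
    next
      case False
      hence "i' = Suc i \<and> j = j'" using mid[of "Suc i" j] True by auto
      thus ?thesis using c by (intro adj) simp
    qed
  next
    case False
    have sh: "shape (adj_transp k \<circ> T) = shape T" using shape_adj_transp k by simp
    have S: "adj_transp k \<circ> T \<in> SYT n"
      unfolding SYT_def
    proof (intro CollectI conjI ballI impI)
      show "young (shape (adj_transp k \<circ> T))" using yg sh by simp
      show "bij_betw (adj_transp k \<circ> T) (shape (adj_transp k \<circ> T)) {1..n}"
        unfolding sh using SYT_bij[OF T] permutes_imp_bij[OF adj_transp_permutes] k by (intro bij_betw_trans) auto
      fix b d assume bd: "b \<in> shape (adj_transp k \<circ> T)" "d \<in> shape (adj_transp k \<circ> T)"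
        "fst b \<le> fst d" "snd b \<le> snd d" "b \<noteq> d"
      have lt: "T b < T d" using SYT_mono[OF T] bd sh by auto
      have "\<not> (T b = k \<and> T d = Suc k)"
      proof
        assume "T b = k \<and> T d = Suc k"
        hence "b = (i, j)" "d = (i', j')" using SYT_inj[OF T] bd(1,2) sh X Y by auto
        thus False using bd False by simp
      qed
      thus "(adj_transp k \<circ> T) b < (adj_transp k \<circ> T) d" using lt by (auto simp: adj_transp_if)
    qed
    show ?thesis
    proof (cases "i < i'")
      case True
      hence "j > j'" using False by auto
      thus ?thesis using True c S x y by (intro down) auto
    next
      case F: False
      hence "j < j'" "i' < i" using nle ne False by auto
      thus ?thesis using F c S x y by (intro up) auto
    qed
  qed
qed

lemma content_Suc_neq: "T \<in> SYT n \<Longrightarrow> 1 \<le> k \<Longrightarrow> k < n \<Longrightarrow> content T (Suc k) \<noteq> content T k"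
  by (rule SYT_swap_cases[of T n k]) auto

text \<open>If k and k + 2 shared a diagonal, the boxes to the right of and below that of k would
  both have to carry k + 1. This keeps the third denominator in the braid relation away from
  zero.\<close>

lemma content_Suc_Suc_neq:
  assumes T: "T \<in> SYT n" and k: "1 \<le> k" "Suc k < n"
  shows "content T (Suc (Suc k)) \<noteq> content T k"
proof
  assume eq: "content T (Suc (Suc k)) = content T k"
  obtain i j where x: "box_of T k = (i, j)" by force
  obtain i' j' where y: "box_of T (Suc (Suc k)) = (i', j')" by force
  have X: "(i, j) \<in> shape T" "T (i, j) = k" using box_of_works[OF T, of k] k x by auto
  have Y: "(i', j') \<in> shape T" "T (i', j') = Suc (Suc k)"
    using box_of_works[OF T, of "Suc (Suc k)"] k y by auto
  note yg = SYT_young[OF T]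
  have ij: "1 \<le> i" "1 \<le> j" using young_pos[OF yg X(1)] by auto
  have c: "int j' - int i' = int j - int i"
    using eq by (simp add: content_def x y superdiagonal_def)
  have ne: "(i', j') \<noteq> (i, j)" using X(2) Y(2) by auto
  have "\<not> (i' \<le> i \<and> j' \<le> j)" using SYT_mono'[OF T Y(1) X(1)] ne X(2) Y(2) by auto
  hence lt: "i < i'" "j < j'" using c by auto
  have A: "(i, Suc j) \<in> shape T" "(Suc i, j) \<in> shape T"
    using young_down[OF yg Y(1)] lt ij by auto
  have "T (i, Suc j) = Suc k"
    using SYT_mono'[OF T X(1) A(1)] SYT_mono'[OF T A(1) Y(1)] lt X Y by simp
  moreover have "T (Suc i, j) = Suc k"
    using SYT_mono'[OF T X(1) A(2)] SYT_mono'[OF T A(2) Y(1)] lt X Y by simp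
  ultimately show False using SYT_inj[OF T A(1), of "(Suc i, j)"] by simp
qed

section \<open>Young's orthogonal form\<close>

definition ywt :: "int \<Rightarrow> real" where
  "ywt d = sqrt (1 - 1 / (of_int d)\<^sup>2)"

lemma ywt_minus [simp]: "ywt (- d) = ywt d"
  by (simp add: ywt_def)

lemma ywt_swap: "ywt (a - b) = ywt (b - a)"
  using ywt_minus[of "b - a"] by simp

lemma ywt_one: "\<bar>d\<bar> = 1 \<Longrightarrow> ywt d = 0"
  by (auto simp: ywt_def abs_if split: if_splits)

lemma ywt_square: "d \<noteq> 0 \<Longrightarrow> (ywt d)\<^sup>2 = 1 - 1 / (of_int d)\<^sup>2"
proof -
  assume "d \<noteq> 0"
  hence "1 \<le> \<bar>real_of_int d\<bar>" by linarith
  hence "1 \<le> (real_of_int d)\<^sup>2" by (simp add: abs_le_square_iff[of 1, simplified])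
  hence "1 / (real_of_int d)\<^sup>2 \<le> 1" by (simp add: divide_le_eq)
  thus ?thesis by (simp add: ywt_def)
qed

lemma ywt_nonzero: "\<bar>d\<bar> \<ge> 2 \<Longrightarrow> ywt d \<noteq> 0"
proof -
  assume "\<bar>d\<bar> \<ge> 2"
  hence "1 < \<bar>real_of_int d\<bar>" by linarith
  hence "1 < (real_of_int d)\<^sup>2" using abs_square_less_1 by (metis abs_le_square_iff abs_one linorder_not_le one_power2)
  thus ?thesis by (simp add: ywt_def)
qed

text \<open>Young's orthogonal form acts on functions on standard tableaux of all shapes of size \<open>n\<close>
  simultaneously. The formal operator \<open>fop\<close> ignores standardness; it agrees with \<open>yop\<close> on \<open>SYT n\<close>
  because \<open>ywt\<close> vanishes whenever the swapped tableau is not standard.\<close>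

definition fop :: "nat \<Rightarrow> (tableau \<Rightarrow> real) \<Rightarrow> tableau \<Rightarrow> real" where
  "fop k f T = f T / of_int (content T (Suc k) - content T k) +
     ywt (content T (Suc k) - content T k) * f (adj_transp k \<circ> T)"

definition yop :: "nat \<Rightarrow> nat \<Rightarrow> (tableau \<Rightarrow> real) \<Rightarrow> tableau \<Rightarrow> real" where
  "yop n k f T = (if T \<in> SYT n then fop k f T else f T)"

lemma SYT_swap_or_zero:
  assumes "T \<in> SYT n" "1 \<le> k" "k < n"
  shows "adj_transp k \<circ> T \<in> SYT n \<or> ywt (content T (Suc k) - content T k) = 0"
  by (rule SYT_swap_cases[OF assms]) (simp_all add: ywt_one)

lemma fop_cong:
  assumes "T \<in> SYT n" "1 \<le> k" "k < n"
    and "\<And>S. S \<in> SYT n \<Longrightarrow> shape S = shape T \<Longrightarrow> g S = g' S"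
  shows "fop k g T = fop k g' T"
  using SYT_swap_or_zero[OF assms(1-3)] assms(4)[of T] assms(4)[of "adj_transp k \<circ> T"] assms(1,2)
  by (auto simp: fop_def shape_adj_transp)

text \<open>Here x, y, z are the inverse axial distances of the three pairs among k, k + 1, k + 2,
  the w's are the off-diagonal weights, and the f's are the values at the six tableaux obtained by
  permuting these entries. The terms in f12, f21 and f121 agree outright, those in f1 and f2 by x y
  = z (x + y), and that in f0 by this relation together with the two for the squared
  weights.\<close>

lemma braid_identity:
  fixes x y z wx wy wz :: real
  assumes "x * y = z * (x + y)" "wx\<^sup>2 = 1 - x\<^sup>2" "wy\<^sup>2 = 1 - y\<^sup>2"
  shows "x * (y * (x * f0 + wx * f1) + wy * (z * f2 + wz * f12)) +
      wx * (z * (- x * f1 + wx * f0) + wz * (y * f21 + wy * f121)) =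
    y * (x * (y * f0 + wy * f2) + wx * (z * f1 + wz * f21)) +
      wy * (z * (- y * f2 + wy * f0) + wz * (x * f12 + wx * f121))"
    (is "?L = ?R")
proof -
  have "?L - ?R = f0 * (x * (x * y) + wx\<^sup>2 * z - y * (x * y) - wy\<^sup>2 * z) +
      f1 * wx * (x * y - z * (x + y)) - f2 * wy * (x * y - z * (x + y))"
    by (simp add: algebra_simps power2_eq_square)
  also have "\<dots> = 0" unfolding assms by (simp add: algebra_simps power2_eq_square)
  finally show ?thesis by simp
qed

lemma sum_of_inverses:
  fixes a b c :: real
  assumes "a \<noteq> b" "b \<noteq> c" "a \<noteq> c"
  shows "1 / (b - a) * (1 / (c - b)) = 1 / (c - a) * (1 / (b - a) + 1 / (c - b))"
proof -
  have "b - a \<noteq> 0" "c - b \<noteq> 0" "c - a \<noteq> 0" using assms by auto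
  thus ?thesis by (simp add: divide_simps)
qed

lemma adj_transp_braid:
  "1 \<le> k \<Longrightarrow> adj_transp k \<circ> (adj_transp (Suc k) \<circ> (adj_transp k \<circ> T)) =
   adj_transp (Suc k) \<circ> (adj_transp k \<circ> (adj_transp (Suc k) \<circ> T))"
  using coxeter_action.braid[OF coxeter_action_adj_transp, of k "Suc (Suc k)"] by (simp add: fun_eq_iff)

lemma adj_transp_commute:
  "1 \<le> k \<Longrightarrow> Suc k < l \<Longrightarrow> adj_transp k \<circ> (adj_transp l \<circ> T) = adj_transp l \<circ> (adj_transp k \<circ> T)"
  using coxeter_action.commute[OF coxeter_action_adj_transp, of k l "Suc l"] by (simp add: fun_eq_iff)

lemma fop_braid:
  assumes T: "T \<in> SYT n" "1 \<le> k" "Suc k < n"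
  shows "fop k (fop (Suc k) (fop k f)) T = fop (Suc k) (fop k (fop (Suc k) f)) T"
proof -
  define a b c where "a = content T k" and "b = content T (Suc k)" and "c = content T (Suc (Suc k))"
  have ne: "a \<noteq> b" "b \<noteq> c" "a \<noteq> c"
    using content_Suc_neq[of T n k] content_Suc_neq[of T n "Suc k"] content_Suc_Suc_neq[of T n k] T
    by (auto simp: a_def b_def c_def)
  define x y z where "x = 1 / real_of_int (b - a)" and "y = 1 / real_of_int (c - b)"
    and "z = 1 / real_of_int (c - a)"
  have xyz: "x * y = z * (x + y)"
    using sum_of_inverses[of "real_of_int a" b c] ne by (simp add: x_def y_def z_def)
  have wx: "(ywt (b - a))\<^sup>2 = 1 - x\<^sup>2" and wy: "(ywt (c - b))\<^sup>2 = 1 - y\<^sup>2"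
    using ywt_square[of "b - a"] ywt_square[of "c - b"] ne by (auto simp: x_def y_def power_divide)
  have dv: "t / real_of_int (b - a) = x * t" "t / real_of_int (c - b) = y * t" "t / real_of_int (c - a) = z * t"
    "t / real_of_int (a - b) = - x * t" "t / real_of_int (b - c) = - y * t" for t
    using minus_divide_right[of t "real_of_int (b - a)"] minus_divide_right[of t "real_of_int (c - b)"]
    by (simp_all add: x_def y_def z_def)
  show ?thesis
    using braid_identity[OF xyz wx wy, of "f T" "f (adj_transp k \<circ> T)" "f (adj_transp (Suc k) \<circ> T)"
      "ywt (c - a)" "f (adj_transp k \<circ> (adj_transp (Suc k) \<circ> T))"
      "f (adj_transp (Suc k) \<circ> (adj_transp k \<circ> T))"
      "f (adj_transp k \<circ> (adj_transp (Suc k) \<circ> (adj_transp k \<circ> T)))"]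
    by (simp add: fop_def adj_transp_comp_assoc dv ywt_swap[of a b] ywt_swap[of b c]
        flip: a_def b_def c_def adj_transp_braid[OF T(2)] del: of_int_diff)
qed

lemma fop_involutive:
  assumes "T \<in> SYT n" "1 \<le> k" "k < n"
  shows "fop k (fop k f) T = f T"
proof -
  define d where "d = content T (Suc k) - content T k"
  have d: "d \<noteq> 0" using content_Suc_neq[OF assms] by (simp add: d_def)
  have m: "content T k - content T (Suc k) = - d" by (simp add: d_def)
  have "fop k (fop k f) T = f T * (1 / (of_int d)\<^sup>2 + (ywt d)\<^sup>2)"
    by (simp add: fop_def adj_transp_comp_assoc m flip: d_def)
       (simp add: field_simps power2_eq_square add_divide_distrib)
  thus ?thesis using ywt_square[OF d] by simp
qed

lemma fop_commute:
  assumes "1 \<le> k" "Suc k < l"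
  shows "fop k (fop l f) T = fop l (fop k f) T"
  using assms adj_transp_commute[OF assms, of T] by (simp add: fop_def divide_inverse algebra_simps)

lemma yop_SYT: "T \<in> SYT n \<Longrightarrow> yop n k f T = fop k f T"
  by (simp add: yop_def)

lemma yop_yop:
  "T \<in> SYT n \<Longrightarrow> 1 \<le> k \<Longrightarrow> k < n \<Longrightarrow> yop n k (yop n l f) T = fop k (fop l f) T"
  using fop_cong[of T n k "yop n l f" "fop l f"] by (simp add: yop_SYT)

lemma coxeter_yop: "coxeter_action (yop n) n"
proof
  fix k f assume k: "1 \<le> k" "k < n"
  show "yop n k (yop n k f) = f"
  proof
    fix T show "yop n k (yop n k f) T = f T"
      using k by (cases "T \<in> SYT n") (simp_all add: yop_yop fop_involutive, simp add: yop_def)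
  qed
next
  fix k f assume k: "1 \<le> k" "Suc k < n"
  have 3: "yop n a (yop n b (yop n c f)) T = fop a (fop b (fop c f)) T"
    if "T \<in> SYT n" "1 \<le> a" "a < n" "1 \<le> b" "b < n" for a b c T
    using fop_cong[OF that(1-3), of "yop n b (yop n c f)" "fop b (fop c f)"] yop_yop[OF _ that(4,5)] that(1)
    by (simp add: yop_SYT[of T])
  show "yop n k (yop n (Suc k) (yop n k f)) = yop n (Suc k) (yop n k (yop n (Suc k) f))"
  proof
    fix T show "yop n k (yop n (Suc k) (yop n k f)) T = yop n (Suc k) (yop n k (yop n (Suc k) f)) T"
    proof (cases "T \<in> SYT n")
      case True
      thus ?thesis using k fop_braid[of T n k f] by (simp add: 3)
    qed (simp add: yop_def)
  qed
next
  fix k l f assume k: "1 \<le> k" "Suc k < l" "l < n"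
  show "yop n k (yop n l f) = yop n l (yop n k f)"
  proof
    fix T show "yop n k (yop n l f) T = yop n l (yop n k f) T"
      using k fop_commute[of k l f T] by (cases "T \<in> SYT n") (simp_all add: yop_yop, simp add: yop_def)
  qed
qed

section \<open>The representation generated by these operators and its matrix coefficients\<close>

definition yrep :: "nat \<Rightarrow> (nat \<Rightarrow> nat) \<Rightarrow> (tableau \<Rightarrow> real) \<Rightarrow> tableau \<Rightarrow> real" where
  "yrep n = cox_ext (yop n) n"

lemma yrep_id: "yrep n id = id"
  by (simp add: yrep_def cox_ext_id)

lemma yrep_step:
  "\<sigma> permutes {1..n} \<Longrightarrow> 1 \<le> k \<Longrightarrow> k < n \<Longrightarrow> yrep n (adj_transp k \<circ> \<sigma>) f = yop n k (yrep n \<sigma> f)"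
  using coxeter_action.cox_ext_step[OF coxeter_yop, of n n \<sigma> k] by (simp add: yrep_def)

lemma yrep_gen: "1 \<le> k \<Longrightarrow> k < n \<Longrightarrow> yrep n (adj_transp k) f = yop n k f"
  using yrep_step[of id n k f] by (simp add: permutes_id yrep_id)

lemma yrep_comp:
  assumes "\<sigma> permutes {1..n}" "\<tau> permutes {1..n}"
  shows "yrep n (\<sigma> \<circ> \<tau>) f = yrep n \<sigma> (yrep n \<tau> f)"
  using assms(1)
proof (induction rule: sym_group_generated)
  case id
  have "yrep n (id \<circ> \<tau>) f = yrep n id (yrep n \<tau> f)" by (simp add: yrep_id)
  thus ?case .
next
  case (step k \<sigma>)
  have "yrep n (adj_transp k \<circ> (\<sigma> \<circ> \<tau>)) f = yrep n (adj_transp k \<circ> \<sigma>) (yrep n \<tau> f)"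
    using step(4) by (simp only: yrep_step[OF permutes_compose[OF assms(2) step(3)] step(1,2)]
        yrep_step[OF step(3) step(1,2)])
  thus ?case unfolding comp_assoc .
qed

definition ST :: "nat \<Rightarrow> (nat \<times> nat) set \<Rightarrow> tableau set" where
  "ST n Y = {T \<in> SYT n. shape T = Y}"

lemma finite_ST: "finite (ST n Y)"
proof (cases "ST n Y = {}")
  case False
  then obtain T where "T \<in> SYT n" "shape T = Y" by (auto simp: ST_def)
  hence "finite Y" using young_finite[OF SYT_young] by auto
  thus ?thesis using finite_SYT_shape by (simp add: ST_def)
qed simp

lemma Tab_ST: "is_partition n \<nu> \<Longrightarrow> Tab \<nu> = ST n (diagram \<nu>)"
  by (simp add: Tab_eq_SYT ST_def)

lemma ST_swap: "S \<in> ST n Y \<Longrightarrow> 1 \<le> k \<Longrightarrow> adj_transp k \<circ> S \<in> SYT n \<Longrightarrow> adj_transp k \<circ> S \<in> ST n Y"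
  by (simp add: ST_def shape_adj_transp)

definition delta :: "tableau \<Rightarrow> tableau \<Rightarrow> real" where
  "delta T = (\<lambda>S. if S = T then 1 else 0)"

text \<open>The coefficient from the basis vector of \<open>T\<close> to that of \<open>S\<close>,
  for tableaux of arbitrary shapes. It vanishes between different shapes, so the matrices of single
  representations and of their direct sums are all restrictions of this one kernel.\<close>

definition yker :: "nat \<Rightarrow> (nat \<Rightarrow> nat) \<Rightarrow> tableau \<Rightarrow> tableau \<Rightarrow> real" where
  "yker n \<sigma> S T = yrep n \<sigma> (delta T) S"

lemma yker_id: "yker n id S T = (if S = T then 1 else 0)"
  by (simp add: yker_def yrep_id delta_def)

text \<open>An admissible swap keeps the shape, and a swap that leaves the standard tableaux has
  weight zero; hence the value at \<open>S\<close> involves tableaux of its shape only.\<close>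

lemma yrep_expand:
  assumes "\<sigma> permutes {1..n}"
  shows "S \<in> ST n Y \<Longrightarrow> yrep n \<sigma> f S = (\<Sum>U\<in>ST n Y. yker n \<sigma> S U * f U)"
  using assms
proof (induction arbitrary: S rule: sym_group_generated)
  case id
  have "(\<Sum>U\<in>ST n Y. (if S = U then 1 else 0) * f U) = (\<Sum>U\<in>ST n Y. if S = U then f U else 0)"
    by (intro sum.cong) auto
  hence "yrep n id f S = (\<Sum>U\<in>ST n Y. yker n id S U * f U)"
    using id by (simp add: yker_id yrep_id finite_ST)
  thus ?case .
next
  case (step k \<sigma>)
  define d where "d = content S (Suc k) - content S k"
  have S: "S \<in> SYT n" using step.prems by (simp add: ST_def)
  have E: "yrep n (adj_transp k \<circ> \<sigma>) g S =
      yrep n \<sigma> g S / of_int d + ywt d * yrep n \<sigma> g (adj_transp k \<circ> S)" for g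
    using step S by (simp add: yrep_step yop_SYT fop_def d_def)
  have I: "ywt d * yrep n \<sigma> f (adj_transp k \<circ> S) =
      ywt d * (\<Sum>U\<in>ST n Y. yker n \<sigma> (adj_transp k \<circ> S) U * f U)"
    using SYT_swap_or_zero[OF S step(1,2)] ST_swap[OF step.prems step(1)] step.IH
    by (auto simp: d_def)
  have "yrep n (adj_transp k \<circ> \<sigma>) f S =
     (\<Sum>U\<in>ST n Y. yker n \<sigma> S U * f U) / of_int d + ywt d * (\<Sum>U\<in>ST n Y. yker n \<sigma> (adj_transp k \<circ> S) U * f U)"
    using E[of f] I step.IH[OF step.prems] by simp
  also have "\<dots> = (\<Sum>U\<in>ST n Y. (yker n \<sigma> S U / of_int d + ywt d * yker n \<sigma> (adj_transp k \<circ> S) U) * f U)"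
    by (simp add: sum_divide_distrib sum_distrib_left sum.distrib distrib_right mult.assoc)
  also have "\<dots> = (\<Sum>U\<in>ST n Y. yker n (adj_transp k \<circ> \<sigma>) S U * f U)"
    using E by (simp add: yker_def)
  finally show ?case .
qed

lemma yker_comp:
  assumes "\<sigma> permutes {1..n}" "\<tau> permutes {1..n}" "S \<in> ST n Y"
  shows "yker n (\<sigma> \<circ> \<tau>) S T = (\<Sum>U\<in>ST n Y. yker n \<sigma> S U * yker n \<tau> U T)"
  unfolding yker_def[of n "\<sigma> \<circ> \<tau>"] yrep_comp[OF assms(1,2)] yrep_expand[OF assms(1,3)] yker_def[of n \<tau>] ..

lemma yker_shape:
  assumes "\<sigma> permutes {1..n}" "S \<in> SYT n" "shape S \<noteq> shape T"
  shows "yker n \<sigma> S T = 0"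
proof -
  have "S \<in> ST n (shape S)" using assms by (simp add: ST_def)
  hence "yker n \<sigma> S T = (\<Sum>U\<in>ST n (shape S). yker n \<sigma> S U * delta T U)"
    unfolding yker_def[of n \<sigma> S T] by (rule yrep_expand[OF assms(1)])
  also have "\<dots> = 0" using assms(3) by (intro sum.neutral) (auto simp: delta_def ST_def)
  finally show ?thesis .
qed

lemma adj_transp_comp_neq: "T \<in> SYT n \<Longrightarrow> 1 \<le> k \<Longrightarrow> k < n \<Longrightarrow> adj_transp k \<circ> T \<noteq> T"
  using box_of_works(1)[of T n k] by (auto dest: fun_cong[of _ _ "box_of T k"])

lemma yker_gen:
  assumes "1 \<le> k" "k < n" "S \<in> SYT n"
  shows "yker n (adj_transp k) S T = (if S = T then 1 / of_int (content T (Suc k) - content T k) else 0) +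
    (if S = adj_transp k \<circ> T then ywt (content T (Suc k) - content T k) else 0)"
proof -
  have "adj_transp k \<circ> S = T \<longleftrightarrow> S = adj_transp k \<circ> T" using adj_transp_comp_assoc by metis
  moreover have "adj_transp k \<circ> (adj_transp k \<circ> T) = T" by (rule adj_transp_comp_assoc)
  ultimately show ?thesis using assms adj_transp_comp_neq[OF assms(3,1,2)]
    by (auto simp: yker_def yrep_gen yop_SYT fop_def delta_def ywt_swap[of "content T k"])
qed

lemma yker_gen_sym:
  assumes "1 \<le> k" "k < n" "S \<in> SYT n" "T \<in> SYT n"
  shows "yker n (adj_transp k) S T = yker n (adj_transp k) T S"
proof -
  have "S = adj_transp k \<circ> T \<longleftrightarrow> T = adj_transp k \<circ> S" using adj_transp_comp_assoc by metis
  thus ?thesis using assms by (auto simp: yker_gen ywt_swap[of "content T k"])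
qed

lemma inv_adj_transp: "inv' (adj_transp k) = adj_transp k"
  by (rule inv_unique_comp) (auto simp: adj_transp_comp_self)

lemma inv_adj_transp_comp: "\<sigma> permutes {1..n} \<Longrightarrow> inv' (adj_transp k \<circ> \<sigma>) = inv' \<sigma> \<circ> adj_transp k"
  by (simp add: o_inv_distrib bij_adj_transp permutes_bij inv_adj_transp)

text \<open>Orthogonality of the representation: each generator is an involution with a symmetric
  matrix, and inverting a product reverses the word just as transposing the matrix does.\<close>

lemma yker_inv:
  assumes "\<sigma> permutes {1..n}" "S \<in> ST n Y" "T \<in> ST n Y"
  shows "yker n (inv' \<sigma>) S T = yker n \<sigma> T S"
  using assms
proof (induction arbitrary: S T rule: sym_group_generated)
  case id
  have "yker n (inv' id) S T = yker n id T S" by (auto simp: yker_id)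
  thus ?case .
next
  case (step k \<sigma>)
  have "yker n (inv' (adj_transp k \<circ> \<sigma>)) S T = (\<Sum>U\<in>ST n Y. yker n (inv' \<sigma>) S U * yker n (adj_transp k) U T)"
    unfolding inv_adj_transp_comp[OF step(3)]
    by (rule yker_comp[OF permutes_inv[OF step(3)] adj_transp_permutes[OF step(1,2)] step(5)])
  also have "\<dots> = (\<Sum>U\<in>ST n Y. yker n (adj_transp k) T U * yker n \<sigma> U S)"
    using step yker_gen_sym[OF step(1,2), of _ T] by (intro sum.cong) (auto simp: ST_def)
  also have "\<dots> = yker n (adj_transp k \<circ> \<sigma>) T S"
    by (rule yker_comp[symmetric, OF adj_transp_permutes[OF step(1,2)] step(3) step(6)])
  finally show ?case .
qed

section \<open>Adding and removing the largest entry\<close>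

lemma extend_ST:
  assumes R: "R \<in> ST m Y" and b: "b \<notin> Y" "young (insert b Y)"
  shows "R(b := Suc m) \<in> ST (Suc m) (insert b Y)"
proof -
  have R': "R \<in> SYT m" "shape R = Y" using R by (auto simp: ST_def)
  have sh: "shape (R(b := Suc m)) = insert b Y" using R'(2) by (auto simp: shape_def)
  have bij: "bij_betw (R(b := Suc m)) (insert b Y) {1..Suc m}"
  proof -
    have "bij_betw (R(b := Suc m)) Y {1..m}"
      using SYT_bij[OF R'(1)] b(1) R'(2) by (subst bij_betw_cong[of _ _ R]) auto
    hence "bij_betw (R(b := Suc m)) (Y \<union> {b}) ({1..m} \<union> {(R(b := Suc m)) b})"
      using b(1) by (intro notIn_Un_bij_betw) auto
    moreover have "{1..m} \<union> {(R(b := Suc m)) b} = {1..Suc m}" by auto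
    ultimately show ?thesis by simp
  qed
  have mono: "(R(b := Suc m)) c < (R(b := Suc m)) d"
    if "c \<in> insert b Y" "d \<in> insert b Y" "fst c \<le> fst d" "snd c \<le> snd d" "c \<noteq> d" for c d
  proof (cases "c = b")
    case True
    hence d: "d \<in> Y" using that by auto
    have "b \<in> Y" using young_down[OF SYT_young[OF R'(1)], of "fst d" "snd d" "fst b" "snd b"]
        young_pos[OF b(2), of "fst b" "snd b"] d that True R'(2) by simp
    thus ?thesis using b by simp
  next
    case False
    hence c: "c \<in> Y" using that by auto
    hence "R c \<le> m" using SYT_range[OF R'(1)] R'(2) by auto
    thus ?thesis using SYT_mono[OF R'(1), of c d] c that False R'(2) by auto
  qed
  show ?thesis using sh bij mono b(2) by (simp add: ST_def SYT_def)
qed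

lemma restrict_ST:
  assumes T: "T \<in> ST (Suc m) Z"
  defines "b \<equiv> box_of T (Suc m)"
  shows "T(b := 0) \<in> ST m (Z - {b})" "b \<in> Z" "(T(b := 0))(b := Suc m) = T"
proof -
  have T': "T \<in> SYT (Suc m)" "shape T = Z" using T by (auto simp: ST_def)
  have b: "T b = Suc m" "b \<in> Z" using box_of_works[OF T'(1), of "Suc m"] T'(2) by (auto simp: b_def)
  show "b \<in> Z" by (rule b)
  show "(T(b := 0))(b := Suc m) = T" using b by auto
  have yg: "young Z" using SYT_young[OF T'(1)] T'(2) by simp
  have sh: "shape (T(b := 0)) = Z - {b}" using T'(2) by (auto simp: shape_def)
  have max: "\<not> (fst b \<le> fst c \<and> snd b \<le> snd c)" if "c \<in> Z" "c \<noteq> b" for c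
    using SYT_mono[OF T'(1), of b c] SYT_range[OF T'(1), of c] that b T'(2) by auto
  have y2: "young (Z - {b})"
  proof (rule youngI)
    show "finite (Z - {b})" using young_finite[OF yg] by simp
    show "1 \<le> i \<and> 1 \<le> j" if "(i, j) \<in> Z - {b}" for i j using young_pos[OF yg] that by blast
    show "(i - 1, j) \<in> Z - {b}" if "(i, j) \<in> Z - {b}" "1 < i" for i j
      using young_down[OF yg, of i j "i - 1" j] young_pos[OF yg, of i j] max[of "(i, j)"] that by auto
    show "(i, j - 1) \<in> Z - {b}" if "(i, j) \<in> Z - {b}" "1 < j" for i j
      using young_down[OF yg, of i j i "j - 1"] young_pos[OF yg, of i j] max[of "(i, j)"] that by auto
  qed
  have "bij_betw T (Z - {b}) ({1..Suc m} - {Suc m})"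
    using SYT_bij[OF T'(1)] b T'(2) by (intro bij_betw_DiffI) auto
  moreover have "{1..Suc m} - {Suc m} = {1..m}" by auto
  ultimately have "bij_betw (T(b := 0)) (Z - {b}) {1..m}"
    by (subst bij_betw_cong[of _ _ T]) auto
  thus "T(b := 0) \<in> ST m (Z - {b})"
    using sh y2 SYT_mono[OF T'(1)] T'(2) by (simp add: ST_def SYT_def)
qed

lemma box_of_extend:
  assumes R: "R \<in> ST m Y" and b: "b \<notin> Y" "young (insert b Y)"
  shows "box_of (R(b := Suc m)) (Suc m) = b"
    and "1 \<le> a \<Longrightarrow> a \<le> m \<Longrightarrow> box_of (R(b := Suc m)) a = box_of R a"
proof -
  have S: "R(b := Suc m) \<in> SYT (Suc m)" "shape (R(b := Suc m)) = insert b Y"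
    using extend_ST[OF R b] by (auto simp: ST_def)
  show "box_of (R(b := Suc m)) (Suc m) = b" using box_of_T[OF S(1), of b] S(2) by simp
  assume a: "1 \<le> a" "a \<le> m"
  have R': "R \<in> SYT m" "shape R = Y" using R by (auto simp: ST_def)
  have w: "R (box_of R a) = a" "box_of R a \<in> Y" using box_of_works[OF R'(1) a] R'(2) by auto
  hence "(R(b := Suc m)) (box_of R a) = a" using b(1) by auto
  thus "box_of (R(b := Suc m)) a = box_of R a" using box_of_T[OF S(1), of "box_of R a"] S(2) w by simp
qed

lemma extend_inj:
  assumes "R \<in> ST m Y" "R' \<in> ST m Y" "b \<notin> Y" "R(b := c) = R'(b := c)"
  shows "R = R'"
proof
  fix x
  have "R b = 0" "R' b = 0" using assms(1-3) not_in_shape[of b] by (auto simp: ST_def)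
  thus "R x = R' x" using fun_cong[OF assms(4), of x] by (cases "x = b") auto
qed

lemma young_remove:
  assumes "young Y" "Y \<noteq> {}"
  obtains b where "b \<in> Y" "young (Y - {b})"
proof -
  note fin = young_finite[OF assms(1)]
  have "\<exists>b\<in>Y. \<forall>c\<in>Y. fst c + snd c \<le> fst b + snd b"
    using Max_in[of "(\<lambda>c. fst c + snd c) ` Y"] Max_ge[of "(\<lambda>c. fst c + snd c) ` Y"] assms(2) fin
    by (metis (no_types, lifting) finite_imageI image_iff image_is_empty)
  then obtain b where b: "b \<in> Y" "\<And>c. c \<in> Y \<Longrightarrow> fst c + snd c \<le> fst b + snd b" by auto
  have "young (Y - {b})"
  proof (rule youngI)
    show "finite (Y - {b})" using fin by simp
    show "1 \<le> i \<and> 1 \<le> j" if "(i, j) \<in> Y - {b}" for i j using young_pos[OF assms(1)] that by blast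
    show "(i - 1, j) \<in> Y - {b}" if "(i, j) \<in> Y - {b}" "1 < i" for i j
      using young_down[OF assms(1), of i j "i - 1" j] young_pos[OF assms(1), of i j] b(2)[of "(i, j)"] that by auto
    show "(i, j - 1) \<in> Y - {b}" if "(i, j) \<in> Y - {b}" "1 < j" for i j
      using young_down[OF assms(1), of i j i "j - 1"] young_pos[OF assms(1), of i j] b(2)[of "(i, j)"] that by auto
  qed
  thus ?thesis using b that by blast
qed

lemma ST_nonempty:
  assumes "young Y"
  shows "ST (card Y) Y \<noteq> {}"
  using assms
proof (induction "card Y" arbitrary: Y)
  case 0
  hence "Y = {}" using young_finite by fastforce
  hence "(\<lambda>_. 0) \<in> ST (card Y) Y" by (auto simp: ST_def SYT_def shape_def young_def bij_betw_def)
  thus ?case by auto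
next
  case (Suc m)
  hence "Y \<noteq> {}" by auto
  then obtain b where b: "b \<in> Y" "young (Y - {b})" using young_remove Suc.prems by blast
  have "card (Y - {b}) = m" using Suc.hyps(2) b by simp
  then obtain R where "R \<in> ST m (Y - {b})" using Suc.hyps(1)[of "Y - {b}"] b by auto
  hence "R(b := Suc m) \<in> ST (Suc m) (insert b (Y - {b}))"
    using Suc.prems b by (intro extend_ST) (auto simp: insert_absorb)
  thus ?case using Suc.hyps(2) b by (auto simp: insert_absorb)
qed

lemma d_tab_pos: "is_partition n \<nu> \<Longrightarrow> 0 < d_tab \<nu>"
  using ST_nonempty[OF young_diagram, of n \<nu>] card_diagram[of \<nu>] finite_ST[of n "diagram \<nu>"]
  by (simp add: d_tab_def Tab_ST is_partition_def card_gt_0_iff)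

text \<open>The branching rule: an entry m + 1 in a fixed box changes neither the contents of 1,
  ..., m nor the effect of swapping two of them, so the generators with k < m act on the extended
  tableaux as on the small ones.\<close>

lemma yrep_restrict:
  assumes h: "h permutes {1..m}" and b: "b \<notin> Y" "young (insert b Y)"
  shows "R \<in> ST m Y \<Longrightarrow> yrep (Suc m) h f (R(b := Suc m)) = yrep m h (\<lambda>R. f (R(b := Suc m))) R"
  using h
proof (induction arbitrary: R rule: sym_group_generated)
  case id
  have "yrep (Suc m) id f (R(b := Suc m)) = yrep m id (\<lambda>R. f (R(b := Suc m))) R"
    by (simp add: yrep_id)
  thus ?case .
next
  case (step k h)
  let ?e = "\<lambda>R. R(b := Suc m)"
  note R = \<open>R \<in> ST m Y\<close>
  have R': "R \<in> SYT m" using R by (simp add: ST_def)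
  have eR: "?e R \<in> SYT (Suc m)" using extend_ST[OF R b] by (simp add: ST_def)
  have c: "content (?e R) k = content R k" "content (?e R) (Suc k) = content R (Suc k)"
    using box_of_extend[OF R b] step(1,2) by (simp_all add: content_def)
  have sw: "adj_transp k \<circ> ?e R = ?e (adj_transp k \<circ> R)" using step(1,2) by (auto simp: fun_eq_iff)
  have "yrep (Suc m) (adj_transp k \<circ> h) f (?e R) = fop k (yrep (Suc m) h f) (?e R)"
    using step(1,2) eR by (simp add: yrep_step[OF permutes_mono_top[OF step(3)]] yop_SYT)
  also have "\<dots> = fop k (\<lambda>R. yrep (Suc m) h f (?e R)) R"
    by (simp only: fop_def c sw)
  also have "\<dots> = fop k (yrep m h (\<lambda>R. f (?e R))) R"
    by (rule fop_cong[OF R' step(1,2)], rule step(4)) (use R in \<open>simp add: ST_def\<close>)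
  also have "\<dots> = yrep m (adj_transp k \<circ> h) (\<lambda>R. f (?e R)) R"
    using step(1,2) R' by (simp add: yrep_step[OF step(3)] yop_SYT)
  finally show ?case .
qed

lemma yker_restrict:
  assumes h: "h permutes {1..m}" and b: "b \<notin> Y" "young (insert b Y)" and R: "R \<in> ST m Y"
  shows "yker (Suc m) h (R(b := Suc m)) T =
    (\<Sum>R'\<in>ST m Y. yker m h R R' * (if T = R'(b := Suc m) then 1 else 0))"
  unfolding yker_def[of "Suc m"] yrep_restrict[OF h b R] yrep_expand[OF h R]
  by (intro sum.cong) (auto simp: delta_def)

section \<open>Matrices indexed by finite sets\<close>

text \<open>\<open>mat_on\<close> for arbitrary scalars: the eigenprojections may have complex
  entries.\<close>

definition kmat :: "'i set \<Rightarrow> 'j set \<Rightarrow> ('i \<Rightarrow> 'j \<Rightarrow> 'a) \<Rightarrow> 'a mat" where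
  "kmat A B K = mat (card A) (card B) (\<lambda>(i, j). K (from_nat_into A i) (from_nat_into B j))"

lemma mat_on_kmat: "mat_on A B K = kmat A B K"
  by (simp add: mat_on_def kmat_def)

lemma kmat_carrier [simp]: "kmat A B K \<in> carrier_mat (card A) (card B)"
  by (simp add: kmat_def)

lemma from_nat_into_card: "i < card A \<Longrightarrow> from_nat_into A i \<in> A"
  by (metis card.empty from_nat_into not_less_zero)

lemma kmat_cong: "(\<And>a b. a \<in> A \<Longrightarrow> b \<in> B \<Longrightarrow> K a b = K' a b) \<Longrightarrow> kmat A B K = kmat A B K'"
  unfolding kmat_def by (intro cong_mat) (auto simp: from_nat_into_card)

lemma kmat_index:
  assumes "finite A" "finite B" "a \<in> A" "b \<in> B"
  shows "kmat A B K $$ (to_nat_on A a, to_nat_on B b) = K a b"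
    "to_nat_on A a < card A" "to_nat_on B b < card B"
proof -
  show "to_nat_on A a < card A" "to_nat_on B b < card B"
    using to_nat_on_finite[OF assms(1)] to_nat_on_finite[OF assms(2)] assms(3,4)
    by (auto simp: bij_betw_def)
  thus "kmat A B K $$ (to_nat_on A a, to_nat_on B b) = K a b"
    using assms by (simp add: kmat_def countable_finite)
qed

lemma entry_on_kmat:
  "finite A \<Longrightarrow> finite B \<Longrightarrow> a \<in> A \<Longrightarrow> b \<in> B \<Longrightarrow> entry_on A B (kmat A B K) a b = K a b"
  by (simp add: entry_on_def kmat_index)

lemma kmat_eqD:
  "kmat A B K = kmat A B K' \<Longrightarrow> finite A \<Longrightarrow> finite B \<Longrightarrow> a \<in> A \<Longrightarrow> b \<in> B \<Longrightarrow> K a b = K' a b"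
  using kmat_index(1) by metis

lemma sum_from_nat_into: "finite A \<Longrightarrow> (\<Sum>i = 0..<card A. f (from_nat_into A i)) = sum f A"
  using sum.reindex_bij_betw[OF bij_betw_from_nat_into_finite, of A f] by (simp add: lessThan_atLeast0)

lemma kmat_mult:
  fixes K :: "'i \<Rightarrow> 'j \<Rightarrow> 'a::comm_ring_1"
  assumes "finite B"
  shows "kmat A B K * kmat B C M = kmat A C (\<lambda>a c. \<Sum>b\<in>B. K a b * M b c)"
  by (rule eq_matI)
    (auto simp: kmat_def scalar_prod_def sum_from_nat_into[OF assms, of "\<lambda>b. K _ b * M b _"])

lemma kmat_one:
  assumes "finite A"
  shows "1\<^sub>m (card A) = kmat A A (\<lambda>a b. if a = b then 1 else 0 :: 'a::comm_ring_1)"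
proof (rule eq_matI)
  fix i j assume "i < dim_row (kmat A A (\<lambda>a b. if a = b then 1 else 0 :: 'a))"
    "j < dim_col (kmat A A (\<lambda>a b. if a = b then 1 else 0 :: 'a))"
  moreover have "inj_on (from_nat_into A) {..<card A}"
    using bij_betw_from_nat_into_finite[OF assms] by (simp add: bij_betw_def)
  ultimately show "1\<^sub>m (card A) $$ (i, j) = kmat A A (\<lambda>a b. if a = b then 1 else 0) $$ (i, j)"
    by (auto simp: kmat_def inj_on_def)
qed (simp_all add: kmat_def)

lemma mat_adjoint_mat:
  "mat_adjoint M = mat (dim_col M) (dim_row M) (\<lambda>(i, j). conjugate (M $$ (j, i)))"
  by (rule eq_matI) (auto simp: mat_adjoint_def mat_of_rows_def)

lemma kmat_adjoint: "mat_adjoint (kmat A B K) = kmat B A (\<lambda>b a. conjugate (K a b))"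
  by (rule eq_matI) (auto simp: mat_adjoint_mat kmat_def)

lemma kmat_smult: "c \<cdot>\<^sub>m kmat A B K = kmat A B (\<lambda>a b. c * K a b)"
  by (rule eq_matI) (auto simp: kmat_def)

lemma map_mat_kmat: "map_mat f (kmat A B K) = kmat A B (\<lambda>a b. f (K a b))"
  by (rule eq_matI) (auto simp: kmat_def)

section \<open>The representation matrices\<close>

lemma kmat_yker_mult:
  assumes "\<sigma> permutes {1..n}" "\<tau> permutes {1..n}"
  shows "kmat (ST n Y) (ST n Y) (yker n \<sigma>) * kmat (ST n Y) (ST n Y) (yker n \<tau>) =
    kmat (ST n Y) (ST n Y) (yker n (\<sigma> \<circ> \<tau>))"
  unfolding kmat_mult[OF finite_ST] by (intro kmat_cong) (simp add: yker_comp[OF assms])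

lemma young_gen_eq:
  assumes "is_partition n \<nu>" "1 \<le> k" "k < n"
  shows "young_gen \<nu> k = kmat (Tab \<nu>) (Tab \<nu>) (yker n (adj_transp k))"
  unfolding young_gen_def mat_on_kmat
proof (rule kmat_cong)
  fix S T assume "S \<in> Tab \<nu>" "T \<in> Tab \<nu>"
  hence ST: "S \<in> SYT n" "T \<in> SYT n" by (auto simp: Tab_eq_SYT[OF assms(1)])
  show "(if S = T then 1 / real_of_int (D_tab T (Suc k) k)
     else if S = adj_transp k \<circ> T then sqrt (1 - 1 / (real_of_int (D_tab T (Suc k) k))\<^sup>2) else 0) =
     yker n (adj_transp k) S T"
    using adj_transp_comp_neq[OF ST(2) assms(2,3)] ST assms
    by (auto simp: yker_gen D_tab_content ywt_def)
qed

text \<open>Discharges the definite description. Existence is the Coxeter presentation; a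
  homomorphism is determined by its values on the generators and at \<open>id\<close>, and
  extensionality fixes it outside the group.\<close>

lemma young_rep_eq:
  assumes p: "is_partition n \<nu>" and "\<sigma> permutes {1..n}"
  shows "young_rep \<nu> \<sigma> = kmat (Tab \<nu>) (Tab \<nu>) (yker n \<sigma>)"
proof -
  define \<pi>0 where "\<pi>0 = restrict (\<lambda>\<sigma>. kmat (Tab \<nu>) (Tab \<nu>) (yker n \<sigma>)) (carrier (sym_group n))"
  have n: "sum_list \<nu> = n" using p by (simp add: is_partition_def)
  have T: "Tab \<nu> = ST n (diagram \<nu>)" by (rule Tab_ST[OF p])
  have fin: "finite (Tab \<nu>)" by (simp add: T finite_ST)
  have \<pi>0: "\<pi>0 \<sigma> = kmat (Tab \<nu>) (Tab \<nu>) (yker n \<sigma>)" if "\<sigma> permutes {1..n}" for \<sigma>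
    using that by (simp add: \<pi>0_def sym_group_carrier)
  let ?P = "\<lambda>\<pi>. \<pi> \<in> hom (sym_group (sum_list \<nu>)) (ring_mat TYPE(real) (d_tab \<nu>) ()) \<and>
     \<pi> \<in> extensional (carrier (sym_group (sum_list \<nu>))) \<and>
     \<pi> id = 1\<^sub>m (d_tab \<nu>) \<and>
     (\<forall>k\<in>{1..<sum_list \<nu>}. \<pi> (adj_transp k) = young_gen \<nu> k)"
  have P0: "?P \<pi>0"
  proof (intro conjI ballI)
    show "\<pi>0 \<in> hom (sym_group (sum_list \<nu>)) (ring_mat TYPE(real) (d_tab \<nu>) ())"
      unfolding n hom_def using kmat_yker_mult[of _ n _ "diagram \<nu>"]
      by (auto simp: sym_group_carrier sym_group_mult ring_mat_simps \<pi>0 permutes_compose d_tab_def T)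
    show "\<pi>0 \<in> extensional (carrier (sym_group (sum_list \<nu>)))" by (simp add: \<pi>0_def n)
    show "\<pi>0 id = 1\<^sub>m (d_tab \<nu>)"
      by (simp add: \<pi>0 permutes_id d_tab_def kmat_one[OF fin] yker_id[abs_def])
    fix k assume "k \<in> {1..<sum_list \<nu>}"
    hence "1 \<le> k" "k < n" by (auto simp: n)
    thus "\<pi>0 (adj_transp k) = young_gen \<nu> k"
      using \<pi>0[OF adj_transp_permutes] young_gen_eq[OF p] by metis
  qed
  have uniq: "\<pi> = \<pi>0" if \<pi>: "?P \<pi>" for \<pi>
  proof (rule extensionalityI[of _ "carrier (sym_group n)"])
    show "\<pi> \<in> extensional (carrier (sym_group n))" using \<pi> n by simp
    show "\<pi>0 \<in> extensional (carrier (sym_group n))" by (simp add: \<pi>0_def)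
    fix \<sigma> assume "\<sigma> \<in> carrier (sym_group n)"
    hence "\<sigma> permutes {1..n}" by (simp add: sym_group_carrier)
    thus "\<pi> \<sigma> = \<pi>0 \<sigma>"
    proof (induction rule: sym_group_generated)
      case id
      have "\<pi> id = \<pi>0 id" using \<pi> P0 by simp
      thus ?case .
    next
      case (step k \<sigma>)
      have s: "adj_transp k permutes {1..n}" by (rule adj_transp_permutes[OF step(1,2)])
      have mult: "\<pi>' (adj_transp k \<circ> \<sigma>) = \<pi>' (adj_transp k) * \<pi>' \<sigma>" if "?P \<pi>'" for \<pi>'
      proof -
        have "\<pi>' \<in> hom (sym_group n) (ring_mat TYPE(real) (d_tab \<nu>) ())" using that n by simp
        from hom_mult[OF this, of "adj_transp k" \<sigma>] show ?thesis
          using s step(3) by (simp add: sym_group_carrier sym_group_mult ring_mat_simps)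
      qed
      have "\<pi> (adj_transp k) = \<pi>0 (adj_transp k)" using \<pi> P0 step(1,2) n by simp
      hence "\<pi> (adj_transp k \<circ> \<sigma>) = \<pi>0 (adj_transp k \<circ> \<sigma>)"
        using mult[OF \<pi>] mult[OF P0] step(4) by simp
      thus ?case .
    qed
  qed
  have "young_rep \<nu> = \<pi>0" unfolding young_rep_def by (rule the_equality[where P = ?P, OF P0 uniq])
  thus ?thesis using \<pi>0 assms(2) by simp
qed

section \<open>Partitions covering \<open>\<mu>\<close> and the direct sum over a set of
  them\<close>

lemma up_setD:
  assumes "is_partition m \<mu>" "\<nu> \<in> up_set \<mu>"
  shows "is_partition (Suc m) \<nu>" "added_box \<nu> \<mu> \<notin> diagram \<mu>"
    "diagram \<nu> = insert (added_box \<nu> \<mu>) (diagram \<mu>)"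
proof -
  have m: "sum_list \<mu> = m" using assms(1) by (simp add: is_partition_def)
  show "is_partition (Suc m) \<nu>" using assms(2) by (simp add: up_set_def m)
  obtain b where b: "b \<notin> diagram \<mu>" "diagram \<nu> = insert b (diagram \<mu>)"
    using assms(2) by (auto simp: up_set_def)
  hence "diagram \<nu> - diagram \<mu> = {b}" by auto
  hence "added_box \<nu> \<mu> = b" by (simp add: added_box_def)
  thus "added_box \<nu> \<mu> \<notin> diagram \<mu>" "diagram \<nu> = insert (added_box \<nu> \<mu>) (diagram \<mu>)" using b by auto
qed

lemma length_le_sum_list: "(\<forall>x\<in>set xs. 0 < (x::nat)) \<Longrightarrow> length xs \<le> sum_list xs"
  by (induction xs) auto

lemma finite_partitions: "finite {\<nu>. is_partition n \<nu>}"
proof (rule finite_subset)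
  show "{\<nu>. is_partition n \<nu>} \<subseteq> {xs. set xs \<subseteq> {..n} \<and> length xs \<le> n}"
    using length_le_sum_list member_le_sum_list by (auto simp: is_partition_def)
qed (simp add: finite_lists_length_le)

lemma finite_up_set: "finite (up_set \<mu>)"
  by (rule finite_subset[OF _ finite_partitions[of "Suc (sum_list \<mu>)"]]) (auto simp: up_set_def)

text \<open>Stated for general \<open>L\<close> because it is needed for the set that witnesses
  isoclinicity, for the whole of \<open>up_set \<mu>\<close>, and for the parity classes.\<close>

locale up_rep =
  fixes m :: nat and \<mu> :: "nat list" and L :: "nat list set"
  assumes mu: "is_partition m \<mu>" and L: "L \<subseteq> up_set \<mu>" and L_nonempty: "L \<noteq> {}"
begin

abbreviation n where "n \<equiv> Suc m"

definition abox :: "nat list \<Rightarrow> nat \<times> nat" where "abox \<nu> = added_box \<nu> \<mu>"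

definition ext :: "nat list \<Rightarrow> tableau \<Rightarrow> tableau" where "ext \<nu> R = R(abox \<nu> := n)"

definition psi :: "tableau \<Rightarrow> tableau \<Rightarrow> real" where
  "psi T R = (\<Sum>\<nu>\<in>L. if T = ext \<nu> R then sqrt (real (d_tab \<nu>) / real (d_sum L)) else 0)"

lemma finL: "finite L"
  using L finite_up_set finite_subset by blast

lemma L_part: "\<nu> \<in> L \<Longrightarrow> is_partition n \<nu>"
  using L up_setD(1)[OF mu] by auto

lemma abox: "\<nu> \<in> L \<Longrightarrow> abox \<nu> \<notin> diagram \<mu>" "\<nu> \<in> L \<Longrightarrow> diagram \<nu> = insert (abox \<nu>) (diagram \<mu>)"
  using L up_setD[OF mu] by (auto simp: abox_def)

lemma abox_young: "\<nu> \<in> L \<Longrightarrow> young (insert (abox \<nu>) (diagram \<mu>))"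
  using abox(2) young_diagram[OF L_part] by metis

lemma extend_tab_ext: "\<nu> \<in> L \<Longrightarrow> extend_tab \<nu> \<mu> R = ext \<nu> R"
  using L_part by (simp add: extend_tab_def ext_def abox_def is_partition_def)

lemma L_diagram_inj: "\<nu> \<in> L \<Longrightarrow> \<kappa> \<in> L \<Longrightarrow> diagram \<nu> = diagram \<kappa> \<Longrightarrow> \<nu> = \<kappa>"
  using diagram_inj L_part by blast

lemma Tabs_eq: "Tabs L = (\<Union>\<nu>\<in>L. ST n (diagram \<nu>))"
  by (simp add: Tabs_def Tab_ST[OF L_part])

lemma finite_Tabs: "finite (Tabs L)"
  by (simp add: Tabs_eq finL finite_ST)

lemma Tabs_SYT: "T \<in> Tabs L \<Longrightarrow> T \<in> SYT n"
  by (auto simp: Tabs_eq ST_def)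

lemma Tabs_ST: "T \<in> Tabs L \<Longrightarrow> ST n (shape T) \<subseteq> Tabs L"
  by (auto simp: Tabs_eq ST_def)

lemma card_Tabs: "card (Tabs L) = d_sum L"
  unfolding Tabs_def d_sum_def d_tab_def
proof (rule card_UN_disjoint[OF finL])
  show "\<forall>\<nu>\<in>L. finite (Tab \<nu>)" using finite_Tab L_part by blast
  show "\<forall>i\<in>L. \<forall>j\<in>L. i \<noteq> j \<longrightarrow> Tab i \<inter> Tab j = {}"
    using L_diagram_inj by (auto dest!: Tab_shape)
qed

lemma Tab_mu: "Tab \<mu> = ST m (diagram \<mu>)"
  by (rule Tab_ST[OF mu])

lemma finite_Tab_mu: "finite (Tab \<mu>)"
  by (simp add: Tab_mu finite_ST)

lemma d_sum_pos: "0 < d_sum L"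
proof -
  obtain \<nu> where \<nu>: "\<nu> \<in> L" using L_nonempty by blast
  have "0 < d_tab \<nu>" by (rule d_tab_pos[OF L_part[OF \<nu>]])
  also have "d_tab \<nu> \<le> d_sum L" unfolding d_sum_def by (rule member_le_sum[OF \<nu> _ finL]) simp
  finally show ?thesis .
qed

lemma ext_ST: "\<nu> \<in> L \<Longrightarrow> R \<in> Tab \<mu> \<Longrightarrow> ext \<nu> R \<in> ST n (diagram \<nu>)"
  using extend_ST[of R m "diagram \<mu>" "abox \<nu>"] abox abox_young by (simp add: Tab_mu ext_def)

lemma ext_Tabs: "\<nu> \<in> L \<Longrightarrow> R \<in> Tab \<mu> \<Longrightarrow> ext \<nu> R \<in> Tabs L"
  using ext_ST by (auto simp: Tabs_eq)

lemma ext_eq_iff: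
  assumes "\<nu> \<in> L" "\<kappa> \<in> L" "R \<in> Tab \<mu>" "R' \<in> Tab \<mu>"
  shows "ext \<nu> R = ext \<kappa> R' \<longleftrightarrow> \<nu> = \<kappa> \<and> R = R'"
proof
  assume e: "ext \<nu> R = ext \<kappa> R'"
  hence "diagram \<nu> = diagram \<kappa>" using ext_ST[OF assms(1,3)] ext_ST[OF assms(2,4)] by (simp add: ST_def)
  hence "\<nu> = \<kappa>" using L_diagram_inj assms by blast
  thus "\<nu> = \<kappa> \<and> R = R'"
    using extend_inj[of R m "diagram \<mu>" R' "abox \<nu>" n] e assms abox(1) by (simp add: Tab_mu ext_def)
qed simp

lemma sum_Tabs_yker:
  assumes "\<sigma> permutes {1..n}" "S \<in> Tabs L"
  shows "(\<Sum>U\<in>Tabs L. yker n \<sigma> S U * g U) = (\<Sum>U\<in>ST n (shape S). yker n \<sigma> S U * g U)"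
proof (rule sum.mono_neutral_right[OF finite_Tabs Tabs_ST[OF assms(2)]])
  show "\<forall>U\<in>Tabs L - ST n (shape S). yker n \<sigma> S U * g U = 0"
    using yker_shape[OF assms(1) Tabs_SYT[OF assms(2)]] Tabs_SYT by (auto simp: ST_def)
qed

lemma in_ST_shape: "S \<in> Tabs L \<Longrightarrow> S \<in> ST n (shape S)"
  using Tabs_SYT by (simp add: ST_def)

lemma rep_eq:
  assumes "\<sigma> permutes {1..n}"
  shows "rep_sum L \<sigma> = kmat (Tabs L) (Tabs L) (yker n \<sigma>)"
  unfolding rep_sum_def mat_on_kmat
proof (rule kmat_cong)
  fix S T assume S: "S \<in> Tabs L" and T: "T \<in> Tabs L"
  obtain \<nu> where \<nu>: "\<nu> \<in> L" "S \<in> Tab \<nu>" using S by (auto simp: Tabs_def)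
  have "(\<Sum>\<kappa>\<in>L. if S \<in> Tab \<kappa> \<and> T \<in> Tab \<kappa> then entry_on (Tab \<kappa>) (Tab \<kappa>) (young_rep \<kappa> \<sigma>) S T else 0)
     = (\<Sum>\<kappa>\<in>L. if \<kappa> = \<nu> then yker n \<sigma> S T else 0)"
  proof (rule sum.cong[OF refl])
    fix \<kappa> assume \<kappa>: "\<kappa> \<in> L"
    have fin: "finite (Tab \<kappa>)" using finite_Tab L_part \<kappa> by blast
    have 1: "S \<in> Tab \<kappa> \<longleftrightarrow> \<kappa> = \<nu>"
      using \<nu> Tab_shape[of S \<kappa>] Tab_shape[of S \<nu>] L_diagram_inj \<kappa> by auto
    have 2: "yker n \<sigma> S T = 0" if "T \<notin> Tab \<nu>"
      using that yker_shape[OF assms Tabs_SYT[OF S], of T] Tab_shape[OF \<nu>(2)] Tabs_SYT[OF T]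
      by (auto simp: Tab_eq_SYT[OF L_part[OF \<nu>(1)]])
    show "(if S \<in> Tab \<kappa> \<and> T \<in> Tab \<kappa> then entry_on (Tab \<kappa>) (Tab \<kappa>) (young_rep \<kappa> \<sigma>) S T else 0)
        = (if \<kappa> = \<nu> then yker n \<sigma> S T else 0)"
      using 1 2 fin \<nu> by (auto simp: young_rep_eq[OF L_part[OF \<nu>(1)] assms] entry_on_kmat)
  qed
  thus "(\<Sum>\<kappa>\<in>L. if S \<in> Tab \<kappa> \<and> T \<in> Tab \<kappa> then entry_on (Tab \<kappa>) (Tab \<kappa>) (young_rep \<kappa> \<sigma>) S T else 0)
     = yker n \<sigma> S T" using \<nu> finL by simp
qed

lemma rep_comp:
  assumes "\<sigma> permutes {1..n}" "\<tau> permutes {1..n}"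
  shows "rep_sum L (\<sigma> \<circ> \<tau>) = rep_sum L \<sigma> * rep_sum L \<tau>"
  unfolding rep_eq[OF assms(1)] rep_eq[OF assms(2)] rep_eq[OF permutes_compose[OF assms(2,1)]]
    kmat_mult[OF finite_Tabs]
  by (intro kmat_cong) (simp add: sum_Tabs_yker[OF assms(1)] yker_comp[OF assms in_ST_shape])

lemma rep_id: "rep_sum L id = 1\<^sub>m (d_sum L)"
  unfolding rep_eq[OF permutes_id] card_Tabs[symmetric] kmat_one[OF finite_Tabs]
  by (intro kmat_cong) (simp add: yker_id)

lemma yker_inv':
  assumes "\<sigma> permutes {1..n}" "S \<in> SYT n" "T \<in> SYT n"
  shows "yker n (inv' \<sigma>) S T = yker n \<sigma> T S"
proof (cases "shape S = shape T")
  case True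
  thus ?thesis using yker_inv[OF assms(1), of S "shape T" T] assms by (simp add: ST_def)
next
  case False
  thus ?thesis using assms yker_shape[OF permutes_inv[OF assms(1)]] yker_shape[OF assms(1)] by metis
qed

lemma rep_inv:
  assumes "\<sigma> permutes {1..n}"
  shows "mat_adjoint (rep_sum L \<sigma>) = rep_sum L (inv' \<sigma>)"
  unfolding rep_eq[OF assms] rep_eq[OF permutes_inv[OF assms]] kmat_adjoint
  by (intro kmat_cong) (simp add: yker_inv'[OF assms] Tabs_SYT)

lemma rep_carrier: "\<sigma> permutes {1..n} \<Longrightarrow> rep_sum L \<sigma> \<in> carrier_mat (d_sum L) (d_sum L)"
  using rep_eq kmat_carrier card_Tabs by metis

lemma Psi_eq: "Psi_sum L \<mu> = kmat (Tabs L) (Tab \<mu>) psi"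
  unfolding Psi_sum_def mat_on_kmat psi_def
  by (intro kmat_cong sum.cong) (auto simp: extend_tab_ext)

lemma Psi_carrier: "Psi_sum L \<mu> \<in> carrier_mat (d_sum L) (d_tab \<mu>)"
  using Psi_eq kmat_carrier card_Tabs d_tab_def by metis

lemma sum_psi:
  assumes "R \<in> Tab \<mu>"
  shows "(\<Sum>T\<in>Tabs L. g T * psi T R) = (\<Sum>\<nu>\<in>L. sqrt (real (d_tab \<nu>) / real (d_sum L)) * g (ext \<nu> R))"
proof -
  have "(\<Sum>T\<in>Tabs L. g T * psi T R) =
      (\<Sum>T\<in>Tabs L. \<Sum>\<nu>\<in>L. if T = ext \<nu> R then sqrt (real (d_tab \<nu>) / real (d_sum L)) * g T else 0)"
    unfolding psi_def sum_distrib_left by (intro sum.cong) auto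
  also have "\<dots> = (\<Sum>\<nu>\<in>L. \<Sum>T\<in>Tabs L. if T = ext \<nu> R then sqrt (real (d_tab \<nu>) / real (d_sum L)) * g T else 0)"
    by (rule sum.swap)
  also have "\<dots> = (\<Sum>\<nu>\<in>L. sqrt (real (d_tab \<nu>) / real (d_sum L)) * g (ext \<nu> R))"
    using assms by (intro sum.cong) (auto simp: finite_Tabs ext_Tabs)
  finally show ?thesis .
qed

lemma psi_ext:
  assumes "R \<in> Tab \<mu>" "R' \<in> Tab \<mu>" "\<nu> \<in> L"
  shows "psi (ext \<nu> R) R' = (if R = R' then sqrt (real (d_tab \<nu>) / real (d_sum L)) else 0)"
proof -
  have "psi (ext \<nu> R) R' = (\<Sum>\<kappa>\<in>L. if \<kappa> = \<nu> then (if R = R' then sqrt (real (d_tab \<nu>) / real (d_sum L)) else 0) else 0)"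
    unfolding psi_def using assms by (intro sum.cong) (auto simp: ext_eq_iff)
  thus ?thesis using assms finL by simp
qed

definition wt :: "nat list \<Rightarrow> real" where
  "wt \<nu> = real (d_tab \<nu>) / real (d_sum L)"

lemma sum_wt: "(\<Sum>\<nu>\<in>L. wt \<nu>) = 1"
  using d_sum_pos by (simp add: wt_def d_sum_def flip: sum_divide_distrib of_nat_sum)

text \<open>Coefficients between different shapes vanish, so the two square roots that survive
  belong to the same shape and multiply to \<open>wt\<close>: the result is a convex combination of
  the blocks.\<close>

lemma compression:
  assumes "\<sigma> permutes {1..n}"
  shows "mat_adjoint (Psi_sum L \<mu>) * rep_sum L \<sigma> * Psi_sum L \<mu> =
    kmat (Tab \<mu>) (Tab \<mu>) (\<lambda>R R'. \<Sum>\<nu>\<in>L. wt \<nu> * yker n \<sigma> (ext \<nu> R) (ext \<nu> R'))"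
  unfolding Psi_eq rep_eq[OF assms] kmat_adjoint kmat_mult[OF finite_Tabs]
proof (rule kmat_cong)
  fix R R' assume R: "R \<in> Tab \<mu>" "R' \<in> Tab \<mu>"
  let ?c = "\<lambda>\<nu>. sqrt (real (d_tab \<nu>) / real (d_sum L))"
  have "(\<Sum>T\<in>Tabs L. (\<Sum>U\<in>Tabs L. conjugate (psi U R) * yker n \<sigma> U T) * psi T R')
    = (\<Sum>\<nu>\<in>L. ?c \<nu> * (\<Sum>U\<in>Tabs L. yker n \<sigma> U (ext \<nu> R') * psi U R))"
    by (simp add: sum_psi[OF R(2)] mult.commute[of "psi _ R"])
  also have "\<dots> = (\<Sum>\<nu>\<in>L. ?c \<nu> * (\<Sum>\<kappa>\<in>L. ?c \<kappa> * yker n \<sigma> (ext \<kappa> R) (ext \<nu> R')))"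
    by (simp add: sum_psi[OF R(1)])
  also have "\<dots> = (\<Sum>\<nu>\<in>L. wt \<nu> * yker n \<sigma> (ext \<nu> R) (ext \<nu> R'))"
  proof (rule sum.cong[OF refl])
    fix \<nu> assume \<nu>: "\<nu> \<in> L"
    have "(\<Sum>\<kappa>\<in>L. ?c \<kappa> * yker n \<sigma> (ext \<kappa> R) (ext \<nu> R')) =
        (\<Sum>\<kappa>\<in>L. if \<kappa> = \<nu> then ?c \<nu> * yker n \<sigma> (ext \<nu> R) (ext \<nu> R') else 0)"
    proof (rule sum.cong[OF refl])
      fix \<kappa> assume \<kappa>: "\<kappa> \<in> L"
      have "shape (ext \<kappa> R) = shape (ext \<nu> R') \<longrightarrow> \<kappa> = \<nu>"
        using ext_ST[OF \<kappa> R(1)] ext_ST[OF \<nu> R(2)] L_diagram_inj[OF \<kappa> \<nu>] by (simp add: ST_def)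
      moreover have "ext \<kappa> R \<in> SYT n" using ext_ST[OF \<kappa> R(1)] by (simp add: ST_def)
      ultimately show "?c \<kappa> * yker n \<sigma> (ext \<kappa> R) (ext \<nu> R') =
          (if \<kappa> = \<nu> then ?c \<nu> * yker n \<sigma> (ext \<nu> R) (ext \<nu> R') else 0)"
        using yker_shape[OF assms] by auto
    qed
    also have "\<dots> = ?c \<nu> * yker n \<sigma> (ext \<nu> R) (ext \<nu> R')" using \<nu> finL by simp
    finally show "?c \<nu> * (\<Sum>\<kappa>\<in>L. ?c \<kappa> * yker n \<sigma> (ext \<kappa> R) (ext \<nu> R')) =
        wt \<nu> * yker n \<sigma> (ext \<nu> R) (ext \<nu> R')"
      by (simp add: wt_def flip: mult.assoc)
  qed
  finally show "(\<Sum>T\<in>Tabs L. (\<Sum>U\<in>Tabs L. conjugate (psi U R) * yker n \<sigma> U T) * psi T R') =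
      (\<Sum>\<nu>\<in>L. wt \<nu> * yker n \<sigma> (ext \<nu> R) (ext \<nu> R'))" .
qed

lemma Psi_isometry: "mat_adjoint (Psi_sum L \<mu>) * Psi_sum L \<mu> = 1\<^sub>m (d_tab \<mu>)"
proof -
  have c: "mat_adjoint (Psi_sum L \<mu>) \<in> carrier_mat (d_tab \<mu>) (d_sum L)"
    using Psi_carrier by (auto simp: mat_adjoint_mat)
  have "mat_adjoint (Psi_sum L \<mu>) * Psi_sum L \<mu> = mat_adjoint (Psi_sum L \<mu>) * rep_sum L id * Psi_sum L \<mu>"
    using c by (simp add: rep_id)
  also have "\<dots> = kmat (Tab \<mu>) (Tab \<mu>) (\<lambda>R R'. if R = R' then 1 else 0)"
    unfolding compression[OF permutes_id]
    by (rule kmat_cong) (auto simp: yker_id ext_eq_iff sum_wt)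
  finally show ?thesis by (simp add: kmat_one[OF finite_Tab_mu] d_tab_def)
qed

lemma Psi_intertwines:
  assumes "h permutes {1..m}"
  shows "rep_sum L h * Psi_sum L \<mu> = Psi_sum L \<mu> * young_rep \<mu> h"
proof -
  have h: "h permutes {1..n}" by (rule permutes_mono_top[OF assms])
  show ?thesis
    unfolding Psi_eq rep_eq[OF h] young_rep_eq[OF mu assms] kmat_mult[OF finite_Tabs] kmat_mult[OF finite_Tab_mu]
  proof (rule kmat_cong)
    fix T R assume T: "T \<in> Tabs L" and R: "R \<in> Tab \<mu>"
    let ?c = "\<lambda>\<nu>. sqrt (real (d_tab \<nu>) / real (d_sum L))"
    have "(\<Sum>U\<in>Tabs L. yker n h T U * psi U R) = (\<Sum>\<nu>\<in>L. ?c \<nu> * yker n h T (ext \<nu> R))"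
      by (rule sum_psi[OF R])
    also have "\<dots> = (\<Sum>\<nu>\<in>L. ?c \<nu> * (\<Sum>R'\<in>Tab \<mu>. yker m h R' R * (if T = ext \<nu> R' then 1 else 0)))"
    proof (rule sum.cong[OF refl])
      fix \<nu> assume \<nu>: "\<nu> \<in> L"
      \<comment> \<open>\<open>yker_restrict\<close> expands the first index, whereas the extended
        tableau stands in the second; passing to the inverse permutation exchanges them, and
        \<open>yker_inv\<close> reverses this on the side of \<open>\<mu>\<close>.\<close>
      have "yker n h T (ext \<nu> R) = yker n (inv' h) (ext \<nu> R) T"
        using yker_inv'[OF h, of "ext \<nu> R" T] Tabs_SYT T ext_Tabs[OF \<nu> R] by simp
      also have "\<dots> = (\<Sum>R'\<in>Tab \<mu>. yker m (inv' h) R R' * (if T = ext \<nu> R' then 1 else 0))"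
        using yker_restrict[OF permutes_inv[OF assms] abox(1)[OF \<nu>] abox_young[OF \<nu>], of R T] R
        by (simp add: ext_def Tab_mu)
      also have "\<dots> = (\<Sum>R'\<in>Tab \<mu>. yker m h R' R * (if T = ext \<nu> R' then 1 else 0))"
        using yker_inv[OF assms, of R "diagram \<mu>"] R by (intro sum.cong) (auto simp: Tab_mu)
      finally show "?c \<nu> * yker n h T (ext \<nu> R) =
        ?c \<nu> * (\<Sum>R'\<in>Tab \<mu>. yker m h R' R * (if T = ext \<nu> R' then 1 else 0))" by simp
    qed
    also have "\<dots> = (\<Sum>R'\<in>Tab \<mu>. \<Sum>\<nu>\<in>L. ?c \<nu> * (yker m h R' R * (if T = ext \<nu> R' then 1 else 0)))"
      unfolding sum_distrib_left by (rule sum.swap)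
    also have "\<dots> = (\<Sum>R'\<in>Tab \<mu>. psi T R' * yker m h R' R)"
      unfolding psi_def sum_distrib_right by (intro sum.cong) auto
    finally show "(\<Sum>U\<in>Tabs L. yker n h T U * psi U R) = (\<Sum>R'\<in>Tab \<mu>. psi T R' * yker m h R' R)" .
  qed
qed

definition hval :: "tableau \<Rightarrow> real" where
  "hval R = (\<Sum>\<nu>\<in>L. wt \<nu> / of_int (superdiagonal (abox \<nu>) - content R m))"

text \<open>The off-diagonal part of Young's formula drops out: swapping m and n carries n to the
  former box of m, a box of \<open>\<mu>\<close>, whereas every extended tableau has n in the added
  box.\<close>

lemma compression_top:
  assumes "1 \<le> m"
  shows "mat_adjoint (Psi_sum L \<mu>) * rep_sum L (adj_transp m) * Psi_sum L \<mu> =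
    kmat (Tab \<mu>) (Tab \<mu>) (\<lambda>R R'. if R = R' then hval R else 0)"
proof -
  have "adj_transp m permutes {1..n}" using assms by (intro adj_transp_permutes) auto
  from compression[OF this] show ?thesis
  proof (simp only:, intro kmat_cong)
    fix R R' assume R: "R \<in> Tab \<mu>" "R' \<in> Tab \<mu>"
    have "yker n (adj_transp m) (ext \<nu> R) (ext \<nu> R') =
        (if R = R' then 1 / of_int (superdiagonal (abox \<nu>) - content R m) else 0)" if \<nu>: "\<nu> \<in> L" for \<nu>
    proof -
      note bx = box_of_extend[of _ m, OF _ abox(1)[OF \<nu>] abox_young[OF \<nu>], folded ext_def Tab_mu]
      have "box_of (ext \<nu> R) n \<noteq> box_of (adj_transp m \<circ> ext \<nu> R') n"
        using bx[OF R(1)] bx[OF R(2)] assms abox(1)[OF \<nu>] box_of_works(2)[of R' m m] R(2)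
        by (auto simp: box_of_adj_transp Tab_mu ST_def)
      hence "ext \<nu> R \<noteq> adj_transp m \<circ> ext \<nu> R'" by auto
      moreover have "content (ext \<nu> R') n = superdiagonal (abox \<nu>)" "content (ext \<nu> R') m = content R' m"
        using bx[OF R(2)] assms by (simp_all add: content_def)
      moreover have "ext \<nu> R \<in> SYT n" using ext_ST[OF \<nu> R(1)] by (simp add: ST_def)
      ultimately show ?thesis using assms ext_eq_iff[OF \<nu> \<nu> R] by (simp add: yker_gen)
    qed
    thus "(\<Sum>\<nu>\<in>L. wt \<nu> * yker n (adj_transp m) (ext \<nu> R) (ext \<nu> R')) = (if R = R' then hval R else 0)"
      by (simp add: hval_def)
  qed
qed

end

section \<open>Frames from representations\<close>

lemma mat_assoc: "dim_col A = dim_row B \<Longrightarrow> dim_col B = dim_row C \<Longrightarrow> A * B * C = A * (B * C)"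
  for A :: "'a::semiring_0 mat"
  by (rule assoc_mult_mat[of A "dim_row A" "dim_col A" B "dim_col B" C "dim_col C"]) auto

lemma mat_cancel:
  "P * Q = 1\<^sub>m k \<Longrightarrow> dim_col P = dim_row Q \<Longrightarrow> dim_col Q = dim_row X \<Longrightarrow> dim_row X = k \<Longrightarrow> P * (Q * X) = X"
  for X :: "'a::semiring_1 mat"
  by (subst mat_assoc[symmetric]) (auto intro: left_mult_one_mat)

lemma adjoint_dim [simp]: "dim_row (mat_adjoint A) = dim_col A" "dim_col (mat_adjoint A) = dim_row A"
  by (auto simp: mat_adjoint_mat)

lemma adjoint_carrier [simp]: "A \<in> carrier_mat a b \<Longrightarrow> mat_adjoint A \<in> carrier_mat b a"
  by (auto simp: mat_adjoint_mat)

lemma adjoint_adjoint [simp]: "mat_adjoint (mat_adjoint A) = A"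
  by (rule eq_matI) (auto simp: mat_adjoint_mat)

lemma adjoint_mult:
  assumes "dim_col A = dim_row B"
  shows "mat_adjoint (A * B) = mat_adjoint B * mat_adjoint A"
proof (rule eq_matI)
  fix i j assume "i < dim_row (mat_adjoint B * mat_adjoint A)" "j < dim_col (mat_adjoint B * mat_adjoint A)"
  hence ij: "i < dim_col B" "j < dim_row A" by auto
  have "mat_adjoint (A * B) $$ (i, j) = conjugate (\<Sum>k = 0..<dim_row B. A $$ (j, k) * B $$ (k, i))"
    using ij assms by (auto simp: mat_adjoint_mat scalar_prod_def)
  also have "\<dots> = (\<Sum>k = 0..<dim_row B. conjugate (B $$ (k, i)) * conjugate (A $$ (j, k)))"
    by (simp add: sum_conjugate conjugate_dist_mul mult.commute)
  also have "\<dots> = (mat_adjoint B * mat_adjoint A) $$ (i, j)"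
    using ij assms by (auto simp: mat_adjoint_mat scalar_prod_def)
  finally show "mat_adjoint (A * B) $$ (i, j) = (mat_adjoint B * mat_adjoint A) $$ (i, j)" .
qed auto

lemma conjugate_one [simp]: "conjugate (1 :: 'a :: conjugatable_field) = 1"
proof -
  have "conjugate (1 :: 'a) * conjugate 1 = conjugate 1" by (simp flip: conjugate_dist_mul)
  moreover have "conjugate (1 :: 'a) \<noteq> 0" by simp
  ultimately show ?thesis by simp
qed

lemma adjoint_one [simp]: "mat_adjoint (1\<^sub>m n :: 'a :: conjugatable_field mat) = 1\<^sub>m n"
  by (rule eq_matI) (auto simp: mat_adjoint_mat)

definition mat_sum :: "nat \<Rightarrow> nat set \<Rightarrow> (nat \<Rightarrow> 'a::comm_ring_1 mat) \<Rightarrow> 'a mat" where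
  "mat_sum N K P = mat N N (\<lambda>(i, j). \<Sum>k\<in>K. P k $$ (i, j))"

lemma mat_sum_carrier [simp]: "mat_sum N K P \<in> carrier_mat N N"
  by (simp add: mat_sum_def)

lemma mat_sum_cong: "(\<And>k. k \<in> K \<Longrightarrow> P k = P' k) \<Longrightarrow> mat_sum N K P = mat_sum N K P'"
  by (simp add: mat_sum_def cong: sum.cong)

lemma mat_sum_sandwich:
  fixes P :: "nat \<Rightarrow> 'a::comm_ring_1 mat"
  assumes "A \<in> carrier_mat N' N" "B \<in> carrier_mat N N'" "\<And>k. k \<in> K \<Longrightarrow> P k \<in> carrier_mat N N"
  shows "A * mat_sum N K P * B = mat_sum N' K (\<lambda>k. A * P k * B)"
proof (rule eq_matI)
  fix i j assume "i < dim_row (mat_sum N' K (\<lambda>k. A * P k * B))" "j < dim_col (mat_sum N' K (\<lambda>k. A * P k * B))"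
  hence ij: "i < N'" "j < N'" by (auto simp: mat_sum_def)
  have e: "(A * X * B) $$ (i, j) = (\<Sum>b<N. \<Sum>a<N. A $$ (i, a) * X $$ (a, b) * B $$ (b, j))"
    if "X \<in> carrier_mat N N" for X
    unfolding lessThan_atLeast0 using assms(1,2) ij that
    by (auto simp del: assoc_mult_mat simp: scalar_prod_def sum_distrib_right intro!: sum.cong)
  have "(A * mat_sum N K P * B) $$ (i, j) =
      (\<Sum>b<N. \<Sum>a<N. \<Sum>k\<in>K. A $$ (i, a) * P k $$ (a, b) * B $$ (b, j))"
    unfolding e[OF mat_sum_carrier]
    by (intro sum.cong) (auto simp: mat_sum_def sum_distrib_left sum_distrib_right)
  also have "\<dots> = (\<Sum>b<N. \<Sum>k\<in>K. \<Sum>a<N. A $$ (i, a) * P k $$ (a, b) * B $$ (b, j))"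
    by (intro sum.cong[OF refl] sum.swap)
  also have "\<dots> = (\<Sum>k\<in>K. \<Sum>b<N. \<Sum>a<N. A $$ (i, a) * P k $$ (a, b) * B $$ (b, j))"
    by (rule sum.swap)
  also have "\<dots> = mat_sum N' K (\<lambda>k. A * P k * B) $$ (i, j)"
    using ij e[OF assms(3)] by (simp add: mat_sum_def)
  finally show "(A * mat_sum N K P * B) $$ (i, j) = mat_sum N' K (\<lambda>k. A * P k * B) $$ (i, j)" .
qed (use assms in \<open>auto simp: mat_sum_def\<close>)

lemma mat_image_mult:
  assumes "A \<in> carrier_mat a b" "B \<in> carrier_mat b c"
  shows "mat_image (A * B) (carrier_vec c) = mat_image A (mat_image B (carrier_vec c))"
  unfolding mat_image_def image_image
  by (rule image_cong[OF refl]) (use assms in \<open>simp add: assoc_mult_mat_vec\<close>)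

lemma mat_image_unitary:
  assumes "A \<in> carrier_mat a r" "U \<in> carrier_mat r r" "V \<in> carrier_mat r r" "U * V = 1\<^sub>m r"
  shows "mat_image (A * U) (carrier_vec r) = mat_image A (carrier_vec r)"
proof
  show "mat_image (A * U) (carrier_vec r) \<subseteq> mat_image A (carrier_vec r)"
    unfolding mat_image_mult[OF assms(1,2)] using assms(2) by (auto simp: mat_image_def)
  show "mat_image A (carrier_vec r) \<subseteq> mat_image (A * U) (carrier_vec r)"
  proof
    fix x assume "x \<in> mat_image A (carrier_vec r)"
    then obtain v where v: "v \<in> carrier_vec r" "x = A *\<^sub>v v" by (auto simp: mat_image_def)
    have "A * U *\<^sub>v (V *\<^sub>v v) = A *\<^sub>v (U *\<^sub>v (V *\<^sub>v v))"
      by (rule assoc_mult_mat_vec[OF assms(1,2)]) (use assms v in auto)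
    also have "U *\<^sub>v (V *\<^sub>v v) = U * V *\<^sub>v v"
      by (rule assoc_mult_mat_vec[symmetric]) (use assms v in auto)
    finally have "A * U *\<^sub>v (V *\<^sub>v v) = x" using assms(4) v by simp
    thus "x \<in> mat_image (A * U) (carrier_vec r)"
      unfolding mat_image_def using assms(3) v by (metis image_eqI mult_mat_vec_carrier)
  qed
qed

text \<open>An orbit of subspaces under a transitive group of permutations, over any scalars. It is
  instantiated with S_n over the reals, with the same data after extending the scalars, and with the
  subgroup acting on the compressed spaces.\<close>

locale frame_data =
  fixes n N r :: nat and G :: "(nat \<Rightarrow> nat) set"
    and \<pi> \<rho> :: "(nat \<Rightarrow> nat) \<Rightarrow> 'a::conjugatable_field mat" and \<Psi> :: "'a mat" and t :: "nat \<Rightarrow> nat \<Rightarrow> nat"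
  assumes n_pos: "1 \<le> n"
    and G_permutes: "\<And>g. g \<in> G \<Longrightarrow> g permutes {1..n}"
    and G_comp: "\<And>g h. g \<in> G \<Longrightarrow> h \<in> G \<Longrightarrow> g \<circ> h \<in> G"
    and G_inv: "\<And>g. g \<in> G \<Longrightarrow> inv' g \<in> G"
    and t_in: "\<And>k. k \<in> {1..n} \<Longrightarrow> t k \<in> G"
    and t_top: "\<And>k. k \<in> {1..n} \<Longrightarrow> t k n = k"
    and \<pi>_carrier: "\<And>g. g \<in> G \<Longrightarrow> \<pi> g \<in> carrier_mat N N"
    and \<pi>_comp: "\<And>g h. g \<in> G \<Longrightarrow> h \<in> G \<Longrightarrow> \<pi> (g \<circ> h) = \<pi> g * \<pi> h"
    and \<pi>_id: "\<pi> id = 1\<^sub>m N"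
    and \<pi>_inv: "\<And>g. g \<in> G \<Longrightarrow> mat_adjoint (\<pi> g) = \<pi> (inv' g)"
    and \<rho>_carrier: "\<And>h. h \<in> G \<Longrightarrow> h n = n \<Longrightarrow> \<rho> h \<in> carrier_mat r r"
    and \<rho>_unitary: "\<And>h. h \<in> G \<Longrightarrow> h n = n \<Longrightarrow> \<rho> h * mat_adjoint (\<rho> h) = 1\<^sub>m r"
    and \<rho>_unitary': "\<And>h. h \<in> G \<Longrightarrow> h n = n \<Longrightarrow> mat_adjoint (\<rho> h) * \<rho> h = 1\<^sub>m r"
    and \<Psi>_carrier: "\<Psi> \<in> carrier_mat N r"
    and \<Psi>_isometry: "mat_adjoint \<Psi> * \<Psi> = 1\<^sub>m r"
    and intertwines: "\<And>h. h \<in> G \<Longrightarrow> h n = n \<Longrightarrow> \<pi> h * \<Psi> = \<Psi> * \<rho> h"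
begin

text \<open>\<open>M k\<close> is an isometry onto the k-th subspace, \<open>A g\<close> the
  compression of g to the base subspace (by \<open>gram\<close>, all mutual Gram matrices have this
  form), and \<open>Q\<close> the frame operator.\<close>

definition M :: "nat \<Rightarrow> 'a mat" where "M k = \<pi> (t k) * \<Psi>"
definition W :: "nat \<Rightarrow> 'a vec set" where "W k = mat_image (M k) (carrier_vec r)"
definition A :: "(nat \<Rightarrow> nat) \<Rightarrow> 'a mat" where "A g = mat_adjoint \<Psi> * \<pi> g * \<Psi>"
definition Q :: "'a mat" where "Q = mat_sum N {1..n} (\<lambda>k. M k * mat_adjoint (M k))"

lemma \<pi>_left_inv: "g \<in> G \<Longrightarrow> mat_adjoint (\<pi> g) * \<pi> g = 1\<^sub>m N"
  using \<pi>_comp[OF G_inv, of g g] permutes_inv_o(2)[OF G_permutes] by (simp add: \<pi>_inv \<pi>_id)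

lemma \<pi>_right_inv: "g \<in> G \<Longrightarrow> \<pi> g * mat_adjoint (\<pi> g) = 1\<^sub>m N"
  using \<pi>_comp[OF _ G_inv, of g g] permutes_inv_o(1)[OF G_permutes] by (simp add: \<pi>_inv \<pi>_id)

lemma dims [simp]:
  "g \<in> G \<Longrightarrow> dim_row (\<pi> g) = N" "g \<in> G \<Longrightarrow> dim_col (\<pi> g) = N"
  "h \<in> G \<Longrightarrow> h n = n \<Longrightarrow> dim_row (\<rho> h) = r" "h \<in> G \<Longrightarrow> h n = n \<Longrightarrow> dim_col (\<rho> h) = r"
  "dim_row \<Psi> = N" "dim_col \<Psi> = r"
  by (rule carrier_matD[OF \<pi>_carrier] carrier_matD[OF \<rho>_carrier] carrier_matD[OF \<Psi>_carrier]; assumption?)+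

lemma M_dims [simp]: "k \<in> {1..n} \<Longrightarrow> dim_row (M k) = N" "dim_col (M k) = r"
  unfolding M_def index_mult_mat(2,3) by (rule dims(1)[OF t_in], assumption) (rule dims(6))

lemma A_dims [simp]: "dim_row (A g) = r" "dim_col (A g) = r"
  unfolding A_def by auto

lemma M_carrier: "k \<in> {1..n} \<Longrightarrow> M k \<in> carrier_mat N r"
  by (rule carrier_matI[OF M_dims])

lemma gram:
  assumes "k \<in> {1..n}" "l \<in> {1..n}"
  shows "mat_adjoint (M k) * M l = A (inv' (t k) \<circ> t l)"
  unfolding A_def M_def \<pi>_comp[OF G_inv[OF t_in[OF assms(1)]] t_in[OF assms(2)]]
    \<pi>_inv[OF t_in[OF assms(1)], symmetric]
  using t_in[OF assms(1)] t_in[OF assms(2)] by (simp add: mat_assoc adjoint_mult)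

lemma M_isometry: "k \<in> {1..n} \<Longrightarrow> mat_adjoint (M k) * M k = 1\<^sub>m r"
proof -
  assume k: "k \<in> {1..n}"
  have "mat_adjoint (M k) * M k = mat_adjoint \<Psi> * 1\<^sub>m N * \<Psi>"
    using gram[OF k k] permutes_inv_o(2)[OF G_permutes[OF t_in[OF k]]] by (simp add: A_def \<pi>_id)
  also have "mat_adjoint \<Psi> * 1\<^sub>m N = mat_adjoint \<Psi>"
    by (rule right_mult_one_mat[OF adjoint_carrier[OF \<Psi>_carrier]])
  finally show ?thesis by (simp add: \<Psi>_isometry)
qed

lemma isometry_W: "k \<in> {1..n} \<Longrightarrow> isometry_onto N r (M k) (W k)"
  unfolding isometry_onto_def W_def by (intro conjI M_carrier M_isometry refl)

lemma G_range: "g \<in> G \<Longrightarrow> k \<in> {1..n} \<Longrightarrow> g k \<in> {1..n}"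
  by (simp only: permutes_in_image[OF G_permutes])

text \<open>Both g t_k and t_(g k) carry n to g k, so they differ by an element of the stabiliser of
  n, and \<open>\<Psi>\<close> turns this element into the unitary \<open>\<rho> h\<close>.\<close>

lemma move:
  assumes "g \<in> G" "k \<in> {1..n}"
  defines "h \<equiv> inv' (t (g k)) \<circ> (g \<circ> t k)"
  shows "h \<in> G" "h n = n" "\<pi> g * M k = M (g k) * \<rho> h"
proof -
  have gk: "g k \<in> {1..n}" by (rule G_range[OF assms(1,2)])
  show hG: "h \<in> G" unfolding h_def by (rule G_comp[OF G_inv[OF t_in[OF gk]] G_comp[OF assms(1) t_in[OF assms(2)]]])
  have tp: "t (g k) permutes {1..n}" by (rule G_permutes[OF t_in[OF gk]])
  show hn: "h n = n" using permutes_inverses(2)[OF tp, of n] t_top[OF gk] t_top[OF assms(2)]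
    by (simp add: h_def)
  have "g \<circ> t k = t (g k) \<circ> h"
    unfolding h_def by (simp add: comp_assoc[symmetric] permutes_inv_o(1)[OF tp])
  hence e: "\<pi> g * \<pi> (t k) = \<pi> (t (g k)) * \<pi> h"
    using \<pi>_comp[OF assms(1) t_in[OF assms(2)]] \<pi>_comp[OF t_in[OF gk] hG] by simp
  have "\<pi> g * M k = (\<pi> g * \<pi> (t k)) * \<Psi>"
    unfolding M_def using assms(1) t_in[OF assms(2)] by (simp add: mat_assoc)
  also have "\<dots> = \<pi> (t (g k)) * (\<pi> h * \<Psi>)" unfolding e
    using hG t_in[OF gk] by (simp add: mat_assoc)
  also have "\<dots> = M (g k) * \<rho> h" unfolding intertwines[OF hG hn] M_def
    using hG hn t_in[OF gk] by (simp add: mat_assoc)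
  finally show "\<pi> g * M k = M (g k) * \<rho> h" .
qed

lemma G_automorphisms: "G \<subseteq> fusion_aut n N W"
proof
  fix g assume g: "g \<in> G"
  have "mat_image (\<pi> g) (W k) = W (g k)" if k: "k \<in> {1..n}" for k
  proof -
    note mv = move[OF g k]
    have "mat_image (\<pi> g) (W k) = mat_image (\<pi> g * M k) (carrier_vec r)"
      unfolding W_def by (rule mat_image_mult[symmetric, OF \<pi>_carrier[OF g] M_carrier[OF k]])
    also have "\<dots> = W (g k)" unfolding mv(3) W_def
      by (rule mat_image_unitary[OF M_carrier[OF G_range[OF g k]] \<rho>_carrier[OF mv(1,2)] _ \<rho>_unitary[OF mv(1,2)]])
        (use \<rho>_carrier[OF mv(1,2)] in simp)
    finally show ?thesis .
  qed
  hence "unitary_mat N (\<pi> g) \<and> (\<forall>k\<in>{1..n}. mat_image (\<pi> g) (W k) = W (g k))"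
    using \<pi>_carrier[OF g] \<pi>_left_inv[OF g] \<pi>_right_inv[OF g] unfolding unitary_mat_def by blast
  thus "g \<in> fusion_aut n N W"
    using G_permutes[OF g] unfolding fusion_aut_def sym_group_carrier by blast
qed

lemma projection_W:
  assumes "k \<in> {1..n}"
  shows "orthogonal_projection N (M k * mat_adjoint (M k)) (W k)"
proof -
  note c = M_carrier[OF assms] and i = M_isometry[OF assms]
  note c' = adjoint_carrier[OF c]
  have d: "dim_row (M k) = N" using assms by (rule M_dims)
  have 1: "M k * mat_adjoint (M k) * (M k * mat_adjoint (M k)) = M k * mat_adjoint (M k)"
    using d by (simp add: mat_assoc mat_cancel[OF i])
  have "mat_image (M k * mat_adjoint (M k)) (carrier_vec N) = W k"
  proof
    show "mat_image (M k * mat_adjoint (M k)) (carrier_vec N) \<subseteq> W k"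
      unfolding mat_image_mult[OF c c'] W_def using c' by (auto simp: mat_image_def)
    show "W k \<subseteq> mat_image (M k * mat_adjoint (M k)) (carrier_vec N)"
    proof
      fix x assume "x \<in> W k"
      then obtain v where v: "v \<in> carrier_vec r" "x = M k *\<^sub>v v" by (auto simp: W_def mat_image_def)
      have "mat_adjoint (M k) *\<^sub>v (M k *\<^sub>v v) = v"
        using assoc_mult_mat_vec[OF c' c v(1)] i v by simp
      moreover have x: "x \<in> carrier_vec N" using v c by simp
      ultimately have "M k * mat_adjoint (M k) *\<^sub>v x = x" using assoc_mult_mat_vec[OF c c' x] v by simp
      thus "x \<in> mat_image (M k * mat_adjoint (M k)) (carrier_vec N)"
        unfolding mat_image_def using x by (metis image_eqI)
    qed
  qed
  moreover have "mat_adjoint (M k * mat_adjoint (M k)) = M k * mat_adjoint (M k)"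
    by (simp add: adjoint_mult)
  ultimately show ?thesis unfolding orthogonal_projection_def
    by (intro conjI 1 mult_carrier_mat[OF c c'])
qed

lemma tight_W: "Q = c \<cdot>\<^sub>m 1\<^sub>m N \<Longrightarrow> tight_fusion_frame n N W"
  unfolding tight_fusion_frame_def Q_def mat_sum_def
  by (intro exI[of _ "\<lambda>k. M k * mat_adjoint (M k)"] conjI exI[of _ c] ballI projection_W)

lemma gram_moves_top:
  assumes "k \<in> {1..n}" "l \<in> {1..n}" "k \<noteq> l"
  shows "inv' (t k) \<circ> t l \<in> G" "(inv' (t k) \<circ> t l) n \<noteq> n"
proof -
  show "inv' (t k) \<circ> t l \<in> G" by (rule G_comp[OF G_inv[OF t_in[OF assms(1)]] t_in[OF assms(2)]])
  have "t k permutes {1..n}" by (rule G_permutes[OF t_in[OF assms(1)]])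
  hence "t k (inv' (t k) l) = l" by (rule permutes_inverses)
  thus "(inv' (t k) \<circ> t l) n \<noteq> n" using t_top[OF assms(1)] t_top[OF assms(2)] assms(3) by auto
qed

lemma equi_isoclinic_W:
  assumes "\<And>g. g \<in> G \<Longrightarrow> g n \<noteq> n \<Longrightarrow> mat_adjoint (A g) * A g = \<alpha> \<cdot>\<^sub>m 1\<^sub>m r"
  shows "equi_isoclinic n r N W"
proof -
  have "mat_adjoint (mat_adjoint (M k) * M l) * (mat_adjoint (M k) * M l) = \<alpha> \<cdot>\<^sub>m 1\<^sub>m r"
    if "k \<in> {1..n}" "l \<in> {1..n}" "k \<noteq> l" for k l
    unfolding gram[OF that(1,2)] by (rule assms[OF gram_moves_top[OF that]])
  thus ?thesis unfolding equi_isoclinic_def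
    by (intro exI[of _ M] conjI exI[of _ \<alpha>] ballI impI isometry_W)
qed

text \<open>The definition speaks of some isometries \<open>\<Phi> k\<close>, the calculation of the
  particular \<open>M k\<close>. Since both have the image \<open>W k\<close>,
  \<open>M k = \<Phi> k * U k\<close> with \<open>U k\<close> unitary; the Gram matrices change by
  unitaries on both sides, and a scalar square is unaffected.\<close>

lemma equi_isoclinicD:
  assumes "equi_isoclinic n r N W"
  obtains \<alpha> where "\<And>k l. k \<in> {1..n} \<Longrightarrow> l \<in> {1..n} \<Longrightarrow> k \<noteq> l \<Longrightarrow>
    mat_adjoint (A (inv' (t k) \<circ> t l)) * A (inv' (t k) \<circ> t l) = \<alpha> \<cdot>\<^sub>m 1\<^sub>m r"
proof -
  from assms obtain \<Phi> where \<Phi>': "(\<forall>k\<in>{1..n}. isometry_onto N r (\<Phi> k) (W k)) \<and>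
    (\<exists>\<alpha>. \<forall>k\<in>{1..n}. \<forall>l\<in>{1..n}. k \<noteq> l \<longrightarrow>
          mat_adjoint (mat_adjoint (\<Phi> k) * \<Phi> l) * (mat_adjoint (\<Phi> k) * \<Phi> l) = \<alpha> \<cdot>\<^sub>m 1\<^sub>m r)"
    unfolding equi_isoclinic_def ..
  note 1 = conjunct1[OF \<Phi>'] and 2 = conjunct2[OF \<Phi>']
  note \<Phi> = bspec[OF 1]
  from 2 obtain \<alpha> where \<alpha>: "\<And>k l. k \<in> {1..n} \<Longrightarrow> l \<in> {1..n} \<Longrightarrow> k \<noteq> l \<Longrightarrow>
       mat_adjoint (mat_adjoint (\<Phi> k) * \<Phi> l) * (mat_adjoint (\<Phi> k) * \<Phi> l) = \<alpha> \<cdot>\<^sub>m 1\<^sub>m r"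
    by (elim exE) simp
  have \<Phi>c: "\<Phi> k \<in> carrier_mat N r" and \<Phi>i: "mat_adjoint (\<Phi> k) * \<Phi> k = 1\<^sub>m r"
    and \<Phi>W: "mat_image (\<Phi> k) (carrier_vec r) = W k" if "k \<in> {1..n}" for k
    using \<Phi>[OF that] by (auto simp: isometry_onto_def)
  define U where "U k = mat_adjoint (\<Phi> k) * M k" for k
  have Ud: "dim_row (U k) = r" "dim_col (U k) = r" if "k \<in> {1..n}" for k
    unfolding U_def using carrier_matD[OF \<Phi>c[OF that]] by simp_all
  have Uc: "U k \<in> carrier_mat r r" if "k \<in> {1..n}" for k
    by (rule carrier_matI[OF Ud[OF that]])
  \<comment> \<open>Each column of \<open>M k\<close> lies in \<open>W k\<close>, hence is
    \<open>\<Phi> k\<close> applied to some v, and the adjoint of \<open>\<Phi> k\<close> recovers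
    v.\<close>
  have MU: "M k = \<Phi> k * U k" if k: "k \<in> {1..n}" for k
  proof (rule eq_matI)
    note c = \<Phi>c[OF k] M_carrier[OF k]
    show "dim_row (M k) = dim_row (\<Phi> k * U k)" "dim_col (M k) = dim_col (\<Phi> k * U k)"
      using c Ud[OF k] by auto
    fix i j assume "i < dim_row (\<Phi> k * U k)" "j < dim_col (\<Phi> k * U k)"
    hence ij: "i < N" "j < r" using c Ud[OF k] by auto
    have "col (M k) j = M k *\<^sub>v unit_vec r j" using c ij
      by (intro eq_vecI) (auto simp: scalar_prod_right_unit)
    also have "\<dots> \<in> W k" unfolding W_def mat_image_def by auto
    finally obtain v where v: "v \<in> carrier_vec r" "col (M k) j = \<Phi> k *\<^sub>v v"
      unfolding \<Phi>W[OF k, symmetric] mat_image_def by auto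
    have "col (U k) j = mat_adjoint (\<Phi> k) *\<^sub>v col (M k) j"
      unfolding U_def using ij c by (subst col_mult2[of _ r N _ r]) auto
    also have "\<dots> = v" unfolding v(2)
      using assoc_mult_mat_vec[OF adjoint_carrier[OF c(1)] c(1) v(1)] \<Phi>i[OF k] v(1) by simp
    finally have "col (\<Phi> k * U k) j = col (M k) j"
      using col_mult2[OF c(1) Uc[OF k] ij(2)] v(2) by simp
    hence "col (\<Phi> k * U k) j $ i = col (M k) j $ i" by simp
    thus "M k $$ (i, j) = (\<Phi> k * U k) $$ (i, j)"
      using c ij Ud[OF k] by (simp del: index_mult_mat(1))
  qed
  have Uu: "mat_adjoint (U k) * U k = 1\<^sub>m r" if k: "k \<in> {1..n}" for k
  proof -
    have "mat_adjoint (U k) = mat_adjoint (M k) * \<Phi> k"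
      unfolding U_def using \<Phi>c[OF k] M_carrier[OF k] by (subst adjoint_mult) auto
    hence "mat_adjoint (U k) * U k = mat_adjoint (M k) * (\<Phi> k * U k)"
      using \<Phi>c[OF k] Ud[OF k] M_carrier[OF k] by (simp add: mat_assoc)
    thus ?thesis using M_isometry[OF k] MU[OF k] by simp
  qed
  have Uu': "U k * mat_adjoint (U k) = 1\<^sub>m r" if k: "k \<in> {1..n}" for k
    using mat_mult_left_right_inverse[OF adjoint_carrier[OF Uc[OF k]] Uc[OF k] Uu[OF k]] .
  have "mat_adjoint (A (inv' (t k) \<circ> t l)) * A (inv' (t k) \<circ> t l) = \<alpha> \<cdot>\<^sub>m 1\<^sub>m r"
    if k: "k \<in> {1..n}" and l: "l \<in> {1..n}" and kl: "k \<noteq> l" for k l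
  proof -
    define B where "B = mat_adjoint (\<Phi> k) * \<Phi> l"
    have d: "dim_row (\<Phi> k) = N" "dim_col (\<Phi> k) = r" "dim_row (\<Phi> l) = N" "dim_col (\<Phi> l) = r"
      using \<Phi>c[OF k] \<Phi>c[OF l] by auto
    have Bd: "dim_row B = r" "dim_col B = r" using d by (auto simp: B_def)
    have B: "mat_adjoint (\<Phi> k) * (\<Phi> l * X) = B * X" if "dim_row X = r" for X
      unfolding B_def using d that by (simp add: mat_assoc)
    have Ae: "A (inv' (t k) \<circ> t l) = mat_adjoint (U k) * (B * U l)"
      unfolding gram[OF k l, symmetric] MU[OF k] MU[OF l]
      using d Ud[OF k] Ud[OF l] by (simp add: adjoint_mult mat_assoc B)
    have "mat_adjoint B * (B * X) = \<alpha> \<cdot>\<^sub>m X" if "dim_row X = r" for X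
    proof -
      have "mat_adjoint B * (B * X) = (\<alpha> \<cdot>\<^sub>m 1\<^sub>m r) * X"
        using \<alpha>[OF k l kl] that Bd by (simp add: B_def[symmetric] mat_assoc[symmetric])
      also have "\<dots> = \<alpha> \<cdot>\<^sub>m (1\<^sub>m r * X)"
        by (rule mult_smult_assoc_mat[of _ r r _ "dim_col X"]) (use that in auto)
      also have "1\<^sub>m r * X = X" using that by (intro left_mult_one_mat) auto
      finally show ?thesis .
    qed
    note BB = this
    have "mat_adjoint (A (inv' (t k) \<circ> t l)) * A (inv' (t k) \<circ> t l) =
        mat_adjoint (U l) * (mat_adjoint B * (B * U l))"
      unfolding Ae using Ud[OF k] Ud[OF l] Bd
      by (simp add: adjoint_mult mat_assoc mat_cancel[OF Uu'[OF k]])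
    also have "\<dots> = mat_adjoint (U l) * (\<alpha> \<cdot>\<^sub>m U l)" using BB Ud[OF l] by simp
    also have "\<dots> = \<alpha> \<cdot>\<^sub>m 1\<^sub>m r"
      using Uu[OF l] mult_smult_distrib[OF adjoint_carrier[OF Uc[OF l]] Uc[OF l]] by simp
    finally show ?thesis .
  qed
  thus ?thesis by (rule that)
qed

text \<open>The adjoint of the relation for the inverse of h produces the adjoint of
  \<open>\<rho> (inv' h)\<close>. That this equals \<open>\<rho> h\<close> follows because
  \<open>\<rho> h\<close> is the compression of \<open>\<pi> h\<close> by
  \<open>\<Psi>\<close>.\<close>

lemma \<Psi>_adjoint_intertwines:
  assumes h: "h \<in> G" "h n = n"
  shows "mat_adjoint \<Psi> * \<pi> h = \<rho> h * mat_adjoint \<Psi>"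
proof -
  have ih: "inv' h \<in> G" "inv' h n = n"
    using G_inv[OF h(1)] permutes_inverses(2)[OF G_permutes[OF h(1)], of n] unfolding h(2) .
  have ihi: "inv' (inv' h) = h" using permutes_inv_inv[OF G_permutes[OF h(1)]] .
  have "mat_adjoint \<Psi> * \<pi> h = mat_adjoint (\<pi> (inv' h) * \<Psi>)"
    using ih \<pi>_inv[OF ih(1)] ihi by (simp add: adjoint_mult)
  also have "\<dots> = mat_adjoint (\<rho> (inv' h)) * mat_adjoint \<Psi>"
    unfolding intertwines[OF ih] using ih by (simp add: adjoint_mult)
  finally have e: "mat_adjoint \<Psi> * \<pi> h = mat_adjoint (\<rho> (inv' h)) * mat_adjoint \<Psi>" .
  have "\<rho> h = mat_adjoint \<Psi> * (\<Psi> * \<rho> h)"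
    using mat_cancel[OF \<Psi>_isometry, of "\<rho> h"] h by simp
  also have "\<dots> = mat_adjoint \<Psi> * \<pi> h * \<Psi>"
    using h by (simp add: intertwines[OF h, symmetric] mat_assoc)
  also have "\<dots> = mat_adjoint (\<rho> (inv' h)) * 1\<^sub>m r"
    unfolding e using ih by (simp add: mat_assoc \<Psi>_isometry)
  also have "\<dots> = mat_adjoint (\<rho> (inv' h))"
    by (rule right_mult_one_mat[OF adjoint_carrier[OF \<rho>_carrier[OF ih]]])
  finally show ?thesis using e by simp
qed

text \<open>Up to unitaries on both sides, \<open>A g\<close> depends only on the double coset of g
  with respect to the stabiliser of n. This is what reduces isoclinicity to a single
  transposition.\<close>

lemma A_conj:
  assumes g: "g \<in> G" and h: "h \<in> G" "h n = n" and h': "h' \<in> G" "h' n = n"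
  shows "A (h \<circ> g \<circ> h') = \<rho> h * A g * \<rho> h'"
proof -
  have "A (h \<circ> g \<circ> h') = (mat_adjoint \<Psi> * \<pi> h) * (\<pi> g * (\<pi> h' * \<Psi>))"
    unfolding A_def \<pi>_comp[OF G_comp[OF h(1) g] h'(1)] \<pi>_comp[OF h(1) g]
    using assms by (simp add: mat_assoc)
  thus ?thesis unfolding \<Psi>_adjoint_intertwines[OF h] intertwines[OF h'] A_def
    using assms by (simp add: mat_assoc)
qed

lemma A_conj_square:
  assumes g: "g \<in> G" and h: "h \<in> G" "h n = n" and h': "h' \<in> G" "h' n = n"
  shows "mat_adjoint (A (h \<circ> g \<circ> h')) * A (h \<circ> g \<circ> h') =
    mat_adjoint (\<rho> h') * (mat_adjoint (A g) * A g) * \<rho> h'"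
  unfolding A_conj[OF assms]
  using assms by (simp add: adjoint_mult mat_assoc mat_cancel[OF \<rho>_unitary'[OF h]])

text \<open>Conjugation by \<open>\<pi> g\<close> permutes the n projections as g permutes their
  indices, the unitary from \<open>move\<close> cancelling against its adjoint.\<close>

lemma Q_commutes:
  assumes g: "g \<in> G"
  shows "\<pi> g * Q * mat_adjoint (\<pi> g) = Q"
proof -
  have "\<pi> g * Q * mat_adjoint (\<pi> g) =
      mat_sum N {1..n} (\<lambda>k. \<pi> g * (M k * mat_adjoint (M k)) * mat_adjoint (\<pi> g))"
    unfolding Q_def
    by (rule mat_sum_sandwich[OF \<pi>_carrier[OF g] adjoint_carrier[OF \<pi>_carrier[OF g]]])
      (rule mult_carrier_mat[OF M_carrier adjoint_carrier[OF M_carrier]])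
  also have "\<dots> = mat_sum N {1..n} (\<lambda>k. M (g k) * mat_adjoint (M (g k)))"
  proof (rule mat_sum_cong)
    fix k assume k: "k \<in> {1..n}"
    define h where "h = inv' (t (g k)) \<circ> (g \<circ> t k)"
    note mv = move[OF g k, folded h_def]
    note d = M_dims(1)[OF k] M_dims(1)[OF G_range[OF g k]]
    have "\<pi> g * (M k * mat_adjoint (M k)) * mat_adjoint (\<pi> g) = (\<pi> g * M k) * mat_adjoint (\<pi> g * M k)"
      using d g by (simp add: mat_assoc adjoint_mult)
    also have "\<dots> = M (g k) * mat_adjoint (M (g k))"
      unfolding mv(3) using mv(1,2) d by (simp add: mat_assoc adjoint_mult mat_cancel[OF \<rho>_unitary[OF mv(1,2)]])
    finally show "\<pi> g * (M k * mat_adjoint (M k)) * mat_adjoint (\<pi> g) = M (g k) * mat_adjoint (M (g k))" .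
  qed
  also have "\<dots> = Q"
    unfolding Q_def mat_sum_def
    using sum.reindex_bij_betw[OF permutes_imp_bij[OF G_permutes[OF g]], of "\<lambda>k. (M k * mat_adjoint (M k)) $$ _"]
    by simp
  finally show ?thesis .
qed

end

text \<open>\<open>E\<close> and \<open>F\<close> are isometries onto subspaces that the actions of
  \<open>H\<close> preserve and that \<open>\<Psi>\<close> matches. Restricting everything to them
  gives frame data for \<open>H\<close>. As \<open>A g\<close> commutes with the projection of
  \<open>F\<close>, its scalar square survives, and the new frame operator is the compression of
  \<open>Q\<close>.\<close>

lemma (in frame_data) compressed_frame:
  assumes E: "E \<in> carrier_mat N N'" "mat_adjoint E * E = 1\<^sub>m N'"
    and F: "F \<in> carrier_mat r r'" "mat_adjoint F * F = 1\<^sub>m r'"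
    and H: "H \<subseteq> G" "\<And>g h. g \<in> H \<Longrightarrow> h \<in> H \<Longrightarrow> g \<circ> h \<in> H" "\<And>g. g \<in> H \<Longrightarrow> inv' g \<in> H"
      "\<And>k. k \<in> {1..n} \<Longrightarrow> t k \<in> H"
    and comm\<pi>: "\<And>g. g \<in> H \<Longrightarrow> E * mat_adjoint E * \<pi> g = \<pi> g * (E * mat_adjoint E)"
    and comm\<rho>: "\<And>h. h \<in> H \<Longrightarrow> h n = n \<Longrightarrow> F * mat_adjoint F * \<rho> h = \<rho> h * (F * mat_adjoint F)"
    and comm\<Psi>: "E * mat_adjoint E * \<Psi> = \<Psi> * (F * mat_adjoint F)"
    and iso: "\<And>g. g \<in> G \<Longrightarrow> g n \<noteq> n \<Longrightarrow> mat_adjoint (A g) * A g = \<alpha> \<cdot>\<^sub>m 1\<^sub>m r"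
    and tight: "Q = c \<cdot>\<^sub>m 1\<^sub>m N"
  shows "\<exists>W :: nat \<Rightarrow> 'a vec set. equi_isoclinic_tff n r' N' W \<and> H \<subseteq> fusion_aut n N' W"
proof -
  have d [simp]: "dim_row E = N" "dim_col E = N'" "dim_row F = r" "dim_col F = r'"
    using carrier_matD[OF E(1)] carrier_matD[OF F(1)] by simp_all
  have HG: "g \<in> H \<Longrightarrow> g \<in> G" for g using H(1) by (rule subsetD)
  have E1: "E * 1\<^sub>m N' = E" by (rule right_mult_one_mat[OF E(1)])
  have F1: "F * 1\<^sub>m r' = F" by (rule right_mult_one_mat[OF F(1)])
  have EX: "mat_adjoint E * (E * X) = X" if "dim_row X = N'" for X
    using that by (intro mat_cancel[OF E(2)]) simp_all
  have FX: "mat_adjoint F * (F * X) = X" if "dim_row X = r'" for X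
    using that by (intro mat_cancel[OF F(2)]) simp_all
  have \<Psi>X: "mat_adjoint \<Psi> * (\<Psi> * X) = X" if "dim_row X = r" for X
    using that by (intro mat_cancel[OF \<Psi>_isometry]) simp_all
  have \<pi>X: "E * (mat_adjoint E * (\<pi> g * X)) = \<pi> g * (E * (mat_adjoint E * X))"
    if "g \<in> H" "dim_row X = N" for g X
    using arg_cong[OF comm\<pi>[OF that(1)], of "\<lambda>Z. Z * X"] that HG[OF that(1)] by (simp add: mat_assoc)
  have \<pi>X': "E * (mat_adjoint E * (mat_adjoint (\<pi> g) * X)) = mat_adjoint (\<pi> g) * (E * (mat_adjoint E * X))"
    if "g \<in> H" "dim_row X = N" for g X
    unfolding \<pi>_inv[OF HG[OF that(1)]] by (rule \<pi>X[OF H(3)[OF that(1)] that(2)])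
  have \<Psi>1: "E * (mat_adjoint E * (\<Psi> * X)) = \<Psi> * (F * (mat_adjoint F * X))"
    if "dim_row X = r" for X
    using arg_cong[OF comm\<Psi>, of "\<lambda>Z. Z * X"] that by (simp add: mat_assoc)
  have \<Psi>2: "F * (mat_adjoint F * (mat_adjoint \<Psi> * X)) = mat_adjoint \<Psi> * (E * (mat_adjoint E * X))"
    if "dim_row X = N" for X
    using arg_cong[OF comm\<Psi>, of "\<lambda>Z. mat_adjoint Z * X"] that by (simp add: mat_assoc adjoint_mult)
  have \<rho>X: "F * (mat_adjoint F * (\<rho> h * X)) = \<rho> h * (F * (mat_adjoint F * X))"
    if "h \<in> H" "h n = n" "dim_row X = r" for h X
    using arg_cong[OF comm\<rho>[OF that(1,2)], of "\<lambda>Z. Z * X"] that HG[OF that(1)] by (simp add: mat_assoc)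
  have \<rho>X': "F * (mat_adjoint F * (mat_adjoint (\<rho> h) * X)) = mat_adjoint (\<rho> h) * (F * (mat_adjoint F * X))"
    if "h \<in> H" "h n = n" "dim_row X = r" for h X
    using arg_cong[OF comm\<rho>[OF that(1,2)], of "\<lambda>Z. mat_adjoint Z * X"] that HG[OF that(1)]
    by (simp add: mat_assoc adjoint_mult)
  have inter: "\<pi> h * (\<Psi> * X) = \<Psi> * (\<rho> h * X)" if "h \<in> H" "h n = n" "dim_row X = r" for h X
    using arg_cong[OF intertwines[OF HG[OF that(1)] that(2)], of "\<lambda>Z. Z * X"] that HG[OF that(1)]
    by (simp add: mat_assoc)
  \<comment> \<open>Simplification with these rules pushes the projections of \<open>E\<close> and
    \<open>F\<close> to the right, \<open>\<Psi>\<close> converting one into the other, until they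
    meet \<open>E\<close> or \<open>F\<close> and are absorbed.\<close>
  note rules = mat_assoc adjoint_mult E1 F1 E(2) F(2) EX FX \<Psi>X \<pi>X \<pi>X' \<Psi>1 \<Psi>2 \<rho>X \<rho>X'
  define \<pi>' where "\<pi>' g = mat_adjoint E * (\<pi> g * E)" for g
  define \<rho>' where "\<rho>' g = mat_adjoint F * (\<rho> g * F)" for g
  define \<Psi>' where "\<Psi>' = mat_adjoint E * (\<Psi> * F)"
  interpret half: frame_data n N' r' H \<pi>' \<rho>' \<Psi>' t
  proof
    show "1 \<le> n" by (rule n_pos)
    show "g permutes {1..n}" if "g \<in> H" for g by (rule G_permutes[OF HG[OF that]])
    show "\<pi>' g \<in> carrier_mat N' N'" if "g \<in> H" for g by (rule carrier_matI) (simp_all add: \<pi>'_def)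
    show "\<pi>' (g \<circ> h) = \<pi>' g * \<pi>' h" if "g \<in> H" "h \<in> H" for g h
      using that HG[OF that(1)] HG[OF that(2)] by (simp add: \<pi>'_def \<pi>_comp rules)
    have "1\<^sub>m N * E = E" by (rule left_mult_one_mat[OF E(1)])
    thus "\<pi>' id = 1\<^sub>m N'" by (simp add: \<pi>'_def \<pi>_id E(2))
    show "mat_adjoint (\<pi>' g) = \<pi>' (inv' g)" if "g \<in> H" for g
      using HG[OF that] by (simp add: \<pi>'_def \<pi>_inv[symmetric] adjoint_mult mat_assoc)
    show "\<rho>' h \<in> carrier_mat r' r'" if "h \<in> H" "h n = n" for h by (rule carrier_matI) (simp_all add: \<rho>'_def)
    show "\<rho>' h * mat_adjoint (\<rho>' h) = 1\<^sub>m r'" if "h \<in> H" "h n = n" for h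
      using that HG[OF that(1)] by (simp add: \<rho>'_def rules mat_cancel[OF \<rho>_unitary])
    show "mat_adjoint (\<rho>' h) * \<rho>' h = 1\<^sub>m r'" if "h \<in> H" "h n = n" for h
      using that HG[OF that(1)] by (simp add: \<rho>'_def rules mat_cancel[OF \<rho>_unitary'])
    show "\<Psi>' \<in> carrier_mat N' r'" by (rule carrier_matI) (simp_all add: \<Psi>'_def)
    show "mat_adjoint \<Psi>' * \<Psi>' = 1\<^sub>m r'" by (simp add: \<Psi>'_def rules)
    show "\<pi>' h * \<Psi>' = \<Psi>' * \<rho>' h" if "h \<in> H" "h n = n" for h
      using that HG[OF that(1)] by (simp add: \<pi>'_def \<Psi>'_def \<rho>'_def rules inter)
  qed (use H t_top in auto)
  have A': "half.A g = mat_adjoint F * (A g * F)" if "g \<in> H" for g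
    unfolding half.A_def A_def using that HG[OF that] by (simp add: \<pi>'_def \<Psi>'_def rules)
  have "mat_adjoint (half.A g) * half.A g = \<alpha> \<cdot>\<^sub>m 1\<^sub>m r'" if g: "g \<in> H" "g n \<noteq> n" for g
  proof -
    have FA: "F * (mat_adjoint F * (A g * X)) = A g * (F * (mat_adjoint F * X))" if "dim_row X = r" for X
      unfolding A_def using g(1) HG[OF g(1)] that by (simp add: rules)
    have "mat_adjoint (half.A g) * half.A g = mat_adjoint F * (mat_adjoint (A g) * A g * F)"
      unfolding A'[OF g(1)] by (simp add: mat_assoc adjoint_mult FA F(2) F1)
    also have "\<dots> = mat_adjoint F * (\<alpha> \<cdot>\<^sub>m F)"
      unfolding iso[OF HG[OF g(1)] g(2)] using mult_smult_assoc_mat[OF one_carrier_mat F(1)] left_mult_one_mat[OF F(1)]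
      by simp
    also have "\<dots> = \<alpha> \<cdot>\<^sub>m 1\<^sub>m r'" using mult_smult_distrib[OF adjoint_carrier[OF F(1)] F(1)] F(2) by simp
    finally show ?thesis .
  qed
  hence eq: "equi_isoclinic n r' N' half.W" by (rule half.equi_isoclinic_W)
  have "half.Q = mat_sum N' {1..n} (\<lambda>k. mat_adjoint E * (M k * mat_adjoint (M k)) * E)"
    unfolding half.Q_def
  proof (rule mat_sum_cong)
    fix k assume k: "k \<in> {1..n}"
    note tk = H(4)[OF k] HG[OF H(4)[OF k]]
    have "half.M k = mat_adjoint E * (M k * F)"
      unfolding half.M_def M_def using tk by (simp add: \<pi>'_def \<Psi>'_def rules)
    moreover have "F * (mat_adjoint F * (mat_adjoint (M k) * X)) = mat_adjoint (M k) * (E * (mat_adjoint E * X))"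
      if "dim_row X = N" for X unfolding M_def using tk that by (simp add: rules)
    ultimately show "half.M k * mat_adjoint (half.M k) = mat_adjoint E * (M k * mat_adjoint (M k)) * E"
      using M_dims(1)[OF k] by (simp add: mat_assoc adjoint_mult E(2) E1)
  qed
  also have "\<dots> = mat_adjoint E * Q * E"
    unfolding Q_def
    by (rule mat_sum_sandwich[symmetric, OF adjoint_carrier[OF E(1)] E(1)])
      (rule mult_carrier_mat[OF M_carrier adjoint_carrier[OF M_carrier]])
  also have "\<dots> = mat_adjoint E * (Q * E)" by (simp add: mat_assoc Q_def mat_sum_def)
  also have "Q * E = c \<cdot>\<^sub>m E"
    unfolding tight using mult_smult_assoc_mat[OF one_carrier_mat E(1)] left_mult_one_mat[OF E(1)] by simp
  also have "mat_adjoint E * (c \<cdot>\<^sub>m E) = c \<cdot>\<^sub>m 1\<^sub>m N'"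
    using mult_smult_distrib[OF adjoint_carrier[OF E(1)] E(1)] E(2) by simp
  finally have "tight_fusion_frame n N' half.W" by (rule half.tight_W)
  thus ?thesis using eq half.G_automorphisms unfolding equi_isoclinic_tff_def by (intro exI[of _ half.W] conjI)
qed

section \<open>Schur's lemma for Young's orthogonal form\<close>

lemma box_of_one:
  assumes "T \<in> SYT n" "1 \<le> n"
  shows "box_of T 1 = (1, 1)"
proof -
  obtain i j where x: "box_of T 1 = (i, j)" by force
  have X: "(i, j) \<in> shape T" "T (i, j) = 1" using box_of_works[OF assms(1), of 1] assms(2) x by auto
  note yg = SYT_young[OF assms(1)]
  have ij: "1 \<le> i" "1 \<le> j" using young_pos[OF yg X(1)] by auto
  have O: "(1, 1) \<in> shape T" using young_down[OF yg X(1), of 1 1] ij by simp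
  have "(i, j) = (1, 1)"
  proof (rule ccontr)
    assume "(i, j) \<noteq> (1, 1)"
    hence "T (1, 1) < T (i, j)" using SYT_mono'[OF assms(1) O X(1)] ij by auto
    thus False using X(2) SYT_range[OF assms(1) O] by simp
  qed
  thus ?thesis using x by simp
qed

lemma content_one: "T \<in> SYT n \<Longrightarrow> 1 \<le> n \<Longrightarrow> content T 1 = 0"
  by (simp add: content_def box_of_one[unfolded One_nat_def] superdiagonal_def)

text \<open>The contents are the joint eigenvalues of the Jucys-Murphy elements, and they separate
  tableaux even of different shapes. Suppose k had boxes on the same diagonal, that in
  \<open>S\<close> further up. This box would hold a smaller entry a in \<open>T\<close>; by
  induction a has the same box in \<open>S\<close>, where k already stands.\<close>

lemma content_inj:
  assumes S: "S \<in> SYT n" and T: "T \<in> SYT n"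
    and eq: "\<And>k. 1 \<le> k \<Longrightarrow> k \<le> n \<Longrightarrow> content S k = content T k"
  shows "S = T"
proof -
  have le: "\<not> fst (box_of S k) < fst (box_of T k)"
    if S: "S \<in> SYT n" and T: "T \<in> SYT n" and k: "1 \<le> k" "k \<le> n" and c: "content S k = content T k"
      and IH: "\<And>j. 1 \<le> j \<Longrightarrow> j < k \<Longrightarrow> box_of S j = box_of T j" for S T k
  proof
    assume lt: "fst (box_of S k) < fst (box_of T k)"
    obtain i j where x: "box_of S k = (i, j)" by force
    obtain i' j' where y: "box_of T k = (i', j')" by force
    have X: "(i, j) \<in> shape S" "S (i, j) = k" using box_of_works[OF S k] x by auto
    have Y: "(i', j') \<in> shape T" "T (i', j') = k" using box_of_works[OF T k] y by auto
    have "int j - int i = int j' - int i'" using c by (simp add: content_def x y superdiagonal_def)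
    hence lt: "i < i'" "j < j'" using lt x y by auto
    have Z: "(i, j) \<in> shape T"
      using young_down[OF SYT_young[OF T] Y(1), of i j] young_pos[OF SYT_young[OF S] X(1)] lt by simp
    define a where "a = T (i, j)"
    have a: "1 \<le> a" "a < k" using SYT_mono'[OF T Z Y(1)] SYT_range[OF T Z] lt Y(2) by (auto simp: a_def)
    have "box_of S a = (i, j)" using IH[OF a] box_of_T[OF T Z] by (simp add: a_def)
    hence "S (i, j) = a" using box_of_works(1)[OF S a(1)] a k by simp
    thus False using X a by simp
  qed
  have bx: "box_of S k = box_of T k" if "1 \<le> k" "k \<le> n" for k
    using that
  proof (induction k rule: less_induct)
    case (less k)
    have IH: "box_of S j = box_of T j" if "1 \<le> j" "j < k" for j using less that by simp
    have "fst (box_of S k) = fst (box_of T k)"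
      using le[OF S T less.prems eq[OF less.prems] IH] le[OF T S less.prems eq[OF less.prems, symmetric] IH[symmetric]]
      by simp
    moreover have "content S k = content T k" by (rule eq[OF less.prems])
    ultimately show ?case by (auto simp: content_def superdiagonal_def intro: prod_eqI)
  qed
  have sub: "S b = T b" if "b \<in> shape S" "S \<in> SYT n" "T \<in> SYT n"
    "\<And>k. 1 \<le> k \<Longrightarrow> k \<le> n \<Longrightarrow> box_of S k = box_of T k" for S T b
  proof -
    have r: "1 \<le> S b" "S b \<le> n" using SYT_range[OF that(2,1)] by auto
    have "box_of T (S b) = b" using that(4)[OF r] box_of_T[OF that(2,1)] by simp
    thus ?thesis using box_of_works(1)[OF that(3) r] by simp
  qed
  show ?thesis
  proof
    fix b
    show "S b = T b"
      using sub[of b S T] sub[of b T S] S T bx not_in_shape[of b S] not_in_shape[of b T] by metis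
  qed
qed

text \<open>All tableaux of one shape are connected by admissible swaps: swapping \<open>k\<close> and \<open>k + 1\<close>
  when \<open>k + 1\<close> lies in a higher row increases \<open>\<Sum> T b * row b\<close>, and only the row reading
  tableau admits no such swap.\<close>

lemma ST_connected:
  assumes swap: "\<And>S k. S \<in> ST n Y \<Longrightarrow> 1 \<le> k \<Longrightarrow> k < n \<Longrightarrow> 2 \<le> \<bar>content S (Suc k) - content S k\<bar> \<Longrightarrow>
      adj_transp k \<circ> S \<in> ST n Y \<Longrightarrow> \<phi> S = \<phi> (adj_transp k \<circ> S)"
    and S: "S \<in> ST n Y" and T: "T \<in> ST n Y"
  shows "\<phi> S = \<phi> T"
proof -
  have finY: "finite Y" using S young_finite[OF SYT_young] by (auto simp: ST_def)
  define pot where "pot T = (\<Sum>b\<in>Y. T b * fst b)" for T :: tableau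
  define nodesc where "nodesc T \<longleftrightarrow> (\<forall>k. 1 \<le> k \<longrightarrow> k < n \<longrightarrow> fst (box_of T k) \<le> fst (box_of T (Suc k)))" for T
  \<comment> \<open>There are finitely many tableaux of one shape, so the potential is bounded and
    its distance to the maximum serves as induction measure.\<close>
  define bd where "bd = Max (pot ` ST n Y)"
  have bd: "pot U \<le> bd" if "U \<in> ST n Y" for U
    unfolding bd_def using that finite_ST by (intro Max_ge) auto
  have reach: "\<exists>U\<in>ST n Y. nodesc U \<and> \<phi> S = \<phi> U" if "S \<in> ST n Y" for S
    using that
  proof (induction "bd - pot S" arbitrary: S rule: less_induct)
    case less
    have S: "S \<in> SYT n" "shape S = Y" using less.prems by (auto simp: ST_def)
    show ?case
    proof (cases "nodesc S")
      case False
      then obtain k where k: "1 \<le> k" "k < n" and d: "fst (box_of S (Suc k)) < fst (box_of S k)"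
        by (auto simp: nodesc_def not_le)
      let ?x = "box_of S k" and ?y = "box_of S (Suc k)"
      \<comment> \<open>As k + 1 lies in a higher row, its box is also strictly further right; the
        content distance is therefore at least 2 and the swap is admissible.\<close>
      have c: "2 \<le> \<bar>content S (Suc k) - content S k\<bar> \<and> adj_transp k \<circ> S \<in> ST n Y"
      proof (rule SYT_swap_cases[OF S(1) k])
        assume a: "\<bar>content S (Suc k) - content S k\<bar> = 1"
        have w: "S ?x = k" "?x \<in> shape S" "S ?y = Suc k" "?y \<in> shape S"
          using box_of_works[OF S(1), of k] box_of_works[OF S(1), of "Suc k"] k by auto
        have "?y \<noteq> ?x" using d by auto
        hence "\<not> snd ?y \<le> snd ?x" using SYT_mono[OF S(1) w(4,2)] d w by auto
        hence False using a d by (simp add: content_def superdiagonal_def)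
        thus ?thesis ..
      qed (use ST_swap[OF less.prems k(1)] in auto)
      have w: "?x \<in> Y" "?y \<in> Y" "S ?x = k" "S ?y = Suc k"
        using box_of_works[OF S(1), of k] box_of_works[OF S(1), of "Suc k"] k S(2) by auto
      have ne: "?x \<noteq> ?y" using d by auto
      have oth: "(adj_transp k \<circ> S) b = S b" if "b \<in> Y - {?x} - {?y}" for b
      proof -
        have "S b \<noteq> k" "S b \<noteq> Suc k"
          using that S SYT_inj[OF S(1), of b ?x] SYT_inj[OF S(1), of b ?y] w by auto
        thus ?thesis by simp
      qed
      have split: "pot U = U ?x * fst ?x + (U ?y * fst ?y + (\<Sum>b\<in>Y - {?x} - {?y}. U b * fst b))" for U
        unfolding pot_def using finY w ne by (simp add: sum.remove[of Y ?x] sum.remove[of "Y - {?x}" ?y])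
      have "(\<Sum>b\<in>Y - {?x} - {?y}. (adj_transp k \<circ> S) b * fst b) = (\<Sum>b\<in>Y - {?x} - {?y}. S b * fst b)"
        using oth by (intro sum.cong) auto
      hence "pot S < pot (adj_transp k \<circ> S)" using split[of S] split[of "adj_transp k \<circ> S"] w d by simp
      hence "bd - pot (adj_transp k \<circ> S) < bd - pot S" using bd[of "adj_transp k \<circ> S"] c by simp
      from less.hyps[OF this] c obtain U where "U \<in> ST n Y" "nodesc U" "\<phi> (adj_transp k \<circ> S) = \<phi> U" by auto
      thus ?thesis using swap[OF less.prems k] c by auto
    qed (use less.prems in auto)
  qed
  have uniq: "U = V" if U: "U \<in> ST n Y" "nodesc U" and V: "V \<in> ST n Y" "nodesc V" for U V
  proof -
    have mono: "U x < U y \<longleftrightarrow> fst x < fst y \<or> fst x = fst y \<and> snd x < snd y"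
      if U: "U \<in> ST n Y" "nodesc U" and xy: "x \<in> Y" "y \<in> Y" for U x y
    proof -
      have U': "U \<in> SYT n" "shape U = Y" using U by (auto simp: ST_def)
      have rows: "fst (box_of U a) \<le> fst (box_of U (a + d))" if "1 \<le> a" "a + d \<le> n" for a d
        using that
      proof (induction d)
        case (Suc d)
        thus ?case using U(2)[unfolded nodesc_def, rule_format, of "a + d"] by simp
      qed simp
      have rw: "fst x \<le> fst y" if "x \<in> Y" "y \<in> Y" "U x \<le> U y" for x y
        using rows[of "U x" "U y - U x"] SYT_range[OF U'(1), of x] SYT_range[OF U'(1), of y]
          box_of_T[OF U'(1), of x] box_of_T[OF U'(1), of y] that U'(2) by simp
      have fwd: "U x < U y" if "x \<in> Y" "y \<in> Y" "fst x < fst y \<or> fst x = fst y \<and> snd x < snd y" for x y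
      proof (cases "fst x < fst y")
        case True
        thus ?thesis using rw[of y x] that by (meson not_less)
      next
        case False
        thus ?thesis using SYT_mono[OF U'(1), of x y] that U'(2) by auto
      qed
      show ?thesis
      proof (cases "x = y")
        case False
        hence "fst x \<noteq> fst y \<or> snd x \<noteq> snd y" by (auto simp: prod_eq_iff)
        thus ?thesis using fwd[of x y] fwd[of y x] xy by fastforce
      qed simp
    qed
    \<comment> \<open>Every entry is recovered as the rank of its box. Without descents the order of
      the boxes by entries is the row reading order, whatever the tableau, so two such tableaux
      coincide.\<close>
    have val: "W x = card {y \<in> Y. W y < W x} + 1" if W: "W \<in> ST n Y" and x: "x \<in> Y" for W x
    proof -
      have W': "W \<in> SYT n" "shape W = Y" using W by (auto simp: ST_def)
      have im: "W ` {y \<in> Y. W y < W x} = {1..<W x}"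
      proof
        show "W ` {y \<in> Y. W y < W x} \<subseteq> {1..<W x}" using SYT_range[OF W'(1)] W'(2) by auto
        show "{1..<W x} \<subseteq> W ` {y \<in> Y. W y < W x}"
        proof
          fix a assume a: "a \<in> {1..<W x}"
          hence "1 \<le> a" "a \<le> n" using SYT_range[OF W'(1), of x] x W'(2) by auto
          from box_of_works[OF W'(1) this] show "a \<in> W ` {y \<in> Y. W y < W x}" using a W'(2)
            by (intro image_eqI[of _ _ "box_of W a"]) auto
        qed
      qed
      have "inj_on W Y" using SYT_bij[OF W'(1)] W'(2) by (simp add: bij_betw_def)
      hence "inj_on W {y \<in> Y. W y < W x}" by (rule inj_on_subset) auto
      from card_image[OF this] have "W x - 1 = card {y \<in> Y. W y < W x}" using im by simp
      moreover have "1 \<le> W x" using SYT_range[OF W'(1), of x] x W'(2) by simp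
      ultimately show ?thesis by linarith
    qed
    show ?thesis
    proof
      fix x
      show "U x = V x"
      proof (cases "x \<in> Y")
        case True
        have "{y \<in> Y. U y < U x} = {y \<in> Y. V y < V x}" using mono[OF U _ True] mono[OF V _ True] by blast
        thus ?thesis using val[OF U(1) True] val[OF V(1) True] by simp
      next
        case False
        thus ?thesis using U(1) V(1) not_in_shape[of x U] not_in_shape[of x V] by (simp add: ST_def)
      qed
    qed
  qed
  show ?thesis using reach[OF S] reach[OF T] uniq by metis
qed

text \<open>Multiplication by the content of \<open>k\<close> is the action of the \<open>k\<close>-th Jucys-Murphy element; this
  is its recursion \<open>X\<^bsub>k+1\<^esub> = s\<^sub>k X\<^sub>k s\<^sub>k + s\<^sub>k\<close>.\<close>

lemma fop_content:
  assumes "T \<in> SYT n" "1 \<le> k" "k < n"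
  shows "fop k (\<lambda>T. of_int (content T k) * fop k f T) T + fop k f T = of_int (content T (Suc k)) * f T"
proof -
  define a b where "a = real_of_int (content T k)" and "b = real_of_int (content T (Suc k))"
  define w where "w = ywt (content T (Suc k) - content T k)"
  have ne: "b - a \<noteq> 0" using content_Suc_neq[OF assms] by (simp add: a_def b_def)
  have w2: "w\<^sup>2 = 1 - 1 / (b - a)\<^sup>2"
    using ywt_square[of "content T (Suc k) - content T k"] content_Suc_neq[OF assms]
    by (simp add: w_def a_def b_def)
  have fT: "fop k f T = f T / (b - a) + w * f (adj_transp k \<circ> T)"
    by (simp add: fop_def a_def b_def w_def)
  have fs: "fop k f (adj_transp k \<circ> T) = - f (adj_transp k \<circ> T) / (b - a) + w * f T"
    by (simp add: fop_def a_def b_def w_def ywt_swap[of "content T k"] adj_transp_comp_assoc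
        minus_divide_divide[symmetric, of _ "_ - real_of_int (content T (Suc k))"] del: minus_divide_divide)
  have e: "fop k (\<lambda>T. of_int (content T k) * fop k f T) T =
      a * fop k f T / (b - a) + w * (b * fop k f (adj_transp k \<circ> T))"
    by (simp add: fop_def[of k "\<lambda>T. of_int (content T k) * fop k f T"] a_def b_def w_def)
  define i where "i = 1 / (b - a)"
  have i: "(a - b) * i = - 1" using ne by (simp add: i_def divide_simps)
  have dv: "x / (b - a) = x * i" for x by (simp add: i_def)
  have w2i: "w\<^sup>2 = 1 - i * i" using w2 by (simp add: i_def power2_eq_square)
  have "fop k (\<lambda>T. of_int (content T k) * fop k f T) T + fop k f T =
      f T * (a * i * i + w\<^sup>2 * b + i) + w * f (adj_transp k \<circ> T) * ((a - b) * i + 1)"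
    unfolding e fT fs dv by (simp add: power2_eq_square algebra_simps)
  also have "a * i * i + w\<^sup>2 * b + i = b + (a - b) * i * i + i" unfolding w2i by (simp add: algebra_simps)
  also have "\<dots> = b" unfolding i by simp
  also have "(a - b) * i + 1 = 0" unfolding i by simp
  finally show ?thesis by (simp add: b_def)
qed

lemma yop_kernel:
  assumes "1 \<le> k" "k < n" "S \<in> ST n Y"
  shows "(\<Sum>U\<in>ST n Y. yker n (adj_transp k) S U * f U) = fop k f S"
  using yrep_expand[OF adj_transp_permutes[OF assms(1,2)] assms(3), of f] assms
  by (simp add: yrep_gen yop_SYT ST_def)

lemma young_rep_comp:
  assumes "is_partition n \<nu>" "\<sigma> permutes {1..n}" "\<tau> permutes {1..n}"
  shows "young_rep \<nu> (\<sigma> \<circ> \<tau>) = young_rep \<nu> \<sigma> * young_rep \<nu> \<tau>"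
  unfolding young_rep_eq[OF assms(1,2)] young_rep_eq[OF assms(1,3)]
    young_rep_eq[OF assms(1) permutes_compose[OF assms(3,2)]] Tab_ST[OF assms(1)]
  by (rule kmat_yker_mult[OF assms(2,3), symmetric])

lemma young_rep_id:
  assumes "is_partition n \<nu>"
  shows "young_rep \<nu> id = 1\<^sub>m (d_tab \<nu>)"
  unfolding young_rep_eq[OF assms permutes_id] d_tab_def kmat_one[OF finite_Tab[OF assms]]
  by (intro kmat_cong) (simp add: yker_id)

lemma young_rep_inv:
  assumes "is_partition n \<nu>" "\<sigma> permutes {1..n}"
  shows "mat_adjoint (young_rep \<nu> \<sigma>) = young_rep \<nu> (inv' \<sigma>)"
  unfolding young_rep_eq[OF assms] young_rep_eq[OF assms(1) permutes_inv[OF assms(2)]] kmat_adjoint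
  by (intro kmat_cong) (simp add: yker_inv[OF assms(2)] Tab_ST[OF assms(1)])

lemma mat_sum_kmat:
  "mat_sum (card A) K (\<lambda>k. kmat A A (P k)) = kmat A A (\<lambda>a b. \<Sum>k\<in>K. P k a b)"
  by (rule eq_matI) (auto simp: mat_sum_def kmat_def)

section \<open>The frame operator of the whole orbit is scalar\<close>

context up_rep
begin

lemma frame:
  assumes "\<And>k. k \<in> {1..n} \<Longrightarrow> t k permutes {1..n}" "\<And>k. k \<in> {1..n} \<Longrightarrow> t k n = k"
  shows "frame_data n (d_sum L) (d_tab \<mu>) {\<sigma>. \<sigma> permutes {1..n}} (rep_sum L) (young_rep \<mu>) (Psi_sum L \<mu>) t"
proof
  show "1 \<le> n" by simp
  show "g \<circ> h \<in> {\<sigma>. \<sigma> permutes {1..n}}" if "g \<in> {\<sigma>. \<sigma> permutes {1..n}}" "h \<in> {\<sigma>. \<sigma> permutes {1..n}}" for g h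
    using that by (simp only: mem_Collect_eq permutes_compose)
  show "inv' g \<in> {\<sigma>. \<sigma> permutes {1..n}}" if "g \<in> {\<sigma>. \<sigma> permutes {1..n}}" for g
    using that by (simp only: mem_Collect_eq permutes_inv)
  show "rep_sum L (g \<circ> h) = rep_sum L g * rep_sum L h"
    if "g \<in> {\<sigma>. \<sigma> permutes {1..n}}" "h \<in> {\<sigma>. \<sigma> permutes {1..n}}" for g h
    using that rep_comp by (simp only: mem_Collect_eq)
  show "rep_sum L id = 1\<^sub>m (d_sum L)" by (rule rep_id)
  show "Psi_sum L \<mu> \<in> carrier_mat (d_sum L) (d_tab \<mu>)" by (rule Psi_carrier)
  show "mat_adjoint (Psi_sum L \<mu>) * Psi_sum L \<mu> = 1\<^sub>m (d_tab \<mu>)" by (rule Psi_isometry)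
  fix h assume "h \<in> {\<sigma>. \<sigma> permutes {1..n}}" "h n = n"
  hence h: "h permutes {1..m}" using perm_fixing_top[of h m] by (simp only: mem_Collect_eq)
  show "young_rep \<mu> h \<in> carrier_mat (d_tab \<mu>) (d_tab \<mu>)"
    unfolding young_rep_eq[OF mu h] d_tab_def by (rule kmat_carrier)
  show "young_rep \<mu> h * mat_adjoint (young_rep \<mu> h) = 1\<^sub>m (d_tab \<mu>)"
    unfolding young_rep_inv[OF mu h] young_rep_comp[OF mu h permutes_inv[OF h], symmetric]
      permutes_inv_o(1)[OF h] by (rule young_rep_id[OF mu])
  show "mat_adjoint (young_rep \<mu> h) * young_rep \<mu> h = 1\<^sub>m (d_tab \<mu>)"
    unfolding young_rep_inv[OF mu h] young_rep_comp[OF mu permutes_inv[OF h] h, symmetric]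
      permutes_inv_o(2)[OF h] by (rule young_rep_id[OF mu])
  show "rep_sum L h * Psi_sum L \<mu> = Psi_sum L \<mu> * young_rep \<mu> h" by (rule Psi_intertwines[OF h])
qed (use assms rep_inv rep_carrier in auto)

text \<open>The kernel q commutes with the generators, hence with the Jucys-Murphy elements, that
  is, with multiplication by contents. As contents separate all tableaux, q is diagonal, which also
  disposes of the blocks between different shapes. Commuting with admissible swaps makes it constant
  on each shape, and a trace yields the constant.\<close>

lemma tight:
  assumes t: "\<And>k. k \<in> {1..n} \<Longrightarrow> t k permutes {1..n}" "\<And>k. k \<in> {1..n} \<Longrightarrow> t k n = k"
  shows "frame_data.Q n (d_sum L) (rep_sum L) (Psi_sum L \<mu>) t =
    (real n * real (d_tab \<mu>) / real (d_sum L)) \<cdot>\<^sub>m 1\<^sub>m (d_sum L)"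
proof -
  interpret fr: frame_data n "d_sum L" "d_tab \<mu>" "{\<sigma>. \<sigma> permutes {1..n}}" "rep_sum L" "young_rep \<mu>" "Psi_sum L \<mu>" t
    by (rule frame[OF t])
  define phi where "phi k T R = (\<Sum>U\<in>Tabs L. yker n (t k) T U * psi U R)" for k T R
  define q where "q S T = (\<Sum>k\<in>{1..n}. \<Sum>R\<in>Tab \<mu>. phi k S R * phi k T R)" for S T
  have Mk: "fr.M k = kmat (Tabs L) (Tab \<mu>) (phi k)" if "k \<in> {1..n}" for k
  proof -
    have "fr.M k = kmat (Tabs L) (Tabs L) (yker n (t k)) * kmat (Tabs L) (Tab \<mu>) psi"
      unfolding rep_eq[OF t(1)[OF that], symmetric] Psi_eq[symmetric] by (rule fr.M_def)
    thus ?thesis unfolding kmat_mult[OF finite_Tabs] phi_def .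
  qed
  have Qq: "fr.Q = kmat (Tabs L) (Tabs L) q"
  proof -
    have "fr.Q = mat_sum (d_sum L) {1..n} (\<lambda>k. kmat (Tabs L) (Tabs L) (\<lambda>S T. \<Sum>R\<in>Tab \<mu>. phi k S R * phi k T R))"
      unfolding fr.Q_def
      by (rule mat_sum_cong) (simp add: Mk kmat_adjoint kmat_mult[OF finite_Tab_mu] del: atLeastAtMost_iff)
    thus ?thesis unfolding card_Tabs[symmetric] mat_sum_kmat q_def .
  qed
  have swap: "(\<Sum>U\<in>Tabs L. yker n (adj_transp j) S U * q U T) = (\<Sum>U\<in>Tabs L. q S U * yker n (adj_transp j) U T)"
    if j: "1 \<le> j" "j < n" and ST: "S \<in> Tabs L" "T \<in> Tabs L" for j S T
  proof -
    have jp: "adj_transp j permutes {1..n}" by (rule adj_transp_permutes[OF j])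
    let ?g = "rep_sum L (adj_transp j)"
    have gd: "dim_row ?g = d_sum L" "dim_col ?g = d_sum L" using rep_carrier[OF jp] by auto
    have Qd: "dim_row fr.Q = d_sum L" "dim_col fr.Q = d_sum L" by (simp_all add: fr.Q_def mat_sum_def)
    have "fr.Q * ?g = ?g * fr.Q * mat_adjoint ?g * ?g"
      using fr.Q_commutes[of "adj_transp j"] jp by simp
    also have "\<dots> = ?g * (fr.Q * (mat_adjoint ?g * ?g))" using gd Qd by (simp add: mat_assoc)
    also have "mat_adjoint ?g * ?g = 1\<^sub>m (d_sum L)" using fr.\<pi>_left_inv jp by simp
    also have "fr.Q * 1\<^sub>m (d_sum L) = fr.Q"
      by (rule right_mult_one_mat[of _ "d_sum L"]) (rule carrier_matI[OF Qd])
    finally have "kmat (Tabs L) (Tabs L) (\<lambda>S T. \<Sum>U\<in>Tabs L. q S U * yker n (adj_transp j) U T) =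
        kmat (Tabs L) (Tabs L) (\<lambda>S T. \<Sum>U\<in>Tabs L. yker n (adj_transp j) S U * q U T)"
      unfolding Qq rep_eq[OF jp] kmat_mult[OF finite_Tabs] .
    from kmat_eqD[OF this finite_Tabs finite_Tabs ST] show ?thesis by simp
  qed
  define Qop where "Qop f S = (\<Sum>T\<in>Tabs L. q S T * f T)" for f S
  have fopsum: "fop j f S = (\<Sum>U\<in>Tabs L. yker n (adj_transp j) S U * f U)"
    if j: "1 \<le> j" "j < n" and S: "S \<in> Tabs L" for j f S
    using yop_kernel[OF j in_ST_shape[OF S]] sum_Tabs_yker[OF adj_transp_permutes[OF j] S] by simp
  have Qop_fop: "Qop (fop j f) S = fop j (Qop f) S" if j: "1 \<le> j" "j < n" and S: "S \<in> Tabs L" for j f S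
  proof -
    have "Qop (fop j f) S = (\<Sum>T\<in>Tabs L. \<Sum>U\<in>Tabs L. q S T * yker n (adj_transp j) T U * f U)"
      unfolding Qop_def by (intro sum.cong) (simp_all add: fopsum[OF j] sum_distrib_left mult.assoc)
    also have "\<dots> = (\<Sum>U\<in>Tabs L. (\<Sum>T\<in>Tabs L. q S T * yker n (adj_transp j) T U) * f U)"
      by (subst sum.swap) (simp add: sum_distrib_right)
    also have "\<dots> = (\<Sum>U\<in>Tabs L. (\<Sum>T\<in>Tabs L. yker n (adj_transp j) S T * q T U) * f U)"
      by (intro sum.cong refl arg_cong2[of _ _ _ _ "(*)"] swap[OF j S, symmetric])
    also have "\<dots> = (\<Sum>T\<in>Tabs L. \<Sum>U\<in>Tabs L. yker n (adj_transp j) S T * q T U * f U)"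
      by (subst sum.swap) (simp add: sum_distrib_right)
    also have "\<dots> = fop j (Qop f) S"
      unfolding fopsum[OF j S] Qop_def by (simp add: sum_distrib_left mult.assoc)
    finally show ?thesis .
  qed
  have Tabs_shape: "U \<in> Tabs L" if "S \<in> Tabs L" "U \<in> SYT n" "shape U = shape S" for S U
    using Tabs_ST[OF that(1)] that by (auto simp: ST_def)
  have JM: "Qop (\<lambda>T. of_int (content T k) * f T) S = of_int (content S k) * Qop f S"
    if "1 \<le> k" "k \<le> n" "S \<in> Tabs L" for k f S
    using that
  proof (induction k arbitrary: f S rule: nat_induct_at_least)
    case base
    have "Qop (\<lambda>T. of_int (content T 1) * f T) S = 0"
      unfolding Qop_def using content_one[OF Tabs_SYT] by (intro sum.neutral) simp
    thus ?case using content_one[OF Tabs_SYT[OF base(2)]] by simp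
  next
    case (Suc k)
    have k: "1 \<le> k" "k < n" using Suc by auto
    let ?c = "\<lambda>k f T. of_int (content T k) * f T"
    have "Qop (?c (Suc k) f) S = Qop (\<lambda>T. fop k (?c k (fop k f)) T + fop k f T) S"
      unfolding Qop_def by (intro sum.cong refl) (simp add: fop_content[OF Tabs_SYT k])
    also have "\<dots> = Qop (fop k (?c k (fop k f))) S + Qop (fop k f) S"
      unfolding Qop_def by (simp add: distrib_left sum.distrib)
    also have "\<dots> = fop k (Qop (?c k (fop k f))) S + fop k (Qop f) S"
      using Qop_fop[OF k Suc(4)] by simp
    also have "fop k (Qop (?c k (fop k f))) S = fop k (?c k (fop k (Qop f))) S"
    proof (rule fop_cong[OF Tabs_SYT[OF Suc(4)] k])
      fix U assume "U \<in> SYT n" "shape U = shape S"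
      hence U: "U \<in> Tabs L" using Tabs_shape Suc(4) by blast
      show "Qop (?c k (fop k f)) U = ?c k (fop k (Qop f)) U"
        using Suc.IH[of U "fop k f"] k U Qop_fop[OF k U] by simp
    qed
    also have "\<dots> + fop k (Qop f) S = ?c (Suc k) (Qop f) S" by (rule fop_content[OF Tabs_SYT[OF Suc(4)] k])
    finally show ?case .
  qed
  have Qdelta: "Qop (\<lambda>U. g U * delta T U) S = q S T * g T" if "T \<in> Tabs L" for g S T
    unfolding Qop_def delta_def using that finite_Tabs by (simp add: if_distrib cong: if_cong)
  have Qdelta': "Qop (delta T) S = q S T" if "T \<in> Tabs L" for S T
    using Qdelta[OF that, of "\<lambda>_. 1"] by simp
  have diag: "q S T = 0" if st: "S \<in> Tabs L" "T \<in> Tabs L" "S \<noteq> T" for S T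
  proof -
    obtain k where k: "1 \<le> k" "k \<le> n" "content S k \<noteq> content T k"
      using content_inj[OF Tabs_SYT[OF st(1)] Tabs_SYT[OF st(2)]] st(3) by blast
    have "q S T * of_int (content T k) = of_int (content S k) * q S T"
      using JM[OF k(1,2) st(1), of "delta T"] Qdelta[OF st(2), of "\<lambda>U. of_int (content U k)" S]
        Qdelta'[OF st(2)] by simp
    thus ?thesis using k(3) by (simp add: mult.commute)
  qed
  have const: "q S S = q T T" if S: "S \<in> Tabs L" and T: "T \<in> ST n (shape S)" for S T
  proof (rule ST_connected[OF _ in_ST_shape[OF S] T])
    fix U k assume U: "U \<in> ST n (shape S)" and k: "1 \<le> k" "k < n"
      and c: "2 \<le> \<bar>content U (Suc k) - content U k\<bar>" and U': "adj_transp k \<circ> U \<in> ST n (shape S)"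
    let ?V = "adj_transp k \<circ> U"
    have UT: "U \<in> Tabs L" "?V \<in> Tabs L" using Tabs_ST[OF S] U U' by auto
    have ne: "?V \<noteq> U" using adj_transp_comp_neq[OF Tabs_SYT[OF UT(1)] k] .
    have Qf: "Qop f W = q W W * f W" if "W \<in> Tabs L" for f W
    proof -
      have "Qop f W = (\<Sum>T\<in>Tabs L. if T = W then q W W * f W else 0)"
        unfolding Qop_def using diag[OF that] by (intro sum.cong) auto
      thus ?thesis using that finite_Tabs by simp
    qed
    let ?w = "ywt (content U (Suc k) - content U k)"
    \<comment> \<open>Both orders of Q and the generator are applied to the basis vector of the
      swapped tableau and evaluated at \<open>U\<close>; the weight is nonzero for an admissible
      swap and cancels.\<close>
    have "q U U * fop k (delta ?V) U = fop k (Qop (delta ?V)) U"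
      using Qop_fop[OF k UT(1), of "delta ?V"] Qf[OF UT(1)] by simp
    moreover have "fop k (delta ?V) U = ?w" using ne by (simp add: fop_def delta_def)
    moreover have "fop k (Qop (delta ?V)) U = ?w * q ?V ?V"
      using ne Qf[OF UT(1), of "delta ?V"] Qf[OF UT(2), of "delta ?V"] by (simp add: fop_def delta_def)
    ultimately show "q U U = q ?V ?V" using ywt_nonzero[OF c] by simp
  qed
  \<comment> \<open>Trace over the block of one shape: each of the n projections contributes
    \<open>wt\<close> times the number of unit vectors, which is the dimension of
    \<open>\<mu>\<close>. The weights in \<open>Psi_sum\<close> are chosen such that the quotient by
    the block dimension no longer depends on the shape.\<close>
  have val: "q S S = real n * real (d_tab \<mu>) / real (d_sum L)" if S: "S \<in> Tabs L" for S
  proof -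
    obtain \<nu> where \<nu>: "\<nu> \<in> L" "S \<in> ST n (diagram \<nu>)" using S by (auto simp: Tabs_eq)
    have sh: "shape S = diagram \<nu>" using \<nu> by (simp add: ST_def)
    let ?c = "\<lambda>\<nu>. sqrt (real (d_tab \<nu>) / real (d_sum L))"
    have ph: "phi k T R = ?c \<nu> * yker n (t k) T (ext \<nu> R)"
      if k: "k \<in> {1..n}" and T: "T \<in> ST n (diagram \<nu>)" and R: "R \<in> Tab \<mu>" for k T R
    proof -
      have T': "T \<in> SYT n" "shape T = diagram \<nu>" using T by (auto simp: ST_def)
      have "phi k T R = (\<Sum>\<kappa>\<in>L. ?c \<kappa> * yker n (t k) T (ext \<kappa> R))"
        unfolding phi_def by (rule sum_psi[OF R])
      also have "\<dots> = (\<Sum>\<kappa>\<in>L. if \<kappa> = \<nu> then ?c \<nu> * yker n (t k) T (ext \<nu> R) else 0)"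
      proof (rule sum.cong[OF refl])
        fix \<kappa> assume \<kappa>: "\<kappa> \<in> L"
        have "shape (ext \<kappa> R) = diagram \<kappa>" using ext_ST[OF \<kappa> R] by (simp add: ST_def)
        thus "?c \<kappa> * yker n (t k) T (ext \<kappa> R) = (if \<kappa> = \<nu> then ?c \<nu> * yker n (t k) T (ext \<nu> R) else 0)"
          using yker_shape[OF t(1)[OF k] T'(1), of "ext \<kappa> R"] L_diagram_inj[OF \<kappa> \<nu>(1)] T'(2) by auto
      qed
      also have "\<dots> = ?c \<nu> * yker n (t k) T (ext \<nu> R)" using \<nu>(1) finL by simp
      finally show ?thesis .
    qed
    have norm: "(\<Sum>T\<in>ST n (diagram \<nu>). yker n (t k) T (ext \<nu> R) * yker n (t k) T (ext \<nu> R)) = 1"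
      if k: "k \<in> {1..n}" and R: "R \<in> Tab \<mu>" for k R
    proof -
      note e = ext_ST[OF \<nu>(1) R]
      have "(\<Sum>T\<in>ST n (diagram \<nu>). yker n (t k) T (ext \<nu> R) * yker n (t k) T (ext \<nu> R)) =
          (\<Sum>T\<in>ST n (diagram \<nu>). yker n (inv' (t k)) (ext \<nu> R) T * yker n (t k) T (ext \<nu> R))"
        by (intro sum.cong refl) (simp add: yker_inv[OF t(1)[OF k] e])
      also have "\<dots> = yker n (inv' (t k) \<circ> t k) (ext \<nu> R) (ext \<nu> R)"
        by (rule yker_comp[symmetric, OF permutes_inv[OF t(1)[OF k]] t(1)[OF k] e])
      finally show ?thesis by (simp add: permutes_inv_o(2)[OF t(1)[OF k]] yker_id)
    qed
    have "(\<Sum>T\<in>ST n (diagram \<nu>). q T T) = (\<Sum>T\<in>ST n (diagram \<nu>). q S S)"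
      using const[OF S, unfolded sh] by (intro sum.cong refl) simp
    hence "real (d_tab \<nu>) * q S S = (\<Sum>T\<in>ST n (diagram \<nu>). q T T)"
      using Tab_ST[OF L_part[OF \<nu>(1)]] by (simp add: d_tab_def)
    also have "\<dots> = (\<Sum>T\<in>ST n (diagram \<nu>). \<Sum>k\<in>{1..n}. \<Sum>R\<in>Tab \<mu>.
        wt \<nu> * (yker n (t k) T (ext \<nu> R) * yker n (t k) T (ext \<nu> R)))"
      unfolding q_def
    proof (intro sum.cong refl)
      fix T k R assume *: "T \<in> ST n (diagram \<nu>)" "k \<in> {1..n}" "R \<in> Tab \<mu>"
      have "?c \<nu> * ?c \<nu> = wt \<nu>" by (simp add: wt_def)
      thus "phi k T R * phi k T R = wt \<nu> * (yker n (t k) T (ext \<nu> R) * yker n (t k) T (ext \<nu> R))"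
        unfolding ph[OF *(2,1,3)] by (metis mult.assoc mult.left_commute)
    qed
    also have "\<dots> = (\<Sum>k\<in>{1..n}. \<Sum>T\<in>ST n (diagram \<nu>). \<Sum>R\<in>Tab \<mu>.
        wt \<nu> * (yker n (t k) T (ext \<nu> R) * yker n (t k) T (ext \<nu> R)))"
      by (rule sum.swap)
    also have "\<dots> = (\<Sum>k\<in>{1..n}. \<Sum>R\<in>Tab \<mu>. \<Sum>T\<in>ST n (diagram \<nu>).
        wt \<nu> * (yker n (t k) T (ext \<nu> R) * yker n (t k) T (ext \<nu> R)))"
      by (intro sum.cong refl sum.swap)
    also have "\<dots> = (\<Sum>k\<in>{1..n}. \<Sum>R\<in>Tab \<mu>. wt \<nu>)"
      by (intro sum.cong refl) (simp add: norm sum_distrib_left[symmetric] del: atLeastAtMost_iff)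
    also have "\<dots> = real n * (real (d_tab \<mu>) * wt \<nu>)" by (simp add: d_tab_def)
    finally have "real (d_tab \<nu>) * q S S = real (d_tab \<nu>) * (real n * real (d_tab \<mu>) / real (d_sum L))"
      by (simp add: wt_def)
    moreover have "real (d_tab \<nu>) \<noteq> 0" using d_tab_pos[OF L_part[OF \<nu>(1)]] by simp
    ultimately show ?thesis by (simp only: mult_cancel_left simp_thms)
  qed
  have "fr.Q = kmat (Tabs L) (Tabs L) (\<lambda>S T. (real n * real (d_tab \<mu>) / real (d_sum L)) * (if S = T then 1 else 0))"
    unfolding Qq
  proof (rule kmat_cong)
    fix S T assume "S \<in> Tabs L" "T \<in> Tabs L"
    thus "q S T = (real n * real (d_tab \<mu>) / real (d_sum L)) * (if S = T then 1 else 0)"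
      using val[of S] diag[of S T] by (cases "S = T") simp_all
  qed
  thus ?thesis unfolding card_Tabs[symmetric] kmat_one[OF finite_Tabs] kmat_smult .
qed

end

section \<open>Addable and removable boxes\<close>

definition addable :: "(nat \<times> nat) set \<Rightarrow> (nat \<times> nat) set" where
  "addable Y = {b. b \<notin> Y \<and> young (insert b Y)}"

definition removable :: "(nat \<times> nat) set \<Rightarrow> (nat \<times> nat) set" where
  "removable Y = {b \<in> Y. young (Y - {b})}"

lemma addable_diagram:
  assumes p: "is_partition n \<mu>"
  shows "addable (diagram \<mu>) = (\<lambda>i. (i, part \<mu> i + 1)) ` ({1} \<union> {i. 1 < i \<and> part \<mu> i < part \<mu> (i - 1)})"
    (is "_ = ?f ` ?I")
proof (intro Set.set_eqI iffI)
  fix b assume b: "b \<in> addable (diagram \<mu>)"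
  obtain i j where ij: "b = (i, j)" by force
  have Y: "young (insert (i, j) (diagram \<mu>))" and nb: "(i, j) \<notin> diagram \<mu>"
    using b ij by (auto simp: addable_def)
  have pos: "1 \<le> i" "1 \<le> j" using young_pos[OF Y, of i j] by auto
  have gt: "part \<mu> i < j" using nb pos by (simp add: mem_diagram)
  have "j - 1 \<le> part \<mu> i"
  proof (cases "j = 1")
    case False
    hence "1 \<le> j - 1" "j - 1 < j" using pos by auto
    thus ?thesis using young_down[OF Y, of i j i "j - 1"] pos by (auto simp: mem_diagram)
  qed simp
  hence j: "j = part \<mu> i + 1" using gt by simp
  have "part \<mu> i < part \<mu> (i - 1)" if "1 < i"
  proof -
    have "1 \<le> i - 1" "i - 1 < i" using that by auto
    thus ?thesis using young_down[OF Y, of i j "i - 1" j] pos j by (auto simp: mem_diagram)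
  qed
  hence "i \<in> ?I" using pos by (cases "i = 1") auto
  thus "b \<in> ?f ` ?I" using ij j by blast
next
  fix b assume "b \<in> ?f ` ?I"
  then obtain i where i: "b = (i, part \<mu> i + 1)" "i = 1 \<or> (1 < i \<and> part \<mu> i < part \<mu> (i - 1))" by auto
  note Y = young_diagram[OF p]
  have "young (insert b (diagram \<mu>))"
  proof (rule youngI)
    show "finite (insert b (diagram \<mu>))" using young_finite[OF Y] by simp
    show "1 \<le> a \<and> 1 \<le> c" if "(a, c) \<in> insert b (diagram \<mu>)" for a c
      using that i young_pos[OF Y, of a c] by auto
    show "(a - 1, c) \<in> insert b (diagram \<mu>)" if "(a, c) \<in> insert b (diagram \<mu>)" "1 < a" for a c
      using that i young_down[OF Y, of a c "a - 1" c] young_pos[OF Y, of a c] by (auto simp: mem_diagram)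
    show "(a, c - 1) \<in> insert b (diagram \<mu>)" if "(a, c) \<in> insert b (diagram \<mu>)" "1 < c" for a c
      using that i young_down[OF Y, of a c a "c - 1"] young_pos[OF Y, of a c] by (auto simp: mem_diagram)
  qed
  thus "b \<in> addable (diagram \<mu>)" using i by (auto simp: addable_def mem_diagram)
qed

lemma removable_diagram:
  assumes p: "is_partition n \<mu>"
  shows "removable (diagram \<mu>) = (\<lambda>i. (i, part \<mu> i)) ` {i. 1 \<le> i \<and> part \<mu> (i + 1) < part \<mu> i}"
    (is "_ = ?f ` ?I")
proof (intro Set.set_eqI iffI)
  note Y0 = young_diagram[OF p]
  fix b assume b: "b \<in> removable (diagram \<mu>)"
  obtain i j where ij: "b = (i, j)" by force
  have Y: "young (diagram \<mu> - {(i, j)})" and mb: "(i, j) \<in> diagram \<mu>"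
    using b ij by (auto simp: removable_def)
  have pos: "1 \<le> i" "1 \<le> j" using young_pos[OF Y0 mb] by auto
  have "\<not> j < part \<mu> i" using young_down[OF Y, of i "j + 1" i j] pos by (auto simp: mem_diagram)
  hence j: "j = part \<mu> i" using mb by (simp add: mem_diagram)
  have "\<not> j \<le> part \<mu> (i + 1)" using young_down[OF Y, of "i + 1" j i j] pos by (auto simp: mem_diagram)
  thus "b \<in> ?f ` ?I" using ij j pos by auto
next
  fix b assume "b \<in> ?f ` ?I"
  then obtain i where i: "b = (i, part \<mu> i)" "1 \<le> i" "part \<mu> (i + 1) < part \<mu> i" by auto
  note Y = young_diagram[OF p]
  have "young (diagram \<mu> - {b})"
  proof (rule youngI)
    show "finite (diagram \<mu> - {b})" using young_finite[OF Y] by simp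
    show "1 \<le> a \<and> 1 \<le> c" if "(a, c) \<in> diagram \<mu> - {b}" for a c
      using that young_pos[OF Y, of a c] by auto
    show "(a - 1, c) \<in> diagram \<mu> - {b}" if "(a, c) \<in> diagram \<mu> - {b}" "1 < a" for a c
      using that i young_down[OF Y, of a c "a - 1" c] young_pos[OF Y, of a c] by (auto simp: mem_diagram)
    show "(a, c - 1) \<in> diagram \<mu> - {b}" if "(a, c) \<in> diagram \<mu> - {b}" "1 < c" for a c
      using that i young_down[OF Y, of a c a "c - 1"] young_pos[OF Y, of a c] by (auto simp: mem_diagram)
  qed
  thus "b \<in> removable (diagram \<mu>)" using i by (auto simp: removable_def mem_diagram)
qed

lemma part_eq_0: "length \<mu> < i \<Longrightarrow> part \<mu> i = 0"
  by (simp add: part_def)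

text \<open>A removable box ends the last among the rows of its length, so there is exactly one for
  every distinct part.\<close>

lemma card_removable:
  assumes p: "is_partition n \<mu>"
  shows "card (removable (diagram \<mu>)) = card (set \<mu>)" "finite (removable (diagram \<mu>))"
proof -
  let ?I = "{i. 1 \<le> i \<and> part \<mu> (i + 1) < part \<mu> i}"
  have sub: "?I \<subseteq> {1..length \<mu>}" by (auto simp: part_def split: if_splits)
  show "finite (removable (diagram \<mu>))" unfolding removable_diagram[OF p] using finite_subset[OF sub] by simp
  have inj: "inj_on (part \<mu>) ?I"
  proof (rule inj_onI)
    have lt: "part \<mu> y < part \<mu> x" if "x \<in> ?I" "x < y" for x y
      using that part_mono[OF p, of "x + 1" y] by auto
    fix x y assume "x \<in> ?I" "y \<in> ?I" "part \<mu> x = part \<mu> y"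
    thus "x = y" using lt[of x y] lt[of y x] by (metis less_irrefl linorder_neqE_nat)
  qed
  have im: "part \<mu> ` ?I = set \<mu>"
  proof
    show "part \<mu> ` ?I \<subseteq> set \<mu>" using sub by (auto simp: part_def)
    show "set \<mu> \<subseteq> part \<mu> ` ?I"
    proof
      fix v assume "v \<in> set \<mu>"
      then obtain k where k: "k < length \<mu>" "\<mu> ! k = v" by (auto simp: in_set_conv_nth)
      let ?S = "{i \<in> {1..length \<mu>}. part \<mu> i = v}"
      have ne: "?S \<noteq> {}" using k by (auto simp: part_def intro!: exI[of _ "Suc k"])
      define i where "i = Max ?S"
      have i: "i \<in> ?S" unfolding i_def by (rule Max_in) (use ne in auto)
      have vpos: "0 < v" using i part_pos[OF p, of i] by auto
      have "part \<mu> (i + 1) \<noteq> v"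
      proof
        assume a: "part \<mu> (i + 1) = v"
        hence "i + 1 \<in> ?S" using vpos i part_eq_0[of \<mu> "i + 1"] by (cases "length \<mu> < i + 1") auto
        hence "i + 1 \<le> i" unfolding i_def by (intro Max_ge) auto
        thus False by simp
      qed
      hence "i \<in> ?I" using i part_mono[OF p, of i "i + 1"] by auto
      thus "v \<in> part \<mu> ` ?I" using i by auto
    qed
  qed
  have "card (removable (diagram \<mu>)) = card ?I"
    unfolding removable_diagram[OF p] by (rule card_image) (auto intro: inj_onI)
  also have "\<dots> = card (set \<mu>)" using card_image[OF inj] im by simp
  finally show "card (removable (diagram \<mu>)) = card (set \<mu>)" .
qed

text \<open>Apart from the first row, a row can be extended exactly when the row above it ends in a
  removable box.\<close>

lemma card_addable:
  assumes p: "is_partition n \<mu>"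
  shows "card (addable (diagram \<mu>)) = card (removable (diagram \<mu>)) + 1" "finite (addable (diagram \<mu>))"
proof -
  let ?I = "{i. 1 \<le> i \<and> part \<mu> (i + 1) < part \<mu> i}"
  let ?J = "{i. 1 < i \<and> part \<mu> i < part \<mu> (i - 1)}"
  have "?I \<subseteq> {1..length \<mu>}" by (auto simp: part_def split: if_splits)
  hence finI: "finite ?I" using finite_subset by blast
  have J: "?J = Suc ` ?I"
  proof (intro Set.set_eqI iffI)
    fix i assume "i \<in> ?J"
    thus "i \<in> Suc ` ?I" by (intro image_eqI[of _ _ "i - 1"]) auto
  qed auto
  have finJ: "finite ?J" using finI unfolding J by simp
  have "card (addable (diagram \<mu>)) = card ({1} \<union> ?J)"
    unfolding addable_diagram[OF p] by (rule card_image) (auto intro: inj_onI)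
  also have "\<dots> = Suc (card ?J)" using finJ by simp
  also have "card ?J = card ?I" unfolding J by (simp add: card_image)
  also have "card ?I = card (removable (diagram \<mu>))"
    unfolding removable_diagram[OF p] by (rule card_image[symmetric]) (auto intro: inj_onI)
  finally show "card (addable (diagram \<mu>)) = card (removable (diagram \<mu>)) + 1" by simp
  show "finite (addable (diagram \<mu>))" unfolding addable_diagram[OF p] using finJ by simp
qed

text \<open>Of two boxes on one diagonal, the upper left one lies in every diagram containing the
  other, hence already in \<open>Y\<close>.\<close>

lemma addable_content_inj:
  assumes "young Y" "b \<in> addable Y" "c \<in> addable Y" "superdiagonal b = superdiagonal c"
  shows "b = c"
proof -
  have aux: "\<not> fst b < fst c" if "b \<in> addable Y" "c \<in> addable Y" "superdiagonal b = superdiagonal c" for b c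
  proof
    assume lt: "fst b < fst c"
    have "snd b < snd c" using that(3) lt by (simp add: superdiagonal_def)
    moreover have "1 \<le> fst b \<and> 1 \<le> snd b" using young_pos[of "insert b Y" "fst b" "snd b"] that by (simp add: addable_def)
    ultimately have "b \<in> insert c Y"
      using young_down[of "insert c Y" "fst c" "snd c" "fst b" "snd b"] that lt by (simp add: addable_def)
    thus False using that lt by (auto simp: addable_def)
  qed
  have "fst b = fst c" using aux[OF assms(2,3,4)] aux[OF assms(3,2) assms(4)[symmetric]] by simp
  thus ?thesis using assms(4) by (simp add: superdiagonal_def prod_eq_iff)
qed

lemma addable_interlaced:
  assumes p: "is_partition n \<mu>" and b: "b \<in> addable (diagram \<mu>)" and c: "c \<in> addable (diagram \<mu>)"
    and lt: "superdiagonal c < superdiagonal b"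
  obtains x where "x \<in> removable (diagram \<mu>)" "superdiagonal c < superdiagonal x" "superdiagonal x < superdiagonal b"
proof -
  obtain i where i: "b = (i, part \<mu> i + 1)" "1 \<le> i" using b unfolding addable_diagram[OF p] by auto
  obtain k where k: "c = (k, part \<mu> k + 1)" "k = 1 \<or> (1 < k \<and> part \<mu> k < part \<mu> (k - 1))"
    using c unfolding addable_diagram[OF p] by auto
  have ik: "i < k"
  proof (rule ccontr)
    assume "\<not> i < k"
    hence "part \<mu> i \<le> part \<mu> k" using part_mono[OF p, of k i] k by auto
    thus False using lt i k \<open>\<not> i < k\<close> by (auto simp: superdiagonal_def)
  qed
  hence k': "1 < k" "part \<mu> k < part \<mu> (k - 1)" using k i by auto
  \<comment> \<open>The row just above the lower addable box is strictly longer than the row of that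
    box, so its end is removable; it lies no higher than the row of \<open>b\<close>.\<close>
  let ?x = "(k - 1, part \<mu> (k - 1))"
  have "?x \<in> removable (diagram \<mu>)" unfolding removable_diagram[OF p] using k' by auto
  moreover have "superdiagonal c < superdiagonal ?x" using k k' by (simp add: superdiagonal_def)
  moreover have "part \<mu> (k - 1) \<le> part \<mu> i" using part_mono[OF p i(2), of "k - 1"] ik by simp
  hence "superdiagonal ?x < superdiagonal b" using ik i by (simp add: superdiagonal_def)
  ultimately show ?thesis by (rule that)
qed

lemma up_set_added:
  assumes p: "is_partition m \<mu>"
  shows "bij_betw (\<lambda>\<nu>. added_box \<nu> \<mu>) (up_set \<mu>) (addable (diagram \<mu>))"
proof (rule bij_betwI')
  fix \<nu> \<kappa> assume a: "\<nu> \<in> up_set \<mu>" "\<kappa> \<in> up_set \<mu>"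
  show "added_box \<nu> \<mu> = added_box \<kappa> \<mu> \<longleftrightarrow> \<nu> = \<kappa>"
    using diagram_inj[OF up_setD(1)[OF p a(1)] up_setD(1)[OF p a(2)]] up_setD(3)[OF p a(1)] up_setD(3)[OF p a(2)] by auto
next
  fix \<nu> assume a: "\<nu> \<in> up_set \<mu>"
  show "added_box \<nu> \<mu> \<in> addable (diagram \<mu>)"
    using up_setD[OF p a] young_diagram[OF up_setD(1)[OF p a]] by (simp add: addable_def)
next
  fix b assume b: "b \<in> addable (diagram \<mu>)"
  have m: "sum_list \<mu> = m" using p by (simp add: is_partition_def)
  have Y: "young (insert b (diagram \<mu>))" "b \<notin> diagram \<mu>" using b by (auto simp: addable_def)
  obtain \<nu> where \<nu>: "is_partition (card (insert b (diagram \<mu>))) \<nu>" "diagram \<nu> = insert b (diagram \<mu>)"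
    using partition_of_young[OF Y(1)] by blast
  have "card (insert b (diagram \<mu>)) = Suc m" using Y(2) finite_diagram[of \<mu>] card_diagram[of \<mu>] m by simp
  hence u: "\<nu> \<in> up_set \<mu>" unfolding up_set_def m mem_Collect_eq using \<nu> Y(2) by metis
  have "added_box \<nu> \<mu> = b" using up_setD(2,3)[OF p u] \<nu>(2) Y(2) by auto
  thus "\<exists>\<nu>\<in>up_set \<mu>. b = added_box \<nu> \<mu>" using u by auto
qed

lemma card_up_set: "is_partition m \<mu> \<Longrightarrow> card (up_set \<mu>) = card (set \<mu>) + 1"
  using bij_betw_same_card[OF up_set_added] card_addable(1) card_removable(1) by metis

section \<open>The dimension of the induced representation\<close>

definition num_ST :: "(nat \<times> nat) set \<Rightarrow> nat" where
  "num_ST Y = card (ST (card Y) Y)"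

lemma num_ST_rec:
  assumes Y: "young Y" "Y \<noteq> {}"
  shows "num_ST Y = (\<Sum>c\<in>removable Y. num_ST (Y - {c}))"
proof -
  have fin: "finite Y" by (rule young_finite[OF Y(1)])
  obtain m where m: "card Y = Suc m" using Y(2) fin by (metis card_0_eq not0_implies_Suc)
  have finr: "finite (removable Y)" using fin by (simp add: removable_def)
  have cm: "card (Y - {c}) = m" if "c \<in> removable Y" for c
    using that m by (simp add: removable_def)
  have ins: "insert c (Y - {c}) = Y" "young (insert c (Y - {c}))" if "c \<in> removable Y" for c
    using that Y(1) by (auto simp: removable_def insert_absorb)
  let ?e = "\<lambda>c R. R(c := Suc m)"
  have U: "ST (Suc m) Y = (\<Union>c\<in>removable Y. ?e c ` ST m (Y - {c}))"
  proof
    show "ST (Suc m) Y \<subseteq> (\<Union>c\<in>removable Y. ?e c ` ST m (Y - {c}))"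
    proof
      fix T assume T: "T \<in> ST (Suc m) Y"
      define b where "b = box_of T (Suc m)"
      note r = restrict_ST[OF T, folded b_def]
      have "young (Y - {b})" using SYT_young[of "T(b := 0)" m] r(1) by (simp add: ST_def)
      hence "b \<in> removable Y" using r(2) by (simp add: removable_def)
      moreover have "T \<in> ?e b ` ST m (Y - {b})" using r(1,3) by (intro image_eqI[of _ _ "T(b := 0)"]) auto
      ultimately show "T \<in> (\<Union>c\<in>removable Y. ?e c ` ST m (Y - {c}))" by blast
    qed
    show "(\<Union>c\<in>removable Y. ?e c ` ST m (Y - {c})) \<subseteq> ST (Suc m) Y"
      using extend_ST[of _ m "Y - {c}" c for c] ins by fastforce
  qed
  have "card (ST (Suc m) Y) = (\<Sum>c\<in>removable Y. card (?e c ` ST m (Y - {c})))"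
    unfolding U
  proof (rule card_UN_disjoint[OF finr])
    show "\<forall>c\<in>removable Y. finite (?e c ` ST m (Y - {c}))" by (simp add: finite_ST)
    show "\<forall>c\<in>removable Y. \<forall>d\<in>removable Y. c \<noteq> d \<longrightarrow> ?e c ` ST m (Y - {c}) \<inter> ?e d ` ST m (Y - {d}) = {}"
    proof (intro ballI impI, rule ccontr)
      fix c d assume cd: "c \<in> removable Y" "d \<in> removable Y" "c \<noteq> d"
        "?e c ` ST m (Y - {c}) \<inter> ?e d ` ST m (Y - {d}) \<noteq> {}"
      then obtain R S where RS: "R \<in> ST m (Y - {c})" "S \<in> ST m (Y - {d})" "?e c R = ?e d S" by auto
      have "box_of (?e c R) (Suc m) = c" "box_of (?e d S) (Suc m) = d"
        using box_of_extend(1)[OF RS(1)] box_of_extend(1)[OF RS(2)] ins(2) cd by auto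
      thus False using RS(3) cd(3) by simp
    qed
  qed
  also have "\<dots> = (\<Sum>c\<in>removable Y. card (ST m (Y - {c})))"
    by (intro sum.cong refl card_image inj_onI) (auto intro: extend_inj)
  finally show ?thesis using cm by (simp add: num_ST_def m)
qed

lemma young_Un: "young X \<Longrightarrow> young Y \<Longrightarrow> young (X \<union> Y)"
  unfolding young_def by (intro conjI; blast)

lemma young_Int: "young X \<Longrightarrow> young Y \<Longrightarrow> young (X \<inter> Y)"
  unfolding young_def by (intro conjI; blast)

text \<open>The relation DU - UD = 1 in Young's lattice. For distinct b and c, adding b and removing
  c commute, and the remaining terms b = c leave one more copy of \<open>num_ST Y\<close> from the
  addable than from the removable boxes. The induction hypothesis evaluates the inner sums for the
  diagrams with one box less.\<close>

lemma sum_num_ST_addable: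
  "young Y \<Longrightarrow> (\<Sum>b\<in>addable Y. num_ST (insert b Y)) = (card Y + 1) * num_ST Y"
proof (induction "card Y" arbitrary: Y rule: less_induct)
  case less
  note Y = less.prems
  have fin: "finite Y" by (rule young_finite[OF Y])
  obtain \<mu> where \<mu>: "is_partition (card Y) \<mu>" "diagram \<mu> = Y" using partition_of_young[OF Y] by blast
  have fa: "finite (addable Y)" and ca: "card (addable Y) = card (removable Y) + 1"
    using card_addable[OF \<mu>(1)] \<mu>(2) by auto
  have fr: "finite (removable Z)" if "finite Z" for Z using that by (simp add: removable_def)
  have split: "num_ST (insert b Y) = num_ST Y + (\<Sum>c\<in>removable (insert b Y) - {b}. num_ST (insert b Y - {c}))"
    if b: "b \<in> addable Y" for b
  proof -
    have "b \<in> removable (insert b Y)" "insert b Y - {b} = Y" using b Y by (auto simp: addable_def removable_def)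
    thus ?thesis using num_ST_rec[of "insert b Y"] b fr[of "insert b Y"] fin
      by (simp add: addable_def sum.remove[of _ b])
  qed
  have "(\<Sum>b\<in>addable Y. num_ST (insert b Y)) =
      card (addable Y) * num_ST Y + (\<Sum>b\<in>addable Y. \<Sum>c\<in>removable (insert b Y) - {b}. num_ST (insert b Y - {c}))"
    by (simp add: split sum.distrib)
  also have "(\<Sum>b\<in>addable Y. \<Sum>c\<in>removable (insert b Y) - {b}. num_ST (insert b Y - {c})) =
      (\<Sum>(b, c)\<in>Sigma (addable Y) (\<lambda>b. removable (insert b Y) - {b}). num_ST (insert b Y - {c}))"
    using fa fr fin by (subst sum.Sigma) auto
  also have "\<dots> = (\<Sum>(c, b)\<in>Sigma (removable Y) (\<lambda>c. addable (Y - {c}) - {c}). num_ST (insert b (Y - {c})))"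
  proof (rule sum.reindex_bij_witness[of _ "\<lambda>(c, b). (b, c)" "\<lambda>(b, c). (c, b)"])
    fix x assume "x \<in> Sigma (addable Y) (\<lambda>b. removable (insert b Y) - {b})"
    then obtain b c where x: "x = (b, c)" "b \<in> addable Y" "c \<in> removable (insert b Y)" "c \<noteq> b" by auto
    have e: "insert b Y - {c} = insert b (Y - {c})" using x(4) by auto
    have y1: "young (insert b (Y - {c}))" using x(3) e by (simp add: removable_def)
    \<comment> \<open>Intersections of diagrams are diagrams, which shows that c is removable from
      \<open>Y\<close> itself; in the opposite direction a union shows that b is addable to
      \<open>Y\<close>.\<close>
    have "(insert b Y - {c}) \<inter> Y = Y - {c}" using x(2) by (auto simp: addable_def)
    hence y2: "young (Y - {c})" using young_Int[of "insert b Y - {c}" Y] x(3) Y by (simp add: removable_def)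
    have "c \<in> removable Y" "b \<in> addable (Y - {c}) - {c}"
      using x y1 y2 by (auto simp: removable_def addable_def)
    thus "(case x of (b, c) \<Rightarrow> (c, b)) \<in> Sigma (removable Y) (\<lambda>c. addable (Y - {c}) - {c})" using x by simp
    show "(case case x of (b, c) \<Rightarrow> (c, b) of (c, b) \<Rightarrow> num_ST (insert b (Y - {c}))) = (case x of (b, c) \<Rightarrow> num_ST (insert b Y - {c}))"
      using x(1) e by simp
  next
    fix x assume "x \<in> Sigma (removable Y) (\<lambda>c. addable (Y - {c}) - {c})"
    then obtain b c where x: "x = (c, b)" "c \<in> removable Y" "b \<in> addable (Y - {c})" "b \<noteq> c" by auto
    have e: "insert b Y - {c} = insert b (Y - {c})" using x(4) by auto
    have "Y \<union> insert b (Y - {c}) = insert b Y" by auto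
    hence "young (insert b Y)" using young_Un[OF Y, of "insert b (Y - {c})"] x(3) by (simp add: addable_def)
    hence "b \<in> addable Y" "c \<in> removable (insert b Y) - {b}"
      using x e by (auto simp: removable_def addable_def)
    thus "(case x of (c, b) \<Rightarrow> (b, c)) \<in> Sigma (addable Y) (\<lambda>b. removable (insert b Y) - {b})" using x by simp
  qed auto
  also have "\<dots> = (\<Sum>c\<in>removable Y. \<Sum>b\<in>addable (Y - {c}) - {c}. num_ST (insert b (Y - {c})))"
  proof (rule sum.Sigma[symmetric])
    show "finite (removable Y)" by (rule fr[OF fin])
    show "\<forall>c\<in>removable Y. finite (addable (Y - {c}) - {c})"
    proof
      fix c assume "c \<in> removable Y"
      hence "young (Y - {c})" by (simp add: removable_def)
      then obtain \<kappa> where "is_partition (card (Y - {c})) \<kappa>" "diagram \<kappa> = Y - {c}" using partition_of_young by blast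
      thus "finite (addable (Y - {c}) - {c})" using card_addable(2) by fastforce
    qed
  qed
  finally have main: "(\<Sum>b\<in>addable Y. num_ST (insert b Y)) = card (addable Y) * num_ST Y +
      (\<Sum>c\<in>removable Y. \<Sum>b\<in>addable (Y - {c}) - {c}. num_ST (insert b (Y - {c})))" .
  \<comment> \<open>The terms b = c are subtracted, hence the passage to integers.\<close>
  have "int (\<Sum>c\<in>removable Y. \<Sum>b\<in>addable (Y - {c}) - {c}. num_ST (insert b (Y - {c}))) =
      (\<Sum>c\<in>removable Y. int (card Y) * int (num_ST (Y - {c})) - int (num_ST Y))"
    unfolding of_nat_sum
  proof (rule sum.cong[OF refl])
    fix c assume c: "c \<in> removable Y"
    have yc: "young (Y - {c})" and cY: "c \<in> Y" using c by (auto simp: removable_def)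
    have cc: "card (Y - {c}) + 1 = card Y" using cY fin by (metis Suc_eq_plus1 card_Suc_Diff1)
    have ca: "c \<in> addable (Y - {c})" "insert c (Y - {c}) = Y" using cY Y by (auto simp: addable_def insert_absorb)
    obtain \<kappa> where "is_partition (card (Y - {c})) \<kappa>" "diagram \<kappa> = Y - {c}" using partition_of_young[OF yc] by blast
    hence fk: "finite (addable (Y - {c}))" using card_addable(2) by fastforce
    have "(\<Sum>b\<in>addable (Y - {c}). num_ST (insert b (Y - {c}))) = card Y * num_ST (Y - {c})"
      using less.hyps[OF _ yc] cc by (metis less_add_one)
    moreover have "(\<Sum>b\<in>addable (Y - {c}). num_ST (insert b (Y - {c}))) =
        num_ST Y + (\<Sum>b\<in>addable (Y - {c}) - {c}. num_ST (insert b (Y - {c})))"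
      using sum.remove[OF fk ca(1), of "\<lambda>b. num_ST (insert b (Y - {c}))"] ca(2) by simp
    ultimately have "num_ST Y + (\<Sum>b\<in>addable (Y - {c}) - {c}. num_ST (insert b (Y - {c}))) = card Y * num_ST (Y - {c})"
      by simp
    hence "int (num_ST Y) + int (\<Sum>b\<in>addable (Y - {c}) - {c}. num_ST (insert b (Y - {c}))) = int (card Y) * int (num_ST (Y - {c}))"
      by (metis of_nat_add of_nat_mult)
    thus "(\<Sum>b\<in>addable (Y - {c}) - {c}. int (num_ST (insert b (Y - {c})))) = int (card Y) * int (num_ST (Y - {c})) - int (num_ST Y)"
      by simp
  qed
  also have "\<dots> = int (card Y) * int (\<Sum>c\<in>removable Y. num_ST (Y - {c})) - int (card (removable Y)) * int (num_ST Y)"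
    by (simp add: sum_subtractf sum_distrib_left)
  also have "int (card Y) * int (\<Sum>c\<in>removable Y. num_ST (Y - {c})) = int (card Y) * int (num_ST Y)"
    using num_ST_rec[OF Y] by (cases "Y = {}") simp_all
  finally have "int (\<Sum>b\<in>addable Y. num_ST (insert b Y)) =
      int (card (addable Y) * num_ST Y) + (int (card Y) * int (num_ST Y) - int (card (removable Y)) * int (num_ST Y))"
    unfolding main of_nat_add by simp
  also have "\<dots> = int ((card Y + 1) * num_ST Y)" unfolding ca by (simp add: algebra_simps)
  finally show ?case by (simp only: of_nat_eq_iff)
qed

lemma d_tab_num_ST: "is_partition n \<nu> \<Longrightarrow> d_tab \<nu> = num_ST (diagram \<nu>)"
  using card_diagram[of \<nu>] by (simp add: d_tab_def num_ST_def Tab_ST is_partition_def)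

lemma d_sum_up_set:
  assumes p: "is_partition m \<mu>"
  shows "d_sum (up_set \<mu>) = Suc m * d_tab \<mu>"
proof -
  have "d_sum (up_set \<mu>) = (\<Sum>\<nu>\<in>up_set \<mu>. num_ST (insert (added_box \<nu> \<mu>) (diagram \<mu>)))"
    unfolding d_sum_def using d_tab_num_ST[OF up_setD(1)[OF p]] up_setD(3)[OF p] by (intro sum.cong refl) simp
  also have "\<dots> = (\<Sum>b\<in>addable (diagram \<mu>). num_ST (insert b (diagram \<mu>)))"
    by (rule sum.reindex_bij_betw[OF up_set_added[OF p]])
  also have "\<dots> = (card (diagram \<mu>) + 1) * num_ST (diagram \<mu>)"
    by (rule sum_num_ST_addable[OF young_diagram[OF p]])
  finally show ?thesis using card_diagram[of \<mu>] p d_tab_num_ST[OF p] by (simp add: is_partition_def)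
qed

section \<open>Isoclinic partitions\<close>

lemma (in frame_data) A_t: "k \<in> {1..n} \<Longrightarrow> mat_adjoint \<Psi> * M k = A (t k)"
  unfolding M_def A_def by (simp add: mat_assoc t_in del: atLeastAtMost_iff)

context up_rep
begin

text \<open>For \<open>L = \<mu>\<^sup>\<up>\<close> the dimensions add up to \<open>n d\<^sub>\<mu>\<close>, so the \<open>n\<close> projections sum to the identity
  and the subspaces are orthogonal.\<close>

lemma hval_full:
  assumes full: "L = up_set \<mu>" and m: "1 \<le> m" and R: "R \<in> Tab \<mu>"
  shows "hval R = 0"
proof -
  define t where "t k = Transposition.transpose k n" for k
  have t: "t k permutes {1..n}" "t k n = k" if "k \<in> {1..n}" for k
    using that permutes_swap_id[of k "{1..n}" n] by (auto simp: t_def)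
  interpret fr: frame_data n "d_sum L" "d_tab \<mu>" "{\<sigma>. \<sigma> permutes {1..n}}" "rep_sum L" "young_rep \<mu>" "Psi_sum L \<mu>" t
    by (rule frame[OF t])
  have "real n * real (d_tab \<mu>) / real (d_sum L) = 1"
    using d_sum_up_set[OF mu] full d_sum_pos by (metis div_self of_nat_0_less_iff of_nat_mult order_less_irrefl)
  hence "fr.Q = 1 \<cdot>\<^sub>m 1\<^sub>m (d_sum L)" using tight[OF t] by (simp only:)
  moreover have "1 \<cdot>\<^sub>m 1\<^sub>m (d_sum L) = (1\<^sub>m (d_sum L) :: real mat)" by (intro eq_matI) auto
  ultimately have Q: "fr.Q = 1\<^sub>m (d_sum L)" by simp
  define i where "i = to_nat_on (Tab \<mu>) R"
  have i: "i < d_tab \<mu>" unfolding i_def d_tab_def using kmat_index(2)[OF finite_Tab_mu finite_Tab_mu R R] .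
  define B where "B k = fr.A (t k)" for k
  have Bd: "dim_row (B k) = d_tab \<mu>" "dim_col (B k) = d_tab \<mu>" for k by (simp_all add: B_def)
  have "mat_sum (d_tab \<mu>) {1..n} (\<lambda>k. B k * mat_adjoint (B k)) =
      mat_sum (d_tab \<mu>) {1..n} (\<lambda>k. mat_adjoint (Psi_sum L \<mu>) * (fr.M k * mat_adjoint (fr.M k)) * Psi_sum L \<mu>)"
  proof (rule mat_sum_cong)
    fix k assume k: "k \<in> {1..n}"
    show "B k * mat_adjoint (B k) = mat_adjoint (Psi_sum L \<mu>) * (fr.M k * mat_adjoint (fr.M k)) * Psi_sum L \<mu>"
      unfolding B_def fr.A_t[OF k, symmetric] using fr.M_dims(1)[OF k] by (simp add: mat_assoc adjoint_mult)
  qed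
  also have "\<dots> = mat_adjoint (Psi_sum L \<mu>) * fr.Q * Psi_sum L \<mu>"
    unfolding fr.Q_def
    by (rule mat_sum_sandwich[symmetric, OF adjoint_carrier[OF fr.\<Psi>_carrier] fr.\<Psi>_carrier])
      (rule mult_carrier_mat[OF fr.M_carrier adjoint_carrier[OF fr.M_carrier]])
  also have "\<dots> = 1\<^sub>m (d_tab \<mu>)"
    unfolding Q using right_mult_one_mat[OF adjoint_carrier[OF fr.\<Psi>_carrier]] Psi_isometry by simp
  finally have "mat_sum (d_tab \<mu>) {1..n} (\<lambda>k. B k * mat_adjoint (B k)) $$ (i, i) = 1" using i by simp
  hence one: "(\<Sum>k\<in>{1..n}. (B k * mat_adjoint (B k)) $$ (i, i)) = 1" using i by (simp add: mat_sum_def)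
  have sq: "(B k * mat_adjoint (B k)) $$ (i, i) = (\<Sum>j<d_tab \<mu>. (B k $$ (i, j))\<^sup>2)" for k
    using i Bd by (simp add: mat_adjoint_mat scalar_prod_def lessThan_atLeast0 power2_eq_square)
  \<comment> \<open>In this diagonal entry the summand for k = n already equals 1, and the others
    are sums of squares. The one for k = m contains the square of \<open>hval R\<close>, which must
    therefore vanish.\<close>
  have "t n = id" by (simp add: t_def)
  hence "B n = 1\<^sub>m (d_tab \<mu>)"
    unfolding B_def fr.A_def using right_mult_one_mat[OF adjoint_carrier[OF fr.\<Psi>_carrier]] Psi_isometry
    by (simp add: rep_id)
  hence Bn: "(B n * mat_adjoint (B n)) $$ (i, i) = 1" using i by simp
  have tm: "t m = adj_transp m" by (simp add: t_def adj_transp_def)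
  have Bm: "B m $$ (i, i) = hval R"
    unfolding B_def fr.A_def tm compression_top[OF m] i_def
    using kmat_index(1)[OF finite_Tab_mu finite_Tab_mu R R, of "\<lambda>R R'. if R = R' then hval R else 0"] by simp
  have nonneg: "0 \<le> (B k * mat_adjoint (B k)) $$ (i, i)" for k unfolding sq by (intro sum_nonneg) simp
  have "(B n * mat_adjoint (B n)) $$ (i, i) + (B m * mat_adjoint (B m)) $$ (i, i) =
      (\<Sum>k\<in>{n, m}. (B k * mat_adjoint (B k)) $$ (i, i))" by simp
  also have "\<dots> \<le> (\<Sum>k\<in>{1..n}. (B k * mat_adjoint (B k)) $$ (i, i))"
    using m nonneg by (intro sum_mono2) auto
  finally have "(B m * mat_adjoint (B m)) $$ (i, i) \<le> 0" using one Bn by simp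
  moreover have "(B m $$ (i, i))\<^sup>2 \<le> (B m * mat_adjoint (B m)) $$ (i, i)"
    unfolding sq using i by (intro member_le_sum[of i "{..<d_tab \<mu>}" "\<lambda>j. (B m $$ (i, j))\<^sup>2"]) auto
  ultimately have "(B m $$ (i, i))\<^sup>2 \<le> 0" by (meson order_trans)
  thus ?thesis using Bm by simp
qed

text \<open>Let k be the image of n, so k is at most m. The permutation (k m) s_m also carries n to
  k, so dividing \<sigma> by it leaves an element fixing n.\<close>

lemma double_coset:
  assumes \<sigma>: "\<sigma> permutes {1..n}" "\<sigma> n \<noteq> n" and m: "1 \<le> m"
  obtains h h' where "h permutes {1..m}" "h' permutes {1..m}" "\<sigma> = h \<circ> adj_transp m \<circ> h'"
proof -
  define k where "k = \<sigma> n"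
  have k: "k \<in> {1..m}" using permutes_in_image[OF \<sigma>(1), of n] \<sigma>(2) by (auto simp: k_def)
  define h where "h = Transposition.transpose k m"
  have h: "h permutes {1..m}" unfolding h_def using k m by (intro permutes_swap_id) auto
  have sp: "adj_transp m permutes {1..n}" using m by (intro adj_transp_permutes) auto
  have hp: "h \<circ> adj_transp m permutes {1..n}" by (rule permutes_compose[OF sp permutes_mono_top[OF h]])
  have top: "(h \<circ> adj_transp m) n = k" by (simp add: h_def)
  define h' where "h' = inv' (h \<circ> adj_transp m) \<circ> \<sigma>"
  have "h' n = n" using permutes_inverses(2)[OF hp, of n] top by (simp add: h'_def k_def)
  hence "h' permutes {1..m}"
    unfolding h'_def by (intro perm_fixing_top[OF permutes_compose[OF \<sigma>(1) permutes_inv[OF hp]]])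
  moreover have "\<sigma> = h \<circ> adj_transp m \<circ> h'"
    unfolding h'_def by (simp add: comp_assoc[symmetric] permutes_inv_o(1)[OF hp])
  ultimately show ?thesis using h that by blast
qed

lemma top_square:
  assumes "1 \<le> m"
  shows "mat_adjoint (mat_adjoint (Psi_sum L \<mu>) * rep_sum L (adj_transp m) * Psi_sum L \<mu>) *
      (mat_adjoint (Psi_sum L \<mu>) * rep_sum L (adj_transp m) * Psi_sum L \<mu>) = \<alpha> \<cdot>\<^sub>m 1\<^sub>m (d_tab \<mu>) \<longleftrightarrow>
    (\<forall>R\<in>Tab \<mu>. (hval R)\<^sup>2 = \<alpha>)"
proof -
  have K: "(\<Sum>U\<in>Tab \<mu>. (if U = R then hval U else 0) * (if U = R' then hval U else 0)) =
      (if R = R' then (hval R)\<^sup>2 else 0)" if "R \<in> Tab \<mu>" for R R'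
  proof -
    have "(\<Sum>U\<in>Tab \<mu>. (if U = R then hval U else 0) * (if U = R' then hval U else 0)) =
        (\<Sum>U\<in>Tab \<mu>. if U = R then (if R = R' then (hval R)\<^sup>2 else 0) else 0)"
      by (intro sum.cong refl) (auto simp: power2_eq_square)
    thus ?thesis using that finite_Tab_mu by simp
  qed
  have E: "mat_adjoint (mat_adjoint (Psi_sum L \<mu>) * rep_sum L (adj_transp m) * Psi_sum L \<mu>) *
      (mat_adjoint (Psi_sum L \<mu>) * rep_sum L (adj_transp m) * Psi_sum L \<mu>) =
      kmat (Tab \<mu>) (Tab \<mu>) (\<lambda>R R'. if R = R' then (hval R)\<^sup>2 else 0)"
    unfolding compression_top[OF assms] kmat_adjoint kmat_mult[OF finite_Tab_mu]
    by (rule kmat_cong) (simp add: K)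
  have F: "\<alpha> \<cdot>\<^sub>m 1\<^sub>m (d_tab \<mu>) = kmat (Tab \<mu>) (Tab \<mu>) (\<lambda>R R'. \<alpha> * (if R = R' then 1 else 0))"
    unfolding d_tab_def kmat_one[OF finite_Tab_mu] kmat_smult ..
  show ?thesis unfolding E F
  proof
    assume eq: "kmat (Tab \<mu>) (Tab \<mu>) (\<lambda>R R'. if R = R' then (hval R)\<^sup>2 else 0) =
        kmat (Tab \<mu>) (Tab \<mu>) (\<lambda>R R'. \<alpha> * (if R = R' then 1 else 0))"
    show "\<forall>R\<in>Tab \<mu>. (hval R)\<^sup>2 = \<alpha>"
    proof
      fix R assume R: "R \<in> Tab \<mu>"
      show "(hval R)\<^sup>2 = \<alpha>" using kmat_eqD[OF eq finite_Tab_mu finite_Tab_mu R R] by simp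
    qed
  next
    assume "\<forall>R\<in>Tab \<mu>. (hval R)\<^sup>2 = \<alpha>"
    thus "kmat (Tab \<mu>) (Tab \<mu>) (\<lambda>R R'. if R = R' then (hval R)\<^sup>2 else 0) =
        kmat (Tab \<mu>) (Tab \<mu>) (\<lambda>R R'. \<alpha> * (if R = R' then 1 else 0))"
      by (intro kmat_cong) auto
  qed
qed

text \<open>The pair of subspaces with indices n and m suffices: its Gram matrix is the compression
  of \<open>adj_transp m\<close> up to unitaries on both sides. Conjugating the scalar matrix back
  gives the condition on the diagonal matrix of the values \<open>hval\<close>.\<close>

lemma isoclinic_hval:
  assumes m: "1 \<le> m" and t: "\<And>k. k \<in> {1..n} \<Longrightarrow> t k permutes {1..n}" "\<And>k. k \<in> {1..n} \<Longrightarrow> t k n = k"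
    and eq: "equi_isoclinic n (d_tab \<mu>) (d_sum L) (\<lambda>k. mat_image (rep_sum L (t k)) (W_sub L \<mu>))"
  obtains \<alpha> where "\<And>R. R \<in> Tab \<mu> \<Longrightarrow> (hval R)\<^sup>2 = \<alpha>"
proof -
  interpret fr: frame_data n "d_sum L" "d_tab \<mu>" "{\<sigma>. \<sigma> permutes {1..n}}" "rep_sum L" "young_rep \<mu>" "Psi_sum L \<mu>" t
    by (rule frame[OF t])
  have "fr.W k = mat_image (rep_sum L (t k)) (W_sub L \<mu>)" if "k \<in> {1..n}" for k
    unfolding fr.W_def fr.M_def W_sub_def by (rule mat_image_mult[OF rep_carrier[OF t(1)[OF that]] Psi_carrier])
  hence eqW: "equi_isoclinic n (d_tab \<mu>) (d_sum L) fr.W"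
    using eq unfolding equi_isoclinic_def by (simp del: atLeastAtMost_iff)
  show ?thesis
  proof (rule fr.equi_isoclinicD[OF eqW])
    fix \<alpha> assume \<alpha>: "\<And>k l. k \<in> {1..n} \<Longrightarrow> l \<in> {1..n} \<Longrightarrow> k \<noteq> l \<Longrightarrow>
      mat_adjoint (fr.A (inv' (t k) \<circ> t l)) * fr.A (inv' (t k) \<circ> t l) = \<alpha> \<cdot>\<^sub>m 1\<^sub>m (d_tab \<mu>)"
    have nm: "n \<in> {1..n}" "m \<in> {1..n}" "n \<noteq> m" using m by auto
    define g where "g = inv' (t n) \<circ> t m"
    have g: "g permutes {1..n}" "g n \<noteq> n" using fr.gram_moves_top[OF nm] by (auto simp: g_def)
    obtain h h' where h: "h permutes {1..m}" "h' permutes {1..m}" and gh: "g = h \<circ> adj_transp m \<circ> h'"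
      using double_coset[OF g m] by blast
    have fix_n: "h n = n" "h' n = n" using h by (auto intro: permutes_not_in)
    have mem: "adj_transp m \<in> {\<sigma>. \<sigma> permutes {1..n}}" "h \<in> {\<sigma>. \<sigma> permutes {1..n}}" "h' \<in> {\<sigma>. \<sigma> permutes {1..n}}"
      unfolding mem_Collect_eq using permutes_mono_top[OF h(1)] permutes_mono_top[OF h(2)] adj_transp_permutes[OF m] by auto
    let ?S = "mat_adjoint (fr.A (adj_transp m)) * fr.A (adj_transp m)" and ?r = "young_rep \<mu> h'"
    have Sd: "dim_row ?S = d_tab \<mu>" "dim_col ?S = d_tab \<mu>" by simp_all
    have rc: "?r \<in> carrier_mat (d_tab \<mu>) (d_tab \<mu>)" using fr.\<rho>_carrier[OF mem(3) fix_n(2)] .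
    have rd: "dim_row ?r = d_tab \<mu>" "dim_col ?r = d_tab \<mu>" using carrier_matD[OF rc] by auto
    have "mat_adjoint ?r * ?S * ?r = \<alpha> \<cdot>\<^sub>m 1\<^sub>m (d_tab \<mu>)"
      using \<alpha>[OF nm] fr.A_conj_square[OF mem(1) mem(2) fix_n(1) mem(3) fix_n(2)] unfolding g_def[symmetric] gh by simp
    hence "?r * (mat_adjoint ?r * ?S * ?r) * mat_adjoint ?r = ?r * (\<alpha> \<cdot>\<^sub>m 1\<^sub>m (d_tab \<mu>)) * mat_adjoint ?r" by simp
    moreover have "?r * (mat_adjoint ?r * ?S * ?r) * mat_adjoint ?r = ?S"
    proof -
      have "?r * (mat_adjoint ?r * ?S * ?r) * mat_adjoint ?r = ?r * (mat_adjoint ?r * (?S * (?r * mat_adjoint ?r)))"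
        using rd Sd by (simp add: mat_assoc)
      also have "\<dots> = ?S * (?r * mat_adjoint ?r)"
        by (rule mat_cancel[OF fr.\<rho>_unitary[OF mem(3) fix_n(2)]]) (use rd Sd in simp_all)
      also have "\<dots> = ?S" unfolding fr.\<rho>_unitary[OF mem(3) fix_n(2)]
        by (rule right_mult_one_mat[OF carrier_matI[OF Sd]])
      finally show ?thesis .
    qed
    moreover have "?r * (\<alpha> \<cdot>\<^sub>m 1\<^sub>m (d_tab \<mu>)) * mat_adjoint ?r = \<alpha> \<cdot>\<^sub>m 1\<^sub>m (d_tab \<mu>)"
      using mult_smult_distrib[OF rc one_carrier_mat] mult_smult_assoc_mat[OF rc adjoint_carrier[OF rc]]
        fr.\<rho>_unitary[OF mem(3) fix_n(2)] right_mult_one_mat[OF rc] by simp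
    ultimately have "?S = \<alpha> \<cdot>\<^sub>m 1\<^sub>m (d_tab \<mu>)" by simp
    hence "\<forall>R\<in>Tab \<mu>. (hval R)\<^sup>2 = \<alpha>" unfolding fr.A_def top_square[OF m] .
    thus ?thesis using that by blast
  qed
qed

lemma hval_isoclinic:
  assumes m: "1 \<le> m" and t: "\<And>k. k \<in> {1..n} \<Longrightarrow> t k permutes {1..n}" "\<And>k. k \<in> {1..n} \<Longrightarrow> t k n = k"
    and hv: "\<And>R. R \<in> Tab \<mu> \<Longrightarrow> (hval R)\<^sup>2 = \<alpha>" and g: "g permutes {1..n}" "g n \<noteq> n"
  shows "mat_adjoint (mat_adjoint (Psi_sum L \<mu>) * rep_sum L g * Psi_sum L \<mu>) *
    (mat_adjoint (Psi_sum L \<mu>) * rep_sum L g * Psi_sum L \<mu>) = \<alpha> \<cdot>\<^sub>m 1\<^sub>m (d_tab \<mu>)"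
proof -
  interpret fr: frame_data n "d_sum L" "d_tab \<mu>" "{\<sigma>. \<sigma> permutes {1..n}}" "rep_sum L" "young_rep \<mu>" "Psi_sum L \<mu>" t
    by (rule frame[OF t])
  obtain h h' where h: "h permutes {1..m}" "h' permutes {1..m}" and gh: "g = h \<circ> adj_transp m \<circ> h'"
    using double_coset[OF g m] by blast
  have fix_n: "h n = n" "h' n = n" using h by (auto intro: permutes_not_in)
  have mem: "adj_transp m \<in> {\<sigma>. \<sigma> permutes {1..n}}" "h \<in> {\<sigma>. \<sigma> permutes {1..n}}" "h' \<in> {\<sigma>. \<sigma> permutes {1..n}}"
    unfolding mem_Collect_eq using permutes_mono_top[OF h(1)] permutes_mono_top[OF h(2)] adj_transp_permutes[OF m] by auto
  have rc: "young_rep \<mu> h' \<in> carrier_mat (d_tab \<mu>) (d_tab \<mu>)" using fr.\<rho>_carrier[OF mem(3) fix_n(2)] .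
  have S: "mat_adjoint (fr.A (adj_transp m)) * fr.A (adj_transp m) = \<alpha> \<cdot>\<^sub>m 1\<^sub>m (d_tab \<mu>)"
    unfolding fr.A_def top_square[OF m] using hv by blast
  have "mat_adjoint (fr.A g) * fr.A g = mat_adjoint (young_rep \<mu> h') * (\<alpha> \<cdot>\<^sub>m 1\<^sub>m (d_tab \<mu>)) * young_rep \<mu> h'"
    using fr.A_conj_square[OF mem(1) mem(2) fix_n(1) mem(3) fix_n(2)] unfolding gh S .
  also have "\<dots> = \<alpha> \<cdot>\<^sub>m 1\<^sub>m (d_tab \<mu>)"
    using mult_smult_distrib[OF adjoint_carrier[OF rc] one_carrier_mat] mult_smult_assoc_mat[OF adjoint_carrier[OF rc] rc]
      fr.\<rho>_unitary'[OF mem(3) fix_n(2)] right_mult_one_mat[OF adjoint_carrier[OF rc]] by simp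
  finally show ?thesis unfolding fr.A_def .
qed

end

text \<open>Between consecutive poles \<open>y \<mapsto> \<Sum> w j / (c j - y)\<close> is increasing. Since the sum over \<open>I\<close> and the
  sum over the complement are negatives of each other at the points \<open>x i\<close>, equal absolute values at these
  points force the membership in \<open>I\<close> to alternate.\<close>

lemma alternating_poles:
  fixes c w x :: "nat \<Rightarrow> real"
  assumes M: "2 \<le> M" and c: "\<And>i j. i < j \<Longrightarrow> j < M \<Longrightarrow> c j < c i" and w: "\<And>i. i < M \<Longrightarrow> 0 < w i"
    and x: "\<And>i. i < M - 1 \<Longrightarrow> c (i + 1) < x i \<and> x i < c i"
    and full: "\<And>i. i < M - 1 \<Longrightarrow> (\<Sum>j<M. w j / (c j - x i)) = 0"
    and I: "I \<subseteq> {..<M}" "I \<noteq> {}" "I \<noteq> {..<M}"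
    and sq: "\<And>i. i < M - 1 \<Longrightarrow> (\<Sum>j\<in>I. w j / (c j - x i))\<^sup>2 = \<beta>"
    and i: "i < M - 1"
  shows "i \<in> I \<longleftrightarrow> i + 1 \<notin> I"
proof -
  define h where "h J i = (\<Sum>j\<in>J. w j / (c j - x i))" for J i
  define I' where "I' = {..<M} - I"
  have I': "I' \<subseteq> {..<M}" "I' \<noteq> {}" using I by (auto simp: I'_def)
  have finI: "finite I" "finite I'" using finite_subset[OF I(1)] finite_subset[OF I'(1)] by auto
  have compl: "h I' i = - h I i" if "i < M - 1" for i
    using full[OF that] sum.subset_diff[OF I(1), of "\<lambda>j. w j / (c j - x i)"] by (simp add: h_def I'_def)
  have cle: "c j \<le> c i" if "i \<le> j" "j < M" for i j using c[of i j] that by (cases "i = j") auto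
  \<comment> \<open>The points x i < x (i - 1) are separated by the pole c i alone. If i is not in
    \<open>J\<close>, no pole of \<open>J\<close> lies between them, and each summand is larger at x
    (i - 1).\<close>
  have mono: "h J i < h J (i - 1)" if J: "J \<subseteq> {..<M}" "J \<noteq> {}" "i \<notin> J" and i: "1 \<le> i" "i < M - 1" for J i
    unfolding h_def
  proof (rule sum_strict_mono)
    show "finite J" using J finite_subset by blast
    show "J \<noteq> {}" by fact
    fix j assume j: "j \<in> J"
    have jM: "j < M" and ji: "j \<noteq> i" using j J by auto
    have xi: "c (i + 1) < x i" "x i < c i" "c i < x (i - 1)" "x (i - 1) < c (i - 1)"
      using x[of i] x[of "i - 1"] i by auto
    show "w j / (c j - x i) < w j / (c j - x (i - 1))"
    proof (cases "j < i")
      case True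
      have "c (i - 1) \<le> c j" using cle[of j "i - 1"] True i by simp
      thus ?thesis using xi w[OF jM] by (intro divide_strict_left_mono mult_pos_pos) auto
    next
      case False
      hence "c j \<le> c (i + 1)" using cle[of "i + 1" j] ji jM by simp
      hence "c j - x (i - 1) < c j - x i" "c j - x i < 0" using xi by auto
      thus ?thesis using w[OF jM] by (intro divide_strict_left_mono mult_neg_neg) auto
    qed
  qed
  have flip: "h I i = - h I (i - 1) \<or> h I i = h I (i - 1)" if "1 \<le> i" "i < M - 1" for i
  proof -
    have "(h I i)\<^sup>2 = (h I (i - 1))\<^sup>2" using sq[of i] sq[of "i - 1"] that by (simp add: h_def)
    thus ?thesis by (auto simp: power2_eq_iff)
  qed
  \<comment> \<open>Strict monotonicity, of the sum over I or of that over its complement, rules out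
    equal values at neighbouring points; the values are opposite, and the set containing the pole
    between them determines the signs.\<close>
  have mid: "if i \<in> I then 0 < h I i \<and> h I (i - 1) < 0 else h I i < 0 \<and> 0 < h I (i - 1)"
    if i: "1 \<le> i" "i < M - 1" for i
  proof (cases "i \<in> I")
    case True
    have "h I' i < h I' (i - 1)" using mono[OF I' _ i] True by (simp add: I'_def)
    hence "h I (i - 1) < h I i" using compl[of i] compl[of "i - 1"] i by simp
    thus ?thesis using flip[OF i] True by auto
  next
    case False
    hence "h I i < h I (i - 1)" using mono[OF I(1,2) _ i] by simp
    thus ?thesis using flip[OF i] False by auto
  qed
  \<comment> \<open>The first and the last pole have evaluation points on one side only. There the
    missing comparison is replaced by the fact that all poles of \<open>J\<close> lie on the same
    side of the extreme point.\<close>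
  have left: "h J 0 < 0" if "J \<subseteq> {..<M}" "J \<noteq> {}" "0 \<notin> J" for J
  proof -
    have "w j / (c j - x 0) < 0" if "j \<in> J" for j
    proof -
      have jM: "j < M" and "1 \<le> j" using that \<open>J \<subseteq> {..<M}\<close> \<open>0 \<notin> J\<close> by (auto simp: Suc_le_eq intro: gr0I)
      hence "c j \<le> c 1" using cle by blast
      thus ?thesis using x[of 0] w[OF jM] M by (intro divide_pos_neg) auto
    qed
    hence "0 < (\<Sum>j\<in>J. - (w j / (c j - x 0)))" using that finite_subset[OF that(1)] by (intro sum_pos) auto
    thus ?thesis unfolding h_def by (simp add: sum_negf)
  qed
  have right: "0 < h J (M - 2)" if "J \<subseteq> {..<M}" "J \<noteq> {}" "M - 1 \<notin> J" for J
  proof -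
    have "0 < w j / (c j - x (M - 2))" if "j \<in> J" for j
    proof -
      have jM: "j < M" and "j \<noteq> M - 1" using that \<open>J \<subseteq> {..<M}\<close> \<open>M - 1 \<notin> J\<close> by auto
      hence "j \<le> M - 2" by simp
      hence "c (M - 2) \<le> c j" using cle[of j "M - 2"] M by simp
      moreover have "M - 2 < M - 1" using M by linarith
      hence "x (M - 2) < c (M - 2)" using x by blast
      ultimately show ?thesis using w[OF jM] by (intro divide_pos_pos) auto
    qed
    thus ?thesis unfolding h_def using that finite_subset[OF that(1)] by (intro sum_pos) auto
  qed
  \<comment> \<open>The sign of the sum at x i is read off once from the pole c i above it and once
    from the pole c (i + 1) below it; the two readings agree only if membership alternates.\<close>
  have A: "if i \<in> I then 0 < h I i else h I i < 0"
  proof (cases "i = 0")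
    case True
    thus ?thesis using left[OF I(1,2)] left[OF I'] compl[of 0] i by (auto simp: I'_def)
  next
    case False
    thus ?thesis using mid[of i] i by (auto split: if_splits)
  qed
  have B: "if i + 1 \<in> I then h I i < 0 else 0 < h I i"
  proof (cases "i + 1 < M - 1")
    case True
    thus ?thesis using mid[of "i + 1"] by (auto split: if_splits)
  next
    case False
    hence e: "i = M - 2" "i + 1 = M - 1" using i by auto
    show ?thesis using right[OF I(1,2), folded e(1), folded e(2)] right[OF I', folded e(1), folded e(2)] compl[OF i] i
      by (auto simp: I'_def)
  qed
  show ?thesis using A B by (auto split: if_splits)
qed

section \<open>The enumeration of addable boxes and the isoclinic sets\<close>

lemma ex1_sorted_list:
  fixes f :: "'b \<Rightarrow> int"
  assumes "finite A" "inj_on f A"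
  shows "\<exists>!xs. set xs = A \<and> sorted_wrt (\<lambda>x y. f x > f y) xs"
proof -
  obtain ys where ys: "set ys = A" "distinct ys" using finite_distinct_list[OF assms(1)] by blast
  define xs where "xs = rev (sort_key f ys)"
  have s: "set xs = A" using ys by (simp add: xs_def)
  have "distinct (map f (sort_key f ys))" using ys assms(2) by (simp add: distinct_map)
  hence "sorted_wrt (<) (map f (sort_key f ys))" by (simp add: strict_sorted_iff)
  hence sw: "sorted_wrt (\<lambda>x y. f x > f y) xs" by (simp add: xs_def sorted_wrt_rev sorted_wrt_map)
  have uniq: "zs = xs" if "set zs = A" "sorted_wrt (\<lambda>x y. f x > f y) zs" for zs
  proof -
    have st: "sorted_wrt (<) (rev (map f zs))" if "sorted_wrt (\<lambda>x y. f x > f y) zs" for zs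
      using that by (simp add: sorted_wrt_rev sorted_wrt_map)
    have "rev (map f zs) = rev (map f xs)"
      by (rule strict_sorted_equal[OF st[OF sw] st[OF that(2)]]) (simp add: s that(1))
    hence "map f zs = map f xs" by simp
    thus ?thesis using inj_on_map_eq_map[of f zs xs] assms(2) that(1) s by simp
  qed
  show ?thesis using s sw uniq by blast
qed

text \<open>Addable boxes have pairwise different contents, so exactly one list is sorted as
  required, and this is what the definite description in \<open>up_enum\<close> denotes.\<close>

lemma up_enum_props:
  assumes p: "is_partition m \<mu>"
  shows "set (up_enum \<mu>) = up_set \<mu>"
    and "i < j \<Longrightarrow> j < length (up_enum \<mu>) \<Longrightarrow>
      superdiagonal (added_box (up_enum \<mu> ! j) \<mu>) < superdiagonal (added_box (up_enum \<mu> ! i) \<mu>)"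
    and "distinct (up_enum \<mu>)" "length (up_enum \<mu>) = card (set \<mu>) + 1"
proof -
  let ?f = "\<lambda>\<nu>. superdiagonal (added_box \<nu> \<mu>)"
  have inj: "inj_on ?f (up_set \<mu>)"
  proof (rule inj_onI)
    fix \<nu> \<kappa> assume a: "\<nu> \<in> up_set \<mu>" "\<kappa> \<in> up_set \<mu>" "?f \<nu> = ?f \<kappa>"
    have "added_box \<nu> \<mu> = added_box \<kappa> \<mu>"
      using addable_content_inj[OF young_diagram[OF p] bij_betwE[OF up_set_added[OF p], rule_format, OF a(1)]
          bij_betwE[OF up_set_added[OF p], rule_format, OF a(2)] a(3)] .
    thus "\<nu> = \<kappa>" using up_set_added[OF p] a by (auto simp: bij_betw_def inj_on_def)
  qed
  have e: "set (up_enum \<mu>) = up_set \<mu> \<and> sorted_wrt (\<lambda>x y. ?f x > ?f y) (up_enum \<mu>)"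
    unfolding up_enum_def by (rule theI'[OF ex1_sorted_list[OF finite_up_set inj]])
  show s: "set (up_enum \<mu>) = up_set \<mu>" using e by blast
  show lt: "?f (up_enum \<mu> ! j) < ?f (up_enum \<mu> ! i)" if "i < j" "j < length (up_enum \<mu>)" for i j
    using sorted_wrt_nth_less[of "\<lambda>x y. ?f x > ?f y" "up_enum \<mu>" i j] e that by simp
  show d: "distinct (up_enum \<mu>)"
    unfolding distinct_conv_nth by (metis lt less_irrefl linorder_neqE_nat)
  show "length (up_enum \<mu>) = card (set \<mu>) + 1" using distinct_card[OF d] s card_up_set[OF p] by simp
qed

text \<open>Positions are counted from 1 in the definition and from 0 in lists, hence the parity of
  i + 1.\<close>

lemma L_parity_eq:
  "L_parity \<delta> \<mu> = (!) (up_enum \<mu>) ` {i. i < length (up_enum \<mu>) \<and> (i + 1) mod 2 = \<delta>}"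
proof (intro Set.set_eqI iffI)
  fix \<nu> assume "\<nu> \<in> L_parity \<delta> \<mu>"
  then obtain p where "p \<in> {1..length (up_enum \<mu>)}" "p mod 2 = \<delta>" "\<nu> = up_enum \<mu> ! (p - 1)"
    unfolding L_parity_def by blast
  thus "\<nu> \<in> (!) (up_enum \<mu>) ` {i. i < length (up_enum \<mu>) \<and> (i + 1) mod 2 = \<delta>}"
    by (intro image_eqI[of _ _ "p - 1"]) auto
next
  fix \<nu> assume "\<nu> \<in> (!) (up_enum \<mu>) ` {i. i < length (up_enum \<mu>) \<and> (i + 1) mod 2 = \<delta>}"
  then obtain i where "\<nu> = up_enum \<mu> ! i" "i < length (up_enum \<mu>)" "(i + 1) mod 2 = \<delta>" by blast
  thus "\<nu> \<in> L_parity \<delta> \<mu>" unfolding L_parity_def by (intro CollectI exI[of _ "i + 1"]) auto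
qed

lemma L_parity_subset: "is_partition m \<mu> \<Longrightarrow> L_parity \<delta> \<mu> \<subseteq> up_set \<mu>"
  unfolding L_parity_eq using up_enum_props(1) nth_mem by fastforce

lemma L_parity_isoclinic:
  assumes p: "is_partition m \<mu>" and iso: "isoclinic \<mu>" and \<delta>: "\<delta> \<in> {0, 1}"
  shows "1 \<le> m" "L_parity \<delta> \<mu> \<noteq> {}"
    "\<exists>\<alpha>. \<forall>R\<in>Tab \<mu>. (up_rep.hval m \<mu> (L_parity \<delta> \<mu>) R)\<^sup>2 = \<alpha>"
proof -
  have m: "sum_list \<mu> = m" using p by (simp add: is_partition_def)
  obtain L t where L: "L \<noteq> {}" "L \<subset> up_set \<mu>"
    and t: "\<forall>k\<in>{1..Suc m}. t k \<in> carrier (sym_group (Suc m)) \<and> t k (Suc m) = k"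
    and eq: "equi_isoclinic (Suc m) (d_tab \<mu>) (d_sum L) (\<lambda>k. mat_image (rep_sum L (t k)) (W_sub L \<mu>))"
    using iso unfolding isoclinic_def m Let_def by (elim exE conjE)
  interpret U: up_rep m \<mu> L by unfold_locales (use p L in auto)
  have t1: "t k permutes {1..Suc m}" "t k (Suc m) = k" if "k \<in> {1..Suc m}" for k
    using t that by (auto simp: sym_group_carrier)
  define ls where "ls = up_enum \<mu>"
  define M where "M = length ls"
  note ep = up_enum_props[OF p, folded ls_def, folded M_def]
  have card2: "2 \<le> M"
  proof -
    have "card L < card (up_set \<mu>)" by (rule psubset_card_mono[OF finite_up_set L(2)])
    moreover have "0 < card L" using L(1) U.finL by (simp add: card_gt_0_iff)
    ultimately show ?thesis using card_up_set[OF p] ep(4) by simp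
  qed
  have "set \<mu> \<noteq> {}" using card2 ep(4) by auto
  hence "\<mu> \<noteq> []" by auto
  thus m1: "1 \<le> m" using p m by (cases \<mu>) (auto simp: is_partition_def)
  interpret F: up_rep m \<mu> "up_set \<mu>" by unfold_locales (use p L in auto)
  have p0: "0 \<in> {i. i < M \<and> (i + 1) mod 2 = 1}" "1 \<in> {i. i < M \<and> (i + 1) mod 2 = 0}" using card2 by auto
  show ne: "L_parity \<delta> \<mu> \<noteq> {}"
  proof -
    have "(if \<delta> = 1 then 0 else 1) \<in> {i. i < M \<and> (i + 1) mod 2 = \<delta>}" using p0 \<delta> by auto
    hence "ls ! (if \<delta> = 1 then 0 else 1) \<in> L_parity \<delta> \<mu>" unfolding L_parity_eq ls_def M_def by (rule imageI)
    thus ?thesis by (rule ex_in_conv[THEN iffD1, OF exI])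
  qed
  interpret P: up_rep m \<mu> "L_parity \<delta> \<mu>" by (intro up_rep.intro p L_parity_subset[OF p] ne)
  \<comment> \<open>Without the normalisation by \<open>d_sum\<close> the sums are additive in the
    set of shapes, which allows passing to complements. For fixed K the two differ by a constant
    factor, harmless for the constancy of the square.\<close>
  define H where "H K y = (\<Sum>\<nu>\<in>K. real (d_tab \<nu>) / (of_int (superdiagonal (added_box \<nu> \<mu>)) - y))" for K and y :: real
  have hv: "up_rep.hval m \<mu> K R = H K (of_int (content R m)) / real (d_sum K)" if "up_rep m \<mu> K" for K R
    unfolding up_rep.hval_def[OF that] up_rep.wt_def[OF that] up_rep.abox_def[OF that] H_def
    by (simp add: sum_divide_distrib mult.commute)
  have H0: "H (up_set \<mu>) (of_int (content R m)) = 0" if "R \<in> Tab \<mu>" for R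
    using F.hval_full[OF refl m1 that] hv[OF F.up_rep_axioms, of R] F.d_sum_pos by simp
  obtain \<alpha> where \<alpha>: "\<And>R. R \<in> Tab \<mu> \<Longrightarrow> (U.hval R)\<^sup>2 = \<alpha>"
    using U.isoclinic_hval[OF m1 t1 eq] by blast
  define \<beta> where "\<beta> = \<alpha> * (real (d_sum L))\<^sup>2"
  have HL: "(H L (of_int (content R m)))\<^sup>2 = \<beta>" if "R \<in> Tab \<mu>" for R
    using \<alpha>[OF that] hv[OF U.up_rep_axioms, of R] U.d_sum_pos by (auto simp: \<beta>_def power_divide field_simps)
  \<comment> \<open>Every removable box can carry the largest entry: any standard filling of the
    other boxes extends. So the conditions on all tableaux become conditions at all removable
    boxes.\<close>
  have rem: "\<exists>R\<in>Tab \<mu>. content R m = superdiagonal x" if x: "x \<in> removable (diagram \<mu>)" for x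
  proof -
    have yx: "young (diagram \<mu> - {x})" "x \<in> diagram \<mu>" using x by (auto simp: removable_def)
    have ins: "insert x (diagram \<mu> - {x}) = diagram \<mu>" using yx by auto
    have "card (diagram \<mu> - {x}) = m - 1" using yx card_diagram[of \<mu>] m by simp
    then obtain R where R: "R \<in> ST (m - 1) (diagram \<mu> - {x})" using ST_nonempty[OF yx(1)] by auto
    have yi: "young (insert x (diagram \<mu> - {x}))" using young_diagram[OF p] ins by simp
    have "R(x := Suc (m - 1)) \<in> Tab \<mu>"
      using extend_ST[OF R _ yi] m1 ins by (simp add: Tab_ST[OF p])
    moreover have "content (R(x := Suc (m - 1))) m = superdiagonal x"
      using box_of_extend(1)[OF R _ yi] m1 by (simp add: content_def)
    ultimately show ?thesis by blast
  qed
  define c where "c i = real_of_int (superdiagonal (added_box (ls ! i) \<mu>))" for i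
  define w where "w i = real (d_tab (ls ! i))" for i
  have lsin: "ls ! i \<in> up_set \<mu>" if "i < M" for i using that ep(1) nth_mem[of i ls] by (simp add: M_def)
  have inj: "inj_on ((!) ls) {..<M}" using ep(3) by (auto simp: inj_on_def nth_eq_iff_index_eq M_def)
  have Hidx: "H ((!) ls ` J) y = (\<Sum>i\<in>J. w i / (c i - y))" if "J \<subseteq> {..<M}" for J y
    unfolding H_def w_def c_def by (subst sum.reindex[OF inj_on_subset[OF inj that]]) simp
  \<comment> \<open>Each gap between consecutive addable contents receives a tableau with m in a
    removable box inside the gap; the content of that box is the evaluation point x i.\<close>
  have "\<forall>i. \<exists>R. i < M - 1 \<longrightarrow> R \<in> Tab \<mu> \<and> c (i + 1) < of_int (content R m) \<and> of_int (content R m) < c i"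
  proof
    fix i
    show "\<exists>R. i < M - 1 \<longrightarrow> R \<in> Tab \<mu> \<and> c (i + 1) < of_int (content R m) \<and> of_int (content R m) < c i"
    proof (cases "i < M - 1")
      case True
      hence i: "i < M" "i + 1 < M" by auto
      have ad: "added_box (ls ! j) \<mu> \<in> addable (diagram \<mu>)" if "j < M" for j
        using bij_betwE[OF up_set_added[OF p]] lsin[OF that] by blast
      obtain x where "x \<in> removable (diagram \<mu>)" "superdiagonal (added_box (ls ! (i + 1)) \<mu>) < superdiagonal x"
        "superdiagonal x < superdiagonal (added_box (ls ! i) \<mu>)"
        using addable_interlaced[OF p ad[OF i(1)] ad[OF i(2)] ep(2)[OF less_add_one i(2)]] by blast
      thus ?thesis using rem[of x] by (auto simp: c_def)
    qed simp
  qed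
  then obtain R where R: "\<And>i. i < M - 1 \<Longrightarrow> R i \<in> Tab \<mu> \<and> c (i + 1) < of_int (content (R i) m) \<and> of_int (content (R i) m) < c i"
    by metis
  define I where "I = {i. i < M \<and> ls ! i \<in> L}"
  have IM: "I \<subseteq> {..<M}" by (auto simp: I_def)
  have imI: "(!) ls ` I = L"
  proof
    show "L \<subseteq> (!) ls ` I"
    proof
      fix \<nu> assume \<nu>: "\<nu> \<in> L"
      hence "\<nu> \<in> set ls" using L(2) ep(1) by auto
      then obtain i where "i < M" "ls ! i = \<nu>" by (auto simp: in_set_conv_nth M_def)
      thus "\<nu> \<in> (!) ls ` I" using \<nu> by (auto simp: I_def)
    qed
  qed (auto simp: I_def)
  have imF: "(!) ls ` {..<M} = up_set \<mu>"
    unfolding ep(1)[symmetric] M_def set_conv_nth by auto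
  have I2: "I \<noteq> {}" "I \<noteq> {..<M}" using imI imF L by auto
  have alt: "i \<in> I \<longleftrightarrow> i + 1 \<notin> I" if "i < M - 1" for i
  proof (rule alternating_poles[OF card2 _ _ _ _ IM I2 _ that, of c w "\<lambda>i. of_int (content (R i) m)" \<beta>])
    show "c j < c i" if "i < j" "j < M" for i j using ep(2)[OF that] by (simp add: c_def)
    show "0 < w i" if "i < M" for i using d_tab_pos[OF up_setD(1)[OF p lsin[OF that]]] by (simp add: w_def)
    show "c (i + 1) < of_int (content (R i) m) \<and> of_int (content (R i) m) < c i" if "i < M - 1" for i
      using R[OF that] by blast
    show "(\<Sum>j<M. w j / (c j - of_int (content (R i) m))) = 0" if "i < M - 1" for i
      using Hidx[of "{..<M}"] H0[of "R i"] R[OF that] imF by simp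
    show "(\<Sum>j\<in>I. w j / (c j - of_int (content (R i) m)))\<^sup>2 = \<beta>" if "i < M - 1" for i
      using Hidx[OF IM] HL[of "R i"] R[OF that] imI by simp
  qed
  have par: "i \<in> I \<longleftrightarrow> (even i \<longleftrightarrow> 0 \<in> I)" if "i < M" for i
    using that
  proof (induction i)
    case (Suc i)
    thus ?case using alt[of i] by auto
  qed simp
  define D where "D = {i. i < M \<and> (i + 1) mod 2 = \<delta>}"
  have LD: "L_parity \<delta> \<mu> = (!) ls ` D" unfolding L_parity_eq D_def ls_def M_def ..
  have Dpar: "i \<in> D \<longleftrightarrow> (even i \<longleftrightarrow> \<delta> = 1)" if "i < M" for i
    using that \<delta> by (auto simp: D_def) presburger+
  have "D = I \<or> D = {..<M} - I"
  proof (cases "(0 \<in> I) \<longleftrightarrow> (\<delta> = 1)")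
    case True
    have "i \<in> D \<longleftrightarrow> i \<in> I" if "i < M" for i using par[OF that] Dpar[OF that] True by blast
    hence "D = I" using IM by (auto simp: D_def)
    thus ?thesis ..
  next
    case False
    have "i \<in> D \<longleftrightarrow> i \<notin> I" if "i < M" for i using par[OF that] Dpar[OF that] False by blast
    hence "D = {..<M} - I" by (auto simp: D_def)
    thus ?thesis ..
  qed
  hence "H (L_parity \<delta> \<mu>) y = H L y \<or> H (L_parity \<delta> \<mu>) y = H (up_set \<mu>) y - H L y" for y
  proof
    assume "D = {..<M} - I"
    hence "H (L_parity \<delta> \<mu>) y = (\<Sum>i\<in>{..<M} - I. w i / (c i - y))" using Hidx[of D] LD by auto
    also have "\<dots> = H (up_set \<mu>) y - H L y"
      using Hidx[of "{..<M}"] Hidx[OF IM] imF imI IM by (simp add: sum_diff)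
    finally show ?thesis ..
  qed (use LD imI in simp)
  hence "(H (L_parity \<delta> \<mu>) (of_int (content R m)))\<^sup>2 = \<beta>" if "R \<in> Tab \<mu>" for R
    using HL[OF that] H0[OF that] by (metis diff_0 power2_minus)
  hence "(P.hval R)\<^sup>2 = \<beta> / (real (d_sum (L_parity \<delta> \<mu>)))\<^sup>2" if "R \<in> Tab \<mu>" for R
    using hv[OF P.up_rep_axioms, of R] that by (simp add: power_divide)
  thus "\<exists>\<alpha>. \<forall>R\<in>Tab \<mu>. (P.hval R)\<^sup>2 = \<alpha>" by blast
qed

section \<open>Transposition of tableaux\<close>

definition tr :: "tableau \<Rightarrow> tableau" where "tr T = T \<circ> prod.swap"

lemma tr_tr [simp]: "tr (tr T) = T"
  by (simp add: tr_def fun_eq_iff)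

lemma tr_eq_iff: "tr S = T \<longleftrightarrow> S = tr T"
  by (metis tr_tr)

lemma tr_apply: "tr T b = T (prod.swap b)"
  by (simp add: tr_def)

lemma adj_transp_tr: "adj_transp k \<circ> tr T = tr (adj_transp k \<circ> T)"
  by (simp add: tr_def comp_assoc)

lemma swap_swap_image [simp]: "prod.swap ` prod.swap ` Y = Y"
  by (simp add: image_image)

lemma mem_swap_image': "b \<in> prod.swap ` Y \<longleftrightarrow> prod.swap b \<in> Y"
  by (cases b) (simp add: mem_swap_image)

lemma shape_tr: "shape (tr T) = prod.swap ` shape T"
  by (intro Set.set_eqI) (simp add: mem_swap_image' shape_def tr_apply)

lemma tr_SYT: "T \<in> SYT n \<Longrightarrow> tr T \<in> SYT n"
proof -
  assume T: "T \<in> SYT n"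
  have "bij_betw prod.swap (prod.swap ` shape T) (shape T)"
    by (rule bij_betwI[where g = prod.swap]) auto
  hence "bij_betw (tr T) (prod.swap ` shape T) {1..n}"
    unfolding tr_def by (rule bij_betw_trans) (rule SYT_bij[OF T])
  moreover have "tr T b < tr T c"
    if "b \<in> prod.swap ` shape T" "c \<in> prod.swap ` shape T" "fst b \<le> fst c" "snd b \<le> snd c" "b \<noteq> c" for b c
    unfolding tr_apply using that by (intro SYT_mono[OF T]) (auto simp: mem_swap_image' prod_eq_iff)
  ultimately show ?thesis using young_swap[OF SYT_young[OF T]] by (simp add: SYT_def shape_tr)
qed

lemma tr_ST: "T \<in> ST n Y \<Longrightarrow> tr T \<in> ST n (prod.swap ` Y)"
  by (simp add: ST_def tr_SYT shape_tr)

lemma box_of_tr: "T \<in> SYT n \<Longrightarrow> 1 \<le> a \<Longrightarrow> a \<le> n \<Longrightarrow> box_of (tr T) a = prod.swap (box_of T a)"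
proof -
  assume T: "T \<in> SYT n" "1 \<le> a" "a \<le> n"
  have "prod.swap (box_of T a) \<in> shape (tr T)" using box_of_works(2)[OF T] by (simp add: shape_tr)
  from box_of_T[OF tr_SYT[OF T(1)] this] show ?thesis using box_of_works(1)[OF T] by (simp add: tr_apply)
qed

lemma content_tr: "T \<in> SYT n \<Longrightarrow> 1 \<le> a \<Longrightarrow> a \<le> n \<Longrightarrow> content (tr T) a = - content T a"
  by (simp add: content_def box_of_tr superdiagonal_def)

text \<open>Contents are negated, so the diagonal coefficient changes sign while the weight, even in
  the axial distance, does not. A sign that alternates under swaps turns this into an overall
  minus.\<close>

lemma fop_tr:
  assumes "T \<in> SYT n" "1 \<le> k" "k < n"
  shows "fop k f (tr T) = - f (tr T) / of_int (content T (Suc k) - content T k) +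
    ywt (content T (Suc k) - content T k) * f (tr (adj_transp k \<circ> T))"
proof -
  have "content (tr T) (Suc k) - content (tr T) k = - (content T (Suc k) - content T k)"
    using content_tr[OF assms(1), of k] content_tr[OF assms(1), of "Suc k"] assms by simp
  thus ?thesis unfolding fop_def adj_transp_tr by (simp del: of_int_diff minus_diff_eq)
qed

lemma num_ST_swap: "num_ST (prod.swap ` Y) = num_ST Y"
proof -
  have c: "card (prod.swap ` Y) = card Y" by (simp add: card_image)
  have "bij_betw tr (ST (card Y) Y) (ST (card Y) (prod.swap ` Y))"
    by (rule bij_betwI[where g = tr]) (auto dest: tr_ST)
  thus ?thesis unfolding num_ST_def c using bij_betw_same_card by metis
qed

text \<open>Besides the box of 1 nothing may precede 2 in its row and column, so 2 stands directly
  to the right of or directly below 1. This distinguishes a tableau from its transpose and selects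
  one of the two.\<close>

lemma second_entry:
  assumes T: "T \<in> SYT n" and n: "2 \<le> n"
  shows "T (1, 2) = 2 \<longleftrightarrow> T (2, 1) \<noteq> 2"
proof -
  obtain i j where x: "box_of T 2 = (i, j)" by force
  have X: "(i, j) \<in> shape T" "T (i, j) = 2" using box_of_works[OF T, of 2] n x by auto
  note yg = SYT_young[OF T]
  have ij: "1 \<le> i" "1 \<le> j" using young_pos[OF yg X(1)] by auto
  have one: "b = (1, 1)" if "b \<in> shape T" "T b < 2" for b
  proof -
    have "T b = 1" using SYT_range[OF T that(1)] that(2) by simp
    thus ?thesis using box_of_T[OF T that(1)] box_of_one[OF T] n by simp
  qed
  have alt: "(i, j) = (1, 2) \<or> (i, j) = (2, 1)"
  proof (cases "1 < i")
    case True
    hence "1 \<le> i - 1" "i - 1 < i" by auto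
    hence Z: "(i - 1, j) \<in> shape T" using young_down[OF yg X(1), of "i - 1" j] ij by simp
    have "T (i - 1, j) < T (i, j)" using SYT_mono'[OF T Z X(1)] \<open>i - 1 < i\<close> by simp
    thus ?thesis using one[OF Z] X(2) True by auto
  next
    case False
    hence i: "i = 1" using ij by simp
    have "j \<noteq> 1" using box_of_works(1)[OF T, of 1] box_of_one[OF T] n X(2) i by auto
    hence "1 \<le> j - 1" "j - 1 < j" using ij by auto
    hence Z: "(i, j - 1) \<in> shape T" using young_down[OF yg X(1), of i "j - 1"] ij by simp
    have "T (i, j - 1) < T (i, j)" using SYT_mono'[OF T Z X(1)] \<open>j - 1 < j\<close> by simp
    thus ?thesis using one[OF Z] X(2) i \<open>1 \<le> j - 1\<close> by auto
  qed
  have u: "b = (i, j)" if "T b = 2" for b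
    using SYT_inj[OF T X(1), of b] X(2) that by simp
  from alt show ?thesis
  proof
    assume "(i, j) = (1, 2)"
    thus ?thesis using X(2) u[of "(2, 1)"] by auto
  next
    assume "(i, j) = (2, 1)"
    thus ?thesis using X(2) u[of "(1, 2)"] by auto
  qed
qed

section \<open>The sign of a tableau\<close>

definition rowless :: "nat \<times> nat \<Rightarrow> nat \<times> nat \<Rightarrow> bool" where
  "rowless b c \<longleftrightarrow> fst b < fst c \<or> fst b = fst c \<and> snd b < snd c"

text \<open>Inversion sign with respect to the order of boxes in which those of \<open>Y\<close> come first, row by row.
  Boxes outside \<open>Y\<close> are last: adding the largest entry to a tableau of shape \<open>Y\<close> creates no inversion.\<close>

definition pairs :: "(nat \<times> nat) set \<Rightarrow> (nat \<times> nat) set \<Rightarrow> ((nat \<times> nat) \<times> nat \<times> nat) set" where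
  "pairs Y Z = {(b, c). b \<in> Y \<and> c \<in> Z \<and> (c \<notin> Y \<or> rowless b c)}"

definition inv_sgn :: "tableau \<Rightarrow> (nat \<times> nat) \<times> nat \<times> nat \<Rightarrow> real" where
  "inv_sgn T p = (if T (fst p) < T (snd p) then 1 else - 1)"

definition sig :: "(nat \<times> nat) set \<Rightarrow> tableau \<Rightarrow> real" where
  "sig Y T = (\<Prod>p\<in>pairs Y (shape T). inv_sgn T p)"

lemma finite_pairs: "finite Y \<Longrightarrow> finite Z \<Longrightarrow> finite (pairs Y Z)"
  by (rule finite_subset[of _ "Y \<times> Z"]) (auto simp: pairs_def)

lemma rowless_total: "b \<noteq> c \<Longrightarrow> rowless b c \<longleftrightarrow> \<not> rowless c b"
  by (auto simp: rowless_def prod_eq_iff)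

lemma sig_square: "sig Y T * sig Y T = 1"
proof -
  have "sig Y T * sig Y T = (\<Prod>p\<in>pairs Y (shape T). inv_sgn T p * inv_sgn T p)"
    by (simp add: sig_def prod.distrib)
  also have "\<dots> = 1" by (rule prod.neutral) (simp add: inv_sgn_def)
  finally show ?thesis .
qed

text \<open>As at most one box lies outside \<open>Y\<close>, the set \<open>pairs\<close> contains
  every two distinct boxes in exactly one order. Exchanging k and k + 1 changes the comparison only
  for the pair of their boxes.\<close>

lemma sig_swap:
  assumes T: "T \<in> SYT n" and Y: "Y \<subseteq> shape T" "shape T - Y \<subseteq> {b0}" and k: "1 \<le> k" "k < n"
  shows "sig Y (adj_transp k \<circ> T) = - sig Y T"
proof -
  define P where "P = pairs Y (shape T)"
  have finT: "finite (shape T)" by (rule young_finite[OF SYT_young[OF T]])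
  have fin: "finite P" unfolding P_def using finite_pairs finT finite_subset[OF Y(1)] by blast
  define x y where "x = box_of T k" and "y = box_of T (Suc k)"
  have x: "x \<in> shape T" "T x = k" and y: "y \<in> shape T" "T y = Suc k"
    using box_of_works[OF T, of k] box_of_works[OF T, of "Suc k"] k by (auto simp: x_def y_def)
  have xy: "x \<noteq> y" using x y by auto
  have tour: "(b, c) \<in> P \<longleftrightarrow> (c, b) \<notin> P" if "b \<in> shape T" "c \<in> shape T" "b \<noteq> c" for b c
    using that Y rowless_total[OF that(3)] by (auto simp: P_def pairs_def)
  define p0 where "p0 = (if (x, y) \<in> P then (x, y) else (y, x))"
  have p0: "p0 \<in> P" using tour[OF x(1) y(1) xy] by (auto simp: p0_def)
  have rest: "inv_sgn (adj_transp k \<circ> T) p = inv_sgn T p" if p: "p \<in> P - {p0}" for p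
  proof -
    obtain b c where bc: "p = (b, c)" by (cases p)
    have m: "b \<in> shape T" "c \<in> shape T" using p Y(1) by (auto simp: bc P_def pairs_def)
    have ne: "b \<noteq> c" using p by (auto simp: bc P_def pairs_def rowless_def)
    have "\<not> (T b = k \<and> T c = Suc k)"
    proof
      assume "T b = k \<and> T c = Suc k"
      hence "p = (x, y)" using SYT_inj[OF T m(1), of x] SYT_inj[OF T m(2), of y] x(2) y(2) by (simp add: bc)
      thus False using p by (auto simp: p0_def)
    qed
    moreover have "\<not> (T b = Suc k \<and> T c = k)"
    proof
      assume "T b = Suc k \<and> T c = k"
      hence e: "p = (y, x)" using SYT_inj[OF T m(1), of y] SYT_inj[OF T m(2), of x] x(2) y(2) by (simp add: bc)
      hence "(x, y) \<notin> P" using p tour[OF x(1) y(1) xy] by simp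
      thus False using p e by (auto simp: p0_def)
    qed
    moreover have "T b \<noteq> T c" using SYT_inj[OF T m(1), of c] ne by metis
    ultimately have "adj_transp k (T b) < adj_transp k (T c) \<longleftrightarrow> T b < T c" by (auto simp: adj_transp_if)
    thus ?thesis by (simp add: inv_sgn_def bc)
  qed
  have flip: "inv_sgn (adj_transp k \<circ> T) p0 = - inv_sgn T p0"
    using x y by (auto simp: inv_sgn_def p0_def)
  have sh: "shape (adj_transp k \<circ> T) = shape T" by (rule shape_adj_transp[OF k(1)])
  have "sig Y (adj_transp k \<circ> T) = inv_sgn (adj_transp k \<circ> T) p0 * (\<Prod>p\<in>P - {p0}. inv_sgn (adj_transp k \<circ> T) p)"
    unfolding sig_def sh P_def[symmetric] by (rule prod.remove[OF fin p0])
  also have "(\<Prod>p\<in>P - {p0}. inv_sgn (adj_transp k \<circ> T) p) = (\<Prod>p\<in>P - {p0}. inv_sgn T p)"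
    by (rule prod.cong[OF refl rest])
  also have "inv_sgn (adj_transp k \<circ> T) p0 * \<dots> = - (inv_sgn T p0 * (\<Prod>p\<in>P - {p0}. inv_sgn T p))"
    by (simp add: flip)
  also have "\<dots> = - sig Y T" unfolding sig_def P_def[symmetric] by (subst prod.remove[OF fin p0]) simp
  finally show ?thesis .
qed

lemma sig_extend:
  assumes R: "R \<in> ST m Y" and b: "b \<notin> Y" and yg: "young (insert b Y)"
  shows "sig Y (R(b := Suc m)) = sig Y R"
proof -
  have R': "R \<in> SYT m" "shape R = Y" using R by (auto simp: ST_def)
  have finY: "finite Y" using young_finite[OF SYT_young[OF R'(1)]] R'(2) by simp
  have sh: "shape (R(b := Suc m)) = insert b Y" using extend_ST[OF R b yg] by (simp add: ST_def)
  have split: "pairs Y (insert b Y) = pairs Y Y \<union> Y \<times> {b}" using b by (auto simp: pairs_def)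
  have disj: "pairs Y Y \<inter> Y \<times> {b} = {}" using b by (auto simp: pairs_def)
  have "sig Y (R(b := Suc m)) = (\<Prod>p\<in>pairs Y Y. inv_sgn (R(b := Suc m)) p) * (\<Prod>p\<in>Y \<times> {b}. inv_sgn (R(b := Suc m)) p)"
    unfolding sig_def sh split using finite_pairs[OF finY finY] finY disj by (intro prod.union_disjoint) auto
  also have "(\<Prod>p\<in>Y \<times> {b}. inv_sgn (R(b := Suc m)) p) = 1"
    using b SYT_range[OF R'(1)] R'(2) by (intro prod.neutral) (fastforce simp: inv_sgn_def)
  also have "(\<Prod>p\<in>pairs Y Y. inv_sgn (R(b := Suc m)) p) = (\<Prod>p\<in>pairs Y Y. inv_sgn R p)"
    using b by (intro prod.cong refl) (auto simp: inv_sgn_def pairs_def)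
  finally show ?thesis unfolding sig_def[of Y R] R'(2) by (simp only: mult_1_right)
qed

lemma even_card_involution:
  assumes "finite A" "\<And>x. x \<in> A \<Longrightarrow> f x \<in> A" "\<And>x. x \<in> A \<Longrightarrow> f (f x) = x" "\<And>x. x \<in> A \<Longrightarrow> f x \<noteq> x"
  shows "even (card A)"
  using assms
proof (induction "card A" arbitrary: A rule: less_induct)
  case less
  show ?case
  proof (cases "A = {}")
    case False
    then obtain x where x: "x \<in> A" by blast
    define B where "B = A - {x, f x}"
    have fx: "f x \<in> A" "f x \<noteq> x" using less.prems x by auto
    have cB: "card A = card B + 2"
    proof -
      have "card A = card (B \<union> {x, f x})" by (rule arg_cong[of _ _ card]) (use x fx in \<open>auto simp: B_def\<close>)
      also have "\<dots> = card B + card {x, f x}" using less.prems(1) by (intro card_Un_disjoint) (auto simp: B_def)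
      finally show ?thesis using fx by simp
    qed
    have "f y \<in> B" if "y \<in> B" for y
    proof -
      have y: "y \<in> A" "y \<noteq> x" "y \<noteq> f x" using that by (auto simp: B_def)
      have "f y \<noteq> x" using less.prems(3)[OF y(1)] y(3) by auto
      moreover have "f y \<noteq> f x" using less.prems(3)[OF y(1)] less.prems(3)[OF x] y(2) by metis
      ultimately show ?thesis using less.prems(2)[OF y(1)] by (simp add: B_def)
    qed
    hence "even (card B)" using less.prems cB by (intro less.hyps) (auto simp: B_def)
    thus ?thesis using cB by simp
  qed simp
qed

text \<open>Transposing a tableau reverses exactly the pairs of boxes that lie strictly north-east/south-west
  of each other; modulo the symmetry of \<open>Y\<close> only the pairs of mirror boxes survive.\<close>

lemma sig_tr:
  assumes Y: "finite Y" "prod.swap ` Y = Y" and T: "T \<in> SYT n" "Y \<subseteq> shape T"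
  shows "sig Y T * sig Y (tr T) = (- 1) ^ card {b \<in> Y. fst b < snd b}"
proof -
  define Z where "Z = shape T"
  have finZ: "finite Z" unfolding Z_def by (rule young_finite[OF SYT_young[OF T(1)]])
  define P where "P = pairs Y Z"
  define sw where "sw p = (prod.swap (fst p), prod.swap (snd p))" for p :: "(nat \<times> nat) \<times> nat \<times> nat"
  \<comment> \<open>The pairs counted for the transposed tableau, reflected back to boxes of
    \<open>T\<close>; on \<open>Y\<close> they follow the order by columns instead of rows.\<close>
  define P' where "P' = sw ` pairs Y (prod.swap ` Z)"
  have finP: "finite P" "finite P'" unfolding P_def P'_def using finite_pairs Y(1) finZ by auto
  have swY: "prod.swap b \<in> Y \<longleftrightarrow> b \<in> Y" for b using mem_swap_image'[of b Y] Y(2) by simp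
  have P'_mem: "(b, c) \<in> P' \<longleftrightarrow> b \<in> Y \<and> c \<in> Z \<and> (c \<notin> Y \<or> rowless (prod.swap b) (prod.swap c))" for b c
  proof -
    have "(b, c) \<in> P' \<longleftrightarrow> (prod.swap b, prod.swap c) \<in> pairs Y (prod.swap ` Z)"
      unfolding P'_def sw_def by (force intro: image_eqI[of _ _ "(prod.swap b, prod.swap c)"])
    thus ?thesis by (simp add: pairs_def swY mem_swap_image')
  qed
  have "inj sw" by (auto simp: inj_def sw_def)
  hence "sig Y (tr T) = (\<Prod>p\<in>P'. inv_sgn T p)"
    unfolding sig_def shape_tr Z_def[symmetric] P'_def
    by (subst prod.reindex) (auto simp: inv_sgn_def tr_apply sw_def intro: inj_on_subset)
  hence "sig Y T * sig Y (tr T) = (\<Prod>p\<in>P. inv_sgn T p) * (\<Prod>p\<in>P'. inv_sgn T p)"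
    by (simp add: sig_def P_def Z_def)
  also have "(\<Prod>p\<in>P. inv_sgn T p) = (\<Prod>p\<in>P - P'. inv_sgn T p) * (\<Prod>p\<in>P \<inter> P'. inv_sgn T p)"
    using prod.Int_Diff[OF finP(1), of "inv_sgn T" P'] by (simp add: mult.commute)
  also have "(\<Prod>p\<in>P'. inv_sgn T p) = (\<Prod>p\<in>P' - P. inv_sgn T p) * (\<Prod>p\<in>P \<inter> P'. inv_sgn T p)"
    using prod.Int_Diff[OF finP(2), of "inv_sgn T" P] by (simp add: mult.commute Int_commute)
  also have "(\<Prod>p\<in>P - P'. inv_sgn T p) * (\<Prod>p\<in>P \<inter> P'. inv_sgn T p) *
      ((\<Prod>p\<in>P' - P. inv_sgn T p) * (\<Prod>p\<in>P \<inter> P'. inv_sgn T p)) =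
      (\<Prod>p\<in>P - P'. inv_sgn T p) * (\<Prod>p\<in>P' - P. inv_sgn T p) * (\<Prod>p\<in>P \<inter> P'. inv_sgn T p * inv_sgn T p)"
    by (simp add: prod.distrib ac_simps)
  also have "(\<Prod>p\<in>P \<inter> P'. inv_sgn T p * inv_sgn T p) = 1" by (rule prod.neutral) (simp add: inv_sgn_def)
  finally have e1: "sig Y T * sig Y (tr T) = (\<Prod>p\<in>P - P'. inv_sgn T p) * (\<Prod>p\<in>P' - P. inv_sgn T p)" by simp
  \<comment> \<open>A box outside \<open>Y\<close> comes last in both orders, so the two sets of
    pairs can differ only inside \<open>Y\<close>.\<close>
  define D where "D = {(b, c). b \<in> Y \<and> c \<in> Y \<and> fst b < fst c \<and> snd c < snd b}"
  have finD: "finite D" by (rule finite_subset[of _ "Y \<times> Y"]) (use Y(1) in \<open>auto simp: D_def\<close>)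
  have PD: "P - P' = D"
    using T(2) by (auto simp: P_def pairs_def P'_mem D_def rowless_def Z_def)
  have PD': "P' - P = prod.swap ` D"
  proof -
    have "(b, c) \<in> P' - P \<longleftrightarrow> (c, b) \<in> D" for b c
      using T(2) by (auto simp: P_def pairs_def P'_mem D_def rowless_def Z_def)
    thus ?thesis by (auto simp: mem_swap_image' split_paired_all) (force intro: image_eqI[of _ _ "(_, _)"])+
  qed
  have "(\<Prod>p\<in>prod.swap ` D. inv_sgn T p) = (\<Prod>p\<in>D. inv_sgn T (prod.swap p))"
    by (subst prod.reindex) auto
  hence "sig Y T * sig Y (tr T) = (\<Prod>p\<in>D. inv_sgn T p * inv_sgn T (prod.swap p))"
    unfolding e1 PD PD' by (simp add: prod.distrib)
  also have "\<dots> = (\<Prod>p\<in>D. - 1)"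
  proof (rule prod.cong[OF refl])
    fix p assume "p \<in> D"
    then obtain b c where bc: "p = (b, c)" "b \<in> Y" "c \<in> Y" "b \<noteq> c" by (auto simp: D_def)
    have "T b \<noteq> T c" using SYT_inj[OF T(1), of b c] bc T(2) by auto
    thus "inv_sgn T p * inv_sgn T (prod.swap p) = - 1" by (auto simp: inv_sgn_def bc)
  qed
  also have "\<dots> = (- 1) ^ card D" by simp
  also have "\<dots> = (- 1) ^ card {b \<in> Y. fst b < snd b}"
  proof -
    \<comment> \<open>Reflecting both boxes and exchanging them is an involution on
      \<open>D\<close>. Its fixed points are the pairs of b and its mirror image with b above the
      diagonal, and the other pairs cancel modulo 2.\<close>
    define \<phi> where "\<phi> p = (prod.swap (snd p), prod.swap (fst p))" for p :: "(nat \<times> nat) \<times> nat \<times> nat"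
    define D1 where "D1 = {p \<in> D. \<phi> p \<noteq> p}"
    have "even (card D1)"
      by (rule even_card_involution[where f = \<phi>]) (use finD swY in \<open>auto simp: D1_def D_def \<phi>_def\<close>)
    moreover have "card D = card D1 + card (D - D1)"
      using card_Un_disjoint[of D1 "D - D1"] finD by (simp add: D1_def Un_absorb1 Collect_mono)
    moreover have "D - D1 = (\<lambda>b. (b, prod.swap b)) ` {b \<in> Y. fst b < snd b}"
      using swY by (auto simp: D1_def D_def \<phi>_def)
    hence "card (D - D1) = card {b \<in> Y. fst b < snd b}" by (simp add: card_image inj_on_def)
    ultimately show ?thesis by (simp add: power_add)
  qed
  finally show ?thesis .
qed

section \<open>Splitting over the alternating group\<close>

text \<open>Instantiated for \<open>Tabs L\<close> and for \<open>Tab \<mu>\<close> with the same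
  \<open>Y = diagram \<mu>\<close>. Shapes may exceed \<open>Y\<close> by at most one box, so that
  the same sign works on both sides of \<open>\<Psi>\<close>.\<close>

locale sym_tabs =
  fixes n :: nat and TT :: "tableau set" and Y :: "(nat \<times> nat) set"
  assumes n2: "2 \<le> n" and fin: "finite TT" and syt: "\<And>T. T \<in> TT \<Longrightarrow> T \<in> SYT n"
    and cls: "\<And>T. T \<in> TT \<Longrightarrow> ST n (shape T) \<subseteq> TT" and trc: "\<And>T. T \<in> TT \<Longrightarrow> tr T \<in> TT"
    and finY: "finite Y" and symY: "prod.swap ` Y = Y" and sub: "\<And>T. T \<in> TT \<Longrightarrow> Y \<subseteq> shape T"
    and one: "\<And>T. T \<in> TT \<Longrightarrow> \<exists>b0. shape T - Y \<subseteq> {b0}"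
begin

definition eps :: real where "eps = (- 1) ^ card {b \<in> Y. fst b < snd b}"

text \<open>Representatives of the orbits of \<open>tr\<close>, which has no fixed points here; they
  index an orthonormal basis of the eigenspace.\<close>

definition X :: "tableau set" where "X = {T \<in> TT. T (1, 2) = 2}"

lemma X_sub: "X \<subseteq> TT"
  by (auto simp: X_def)

lemma finX: "finite X"
  by (rule finite_subset[OF X_sub fin])

lemma tr_X: "T \<in> TT \<Longrightarrow> tr T \<in> X \<longleftrightarrow> T \<notin> X"
  using second_entry[OF syt n2, of T] trc[of T] by (auto simp: X_def tr_apply)

lemma tr_neq: "T \<in> TT \<Longrightarrow> tr T \<noteq> T"
  using tr_X by metis

lemma card_TT: "card TT = 2 * card X"
proof -
  have "TT = X \<union> tr ` X"
  proof
    show "TT \<subseteq> X \<union> tr ` X"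
    proof
      fix T assume T: "T \<in> TT"
      show "T \<in> X \<union> tr ` X"
      proof (cases "T \<in> X")
        case False
        hence "tr T \<in> X" using tr_X T by blast
        hence "tr (tr T) \<in> tr ` X" by (rule imageI)
        thus ?thesis by simp
      qed simp
    qed
  qed (use X_sub trc in auto)
  moreover have "X \<inter> tr ` X = {}" using tr_X X_sub by auto
  moreover have "card (tr ` X) = card X" by (rule card_image) (metis inj_onI tr_tr)
  ultimately show ?thesis using card_Un_disjoint[OF finX finite_imageI[OF finX], of tr] by simp
qed

lemma eps_square: "eps * eps = 1"
  by (simp add: eps_def flip: power_mult_distrib)

lemma sig_tr_eps: "T \<in> TT \<Longrightarrow> sig Y (tr T) = eps * sig Y T"
proof -
  assume T: "T \<in> TT"
  have "sig Y T * sig Y (tr T) = eps" unfolding eps_def by (rule sig_tr[OF finY symY syt[OF T] sub[OF T]])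
  hence "eps * sig Y T = (sig Y T * sig Y T) * sig Y (tr T)" by (simp add: ac_simps)
  thus ?thesis by (simp add: sig_square)
qed

lemma swap_TT: "S \<in> TT \<Longrightarrow> 1 \<le> k \<Longrightarrow> adj_transp k \<circ> S \<in> SYT n \<Longrightarrow> adj_transp k \<circ> S \<in> TT"
  using cls[of S] by (auto simp: ST_def shape_adj_transp)

text \<open>The signed transposition \<open>v\<^sub>T \<mapsto> \<plusminus> v\<^bsub>T'\<^esub>\<close> intertwines the representation with its sign twist.\<close>

lemma yker_tr:
  assumes "\<sigma> permutes {1..n}" "T \<in> TT"
  shows "S \<in> TT \<Longrightarrow> yker n \<sigma> S (tr T) * sig Y (tr T) =
    (if evenperm \<sigma> then 1 else - 1) * (sig Y S * yker n \<sigma> (tr S) T)"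
  using assms(1)
proof (induction arbitrary: S rule: sym_group_generated)
  case id
  have "yker n id S (tr T) * sig Y (tr T) = (if evenperm id then 1 else - 1) * (sig Y S * yker n id (tr S) T)"
    by (auto simp: yker_id tr_eq_iff evenperm_id)
  thus ?case .
next
  case (step k \<sigma>)
  note S = \<open>S \<in> TT\<close>
  define sg :: real where "sg = (if evenperm \<sigma> then 1 else - 1)"
  define a where "a = yrep n \<sigma> (delta (tr T))"
  define b where "b = yrep n \<sigma> (delta T)"
  have IH: "a U * sig Y (tr T) = sg * (sig Y U * b (tr U))" if "U \<in> TT" for U
    using step(4)[OF that] by (simp add: a_def b_def sg_def yker_def)
  have "permutation \<sigma>" using step(3) permutation_permutes by blast
  hence sg': "(if evenperm (adj_transp k \<circ> \<sigma>) then 1 else - 1) = - sg"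
    using evenperm_adj_transp_comp[of \<sigma> k] by (simp add: sg_def)
  define d where "d = content S (Suc k) - content S k"
  obtain b0 where b0: "shape S - Y \<subseteq> {b0}" using one[OF S] by blast
  \<comment> \<open>The swapped term acquires its minus from \<open>sig\<close>, the diagonal term
    from the negated content; together they account for the changed parity of the
    permutation.\<close>
  have sw: "ywt d * (a (adj_transp k \<circ> S) * sig Y (tr T)) = - (ywt d * (sg * (sig Y S * b (tr (adj_transp k \<circ> S)))))"
  proof (cases "ywt d = 0")
    case False
    hence "adj_transp k \<circ> S \<in> TT"
      using SYT_swap_or_zero[OF syt[OF S] step(1,2)] swap_TT[OF S step(1)] by (auto simp: d_def)
    thus ?thesis using IH[of "adj_transp k \<circ> S"] sig_swap[OF syt[OF S] sub[OF S] b0 step(1,2)] by simp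
  qed simp
  have "yker n (adj_transp k \<circ> \<sigma>) S (tr T) * sig Y (tr T) = fop k a S * sig Y (tr T)"
    using step(1,2) syt[OF S] by (simp add: yker_def yrep_step[OF step(3)] yop_SYT a_def)
  also have "\<dots> = a S * sig Y (tr T) / of_int d + ywt d * (a (adj_transp k \<circ> S) * sig Y (tr T))"
    by (simp add: fop_def d_def distrib_right mult.assoc)
  also have "\<dots> = - sg * (sig Y S * (- b (tr S) / of_int d + ywt d * b (tr (adj_transp k \<circ> S))))"
    unfolding sw IH[OF S] by (simp add: algebra_simps)
  also have "- b (tr S) / of_int d + ywt d * b (tr (adj_transp k \<circ> S)) = fop k b (tr S)"
    unfolding d_def by (rule fop_tr[OF syt[OF S] step(1,2), symmetric])
  also have "\<dots> = yker n (adj_transp k \<circ> \<sigma>) (tr S) T"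
    using step(1,2) tr_SYT[OF syt[OF S]] by (simp add: yker_def yrep_step[OF step(3)] yop_SYT b_def)
  finally have "yker n (adj_transp k \<circ> \<sigma>) S (tr T) * sig Y (tr T) =
      (if evenperm (adj_transp k \<circ> \<sigma>) then 1 else - 1) * (sig Y S * yker n (adj_transp k \<circ> \<sigma>) (tr S) T)"
    unfolding sg' .
  thus ?case .
qed

end

text \<open>Treats both scalar fields at once: \<open>emb\<close> becomes the identity on the reals
  or the inclusion into the complex numbers.\<close>

locale real_embedding =
  fixes emb :: "real \<Rightarrow> 'a::conjugatable_field"
  assumes emb_add: "\<And>x y. emb (x + y) = emb x + emb y" and emb_mult: "\<And>x y. emb (x * y) = emb x * emb y"
    and emb_0: "emb 0 = 0" and emb_1: "emb 1 = 1" and emb_conj: "\<And>x. conjugate (emb x) = emb x"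

text \<open>With J sending v_T to sig(T) v_T', one has J^2 = \<open>eps\<close>, and \<theta> is a
  square root of it of modulus one. Within the reals this requires \<open>eps\<close> to be
  1.\<close>

locale sym_tabs_field = sym_tabs n TT Y + real_embedding emb
  for n TT Y and emb :: "real \<Rightarrow> 'a::conjugatable_field" +
  fixes \<theta> :: 'a
  assumes \<theta>_unit: "\<theta> * conjugate \<theta> = 1" and \<theta>_square: "\<theta> * \<theta> = emb eps"
begin

definition rt :: 'a where "rt = emb (1 / sqrt 2)"

text \<open>The column for T is (v_T + \<theta> sig(T) v_T') / sqrt 2, an eigenvector of J with
  eigenvalue \<open>conjugate \<theta>\<close>. The kernel \<open>pe\<close> below is the projection
  (1 + \<theta> J) / 2 onto the eigenspace.\<close>

definition e :: "tableau \<Rightarrow> tableau \<Rightarrow> 'a" where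
  "e S T = rt * ((if S = T then 1 else 0) + (if S = tr T then \<theta> * emb (sig Y T) else 0))"

definition pe :: "tableau \<Rightarrow> tableau \<Rightarrow> 'a" where
  "pe S S' = rt * rt * ((if S' = S then 1 else 0) + (if S' = tr S then conjugate \<theta> * emb (sig Y S) else 0))"

lemma rt_rt: "rt * rt + rt * rt = 1"
proof -
  have "rt * rt + rt * rt = emb (1 / sqrt 2 * (1 / sqrt 2) + 1 / sqrt 2 * (1 / sqrt 2))"
    unfolding rt_def emb_add emb_mult ..
  also have "1 / sqrt 2 * (1 / sqrt 2) + 1 / sqrt 2 * (1 / sqrt 2) = (1::real)" by simp
  finally show ?thesis by (simp add: emb_1)
qed

lemma conj_rt: "conjugate rt = rt"
  by (simp add: rt_def emb_conj)

lemma emb_sig: "emb (sig Y T) * emb (sig Y T) = 1"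
  using sig_square by (simp add: emb_1 flip: emb_mult)

lemma conj_\<theta>: "conjugate \<theta> = \<theta> * emb eps"
proof -
  have "conjugate \<theta> = conjugate \<theta> * emb (eps * eps)" by (simp add: eps_square emb_1)
  also have "\<dots> = conjugate \<theta> * (\<theta> * \<theta>) * emb eps" by (simp add: emb_mult \<theta>_square mult.assoc)
  also have "\<dots> = (\<theta> * conjugate \<theta>) * \<theta> * emb eps" by (simp add: ac_simps)
  finally show ?thesis by (simp add: \<theta>_unit)
qed

lemma sum_e:
  assumes "T \<in> X"
  shows "(\<Sum>S\<in>TT. f S * e S T) = rt * (f T + f (tr T) * (\<theta> * emb (sig Y T)))"
proof -
  have T: "T \<in> TT" "tr T \<in> TT" using assms X_sub trc by auto
  have "(\<Sum>S\<in>TT. f S * e S T) = (\<Sum>S\<in>TT. (if S = T then rt * f T else 0) +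
      (if S = tr T then rt * (f (tr T) * (\<theta> * emb (sig Y T))) else 0))"
    unfolding e_def by (intro sum.cong refl) (auto simp: algebra_simps)
  thus ?thesis using T fin by (simp add: sum.distrib distrib_left)
qed

lemma E_isometry: "mat_adjoint (kmat TT X e) * kmat TT X e = 1\<^sub>m (card X)"
  unfolding kmat_adjoint kmat_mult[OF fin] kmat_one[OF finX]
proof (rule kmat_cong)
  fix T T' assume T: "T \<in> X" "T' \<in> X"
  have ne: "T' \<noteq> tr T" "tr T' \<noteq> T" "T \<noteq> tr T" using tr_X X_sub T tr_tr by (metis subsetD)+
  have "(\<Sum>S\<in>TT. conjugate (e S T) * e S T') =
      rt * (conjugate (e T' T) + conjugate (e (tr T') T) * (\<theta> * emb (sig Y T')))"
    by (rule sum_e[OF T(2)])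
  also have "\<dots> = (if T = T' then 1 else 0)"
  proof (cases "T = T'")
    case True
    have "conjugate (e T T) = rt" using ne by (simp add: e_def conjugate_dist_mul conj_rt)
    moreover have "conjugate (e (tr T) T) = rt * (conjugate \<theta> * emb (sig Y T))"
      using ne by (simp add: e_def conjugate_dist_mul conj_rt emb_conj)
    moreover have "rt * (rt + rt * (conjugate \<theta> * emb (sig Y T)) * (\<theta> * emb (sig Y T))) =
        rt * rt + rt * rt * ((\<theta> * conjugate \<theta>) * (emb (sig Y T) * emb (sig Y T)))"
      by (simp add: algebra_simps)
    ultimately show ?thesis using True by (simp add: \<theta>_unit emb_sig rt_rt)
  next
    case False
    hence "tr T' \<noteq> tr T" using tr_tr by metis
    hence "e T' T = 0" "e (tr T') T = 0" using False ne by (auto simp: e_def)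
    thus ?thesis using False by simp
  qed
  finally show "(\<Sum>S\<in>TT. conjugate (e S T) * e S T') = (if T = T' then 1 else 0)" .
qed

text \<open>Each row index S occurs in exactly one column, that of its representative, which is S or
  its transpose. In the second case \<open>sig_tr_eps\<close> and \<open>conj_\<theta>\<close>
  express the coefficient through the sign of S again.\<close>

lemma E_projection: "kmat TT X e * mat_adjoint (kmat TT X e) = kmat TT TT pe"
  unfolding kmat_adjoint kmat_mult[OF finX]
proof (rule kmat_cong)
  fix S S' assume S: "S \<in> TT" "S' \<in> TT"
  have sneq: "S \<noteq> tr S" "S' \<noteq> tr S'" using tr_neq S by metis+
  show "(\<Sum>T\<in>X. e S T * conjugate (e S' T)) = pe S S'"
  proof (cases "S \<in> X")
    case True
    have "e S T = (if T = S then rt else 0)" if "T \<in> X" for T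
      using tr_X[of T] X_sub that True sneq by (auto simp: e_def)
    hence "(\<Sum>T\<in>X. e S T * conjugate (e S' T)) = (\<Sum>T\<in>X. if T = S then rt * conjugate (e S' S) else 0)"
      by (intro sum.cong refl) simp
    also have "\<dots> = rt * conjugate (e S' S)" using True finX by simp
    also have "\<dots> = pe S S'"
      using sneq by (auto simp: e_def pe_def conjugate_dist_mul conjugate_dist_add conj_rt emb_conj mult.assoc)
    finally show ?thesis .
  next
    case False
    hence tS: "tr S \<in> X" using tr_X[OF S(1)] by blast
    have "e S T = (if T = tr S then rt * (\<theta> * emb (sig Y (tr S))) else 0)" if "T \<in> X" for T
      using that False tr_eq_iff[of S T] by (auto simp: e_def tr_eq_iff)
    hence "(\<Sum>T\<in>X. e S T * conjugate (e S' T)) =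
        (\<Sum>T\<in>X. if T = tr S then rt * (\<theta> * emb (sig Y (tr S))) * conjugate (e S' (tr S)) else 0)"
      by (intro sum.cong refl) simp
    also have "\<dots> = rt * (\<theta> * emb (sig Y (tr S))) * conjugate (e S' (tr S))" using tS finX by simp
    also have "\<dots> = pe S S'"
    proof -
      have c: "conjugate (e S' (tr S)) = rt * ((if S' = tr S then 1 else 0) + (if S' = S then conjugate \<theta> * emb (sig Y (tr S)) else 0))"
        by (auto simp: e_def conjugate_dist_mul conjugate_dist_add conj_rt emb_conj)
      have 1: "\<theta> * emb (sig Y (tr S)) * (conjugate \<theta> * emb (sig Y (tr S))) = 1"
      proof -
        have "\<theta> * emb (sig Y (tr S)) * (conjugate \<theta> * emb (sig Y (tr S))) =
            (\<theta> * conjugate \<theta>) * (emb (sig Y (tr S)) * emb (sig Y (tr S)))" by (simp add: ac_simps)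
        thus ?thesis by (simp add: \<theta>_unit emb_sig)
      qed
      have 2: "\<theta> * emb (sig Y (tr S)) = conjugate \<theta> * emb (sig Y S)"
        unfolding sig_tr_eps[OF S(1)] emb_mult conj_\<theta> by (simp add: ac_simps)
      show ?thesis
      proof (cases "S' = S")
        case True
        have "rt * (\<theta> * emb (sig Y (tr S))) * (rt * (conjugate \<theta> * emb (sig Y (tr S)))) =
            rt * rt * (\<theta> * emb (sig Y (tr S)) * (conjugate \<theta> * emb (sig Y (tr S))))" by (simp add: ac_simps)
        hence "rt * (\<theta> * emb (sig Y (tr S))) * (rt * (conjugate \<theta> * emb (sig Y (tr S)))) = rt * rt"
          by (simp only: 1 mult_1_right)
        moreover have "conjugate (e S (tr S)) = rt * (conjugate \<theta> * emb (sig Y (tr S)))" using c True sneq by simp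
        moreover have "pe S S = rt * rt" using sneq by (simp add: pe_def)
        ultimately show ?thesis unfolding True by (simp only:)
      next
        case F: False
        show ?thesis
        proof (cases "S' = tr S")
          case True
          have "conjugate (e (tr S) (tr S)) = rt" using c True F by simp
          moreover have "pe S (tr S) = rt * rt * (conjugate \<theta> * emb (sig Y S))" using sneq by (simp add: pe_def)
          ultimately show ?thesis unfolding True 2 by (simp add: ac_simps)
        qed (use F in \<open>simp add: c pe_def\<close>)
      qed
    qed
    finally show ?thesis .
  qed
qed

lemma sum_pe_left:
  assumes "S \<in> TT"
  shows "(\<Sum>U\<in>TT. pe S U * f U) = rt * rt * (f S + conjugate \<theta> * emb (sig Y S) * f (tr S))"
proof -
  have "(\<Sum>U\<in>TT. pe S U * f U) = (\<Sum>U\<in>TT. (if U = S then rt * rt * f S else 0) +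
      (if U = tr S then rt * rt * (conjugate \<theta> * emb (sig Y S) * f (tr S)) else 0))"
    unfolding pe_def by (intro sum.cong refl) (auto simp: algebra_simps)
  thus ?thesis using assms trc fin by (simp add: sum.distrib distrib_left)
qed

lemma sum_pe_right:
  assumes "T \<in> TT"
  shows "(\<Sum>U\<in>TT. f U * pe U T) = rt * rt * (f T + conjugate \<theta> * emb (sig Y (tr T)) * f (tr T))"
proof -
  have "(\<Sum>U\<in>TT. f U * pe U T) = (\<Sum>U\<in>TT. (if U = T then rt * rt * f T else 0) +
      (if U = tr T then rt * rt * (conjugate \<theta> * emb (sig Y (tr T)) * f (tr T)) else 0))"
    unfolding pe_def by (intro sum.cong refl) (auto simp: algebra_simps)
  thus ?thesis using assms trc fin by (simp add: sum.distrib distrib_left)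
qed

text \<open>For an even permutation the sign twist in \<open>yker_tr\<close> is trivial, so the
  reflected terms of both products coincide; the direct terms agree anyway.\<close>

lemma projection_commutes:
  assumes "\<sigma> permutes {1..n}" "evenperm \<sigma>"
  shows "kmat TT X e * mat_adjoint (kmat TT X e) * kmat TT TT (\<lambda>S T. emb (yker n \<sigma> S T)) =
    kmat TT TT (\<lambda>S T. emb (yker n \<sigma> S T)) * (kmat TT X e * mat_adjoint (kmat TT X e))"
  unfolding E_projection kmat_mult[OF fin]
proof (rule kmat_cong)
  fix S T assume S: "S \<in> TT" and T: "T \<in> TT"
  have "emb (yker n \<sigma> S (tr T) * sig Y (tr T)) = emb (sig Y S * yker n \<sigma> (tr S) T)"
    using yker_tr[OF assms(1) T S] assms(2) by simp
  hence "emb (yker n \<sigma> S (tr T)) * emb (sig Y (tr T)) = emb (sig Y S) * emb (yker n \<sigma> (tr S) T)"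
    by (simp add: emb_mult)
  hence "conjugate \<theta> * emb (sig Y S) * emb (yker n \<sigma> (tr S) T) =
      conjugate \<theta> * emb (sig Y (tr T)) * emb (yker n \<sigma> S (tr T))"
    by (simp add: mult.assoc) (simp add: mult.commute)
  thus "(\<Sum>U\<in>TT. pe S U * emb (yker n \<sigma> U T)) = (\<Sum>U\<in>TT. emb (yker n \<sigma> S U) * pe U T)"
    unfolding sum_pe_left[OF S] sum_pe_right[OF T] by simp
qed

end

section \<open>Extension of the scalars\<close>

context real_embedding
begin

lemma emb_sum: "emb (sum f A) = (\<Sum>x\<in>A. emb (f x))"
  by (induction A rule: infinite_finite_induct) (auto simp: emb_0 emb_add)

lemma map_mat_mult_emb:
  assumes "dim_col A = dim_row B"
  shows "map_mat emb (A * B) = map_mat emb A * map_mat emb B"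
  by (rule eq_matI) (use assms in \<open>auto simp: scalar_prod_def emb_sum emb_mult\<close>)

lemma map_mat_one_emb: "map_mat emb (1\<^sub>m k) = 1\<^sub>m k"
  by (rule eq_matI) (auto simp: emb_0 emb_1)

lemma map_mat_adjoint_emb: "mat_adjoint (map_mat emb A) = map_mat emb (mat_adjoint A)"
  by (rule eq_matI) (auto simp: mat_adjoint_mat emb_conj)

lemma map_mat_smult_emb: "map_mat emb (c \<cdot>\<^sub>m A) = emb c \<cdot>\<^sub>m map_mat emb A"
  by (rule eq_matI) (auto simp: emb_mult)

lemma frame_data_map:
  assumes "frame_data n N r G \<pi> \<rho> \<Psi> t"
  shows "frame_data n N r G (\<lambda>g. map_mat emb (\<pi> g)) (\<lambda>h. map_mat emb (\<rho> h)) (map_mat emb \<Psi>) t"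
    and "g \<in> G \<Longrightarrow> frame_data.A (\<lambda>g. map_mat emb (\<pi> g)) (map_mat emb \<Psi>) g = map_mat emb (frame_data.A \<pi> \<Psi> g)"
    and "frame_data.Q n N (\<lambda>g. map_mat emb (\<pi> g)) (map_mat emb \<Psi>) t = map_mat emb (frame_data.Q n N \<pi> \<Psi> t)"
proof -
  interpret fr: frame_data n N r G \<pi> \<rho> \<Psi> t by (rule assms)
  interpret mp: frame_data n N r G "\<lambda>g. map_mat emb (\<pi> g)" "\<lambda>h. map_mat emb (\<rho> h)" "map_mat emb \<Psi>" t
  proof
    show "map_mat emb (\<pi> g) \<in> carrier_mat N N" if "g \<in> G" for g using fr.\<pi>_carrier[OF that] by simp
    show "map_mat emb (\<pi> (g \<circ> h)) = map_mat emb (\<pi> g) * map_mat emb (\<pi> h)" if "g \<in> G" "h \<in> G" for g h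
      using that by (simp add: fr.\<pi>_comp map_mat_mult_emb)
    show "map_mat emb (\<pi> id) = 1\<^sub>m N" by (simp add: fr.\<pi>_id map_mat_one_emb)
    show "mat_adjoint (map_mat emb (\<pi> g)) = map_mat emb (\<pi> (inv' g))" if "g \<in> G" for g
      using that by (simp add: map_mat_adjoint_emb fr.\<pi>_inv)
    show "map_mat emb (\<rho> h) \<in> carrier_mat r r" if "h \<in> G" "h n = n" for h using fr.\<rho>_carrier[OF that] by simp
    show "map_mat emb (\<rho> h) * mat_adjoint (map_mat emb (\<rho> h)) = 1\<^sub>m r" if "h \<in> G" "h n = n" for h
      using fr.\<rho>_unitary[OF that] map_mat_mult_emb[of "\<rho> h" "mat_adjoint (\<rho> h)"]
      by (simp add: map_mat_adjoint_emb map_mat_one_emb)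
    show "mat_adjoint (map_mat emb (\<rho> h)) * map_mat emb (\<rho> h) = 1\<^sub>m r" if "h \<in> G" "h n = n" for h
      using fr.\<rho>_unitary'[OF that] map_mat_mult_emb[of "mat_adjoint (\<rho> h)" "\<rho> h"]
      by (simp add: map_mat_adjoint_emb map_mat_one_emb)
    show "map_mat emb \<Psi> \<in> carrier_mat N r" using fr.\<Psi>_carrier by simp
    show "mat_adjoint (map_mat emb \<Psi>) * map_mat emb \<Psi> = 1\<^sub>m r"
      using fr.\<Psi>_isometry map_mat_mult_emb[of "mat_adjoint \<Psi>" \<Psi>] by (simp add: map_mat_adjoint_emb map_mat_one_emb)
    show "map_mat emb (\<pi> h) * map_mat emb \<Psi> = map_mat emb \<Psi> * map_mat emb (\<rho> h)" if "h \<in> G" "h n = n" for h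
      using fr.intertwines[OF that] that map_mat_mult_emb[of "\<pi> h" \<Psi>] map_mat_mult_emb[of \<Psi> "\<rho> h"] by simp
  qed (use fr.n_pos fr.G_permutes fr.G_comp fr.G_inv fr.t_in fr.t_top in blast)+
  show "frame_data n N r G (\<lambda>g. map_mat emb (\<pi> g)) (\<lambda>h. map_mat emb (\<rho> h)) (map_mat emb \<Psi>) t"
    by (rule mp.frame_data_axioms)
  show "mp.A g = map_mat emb (fr.A g)" if "g \<in> G"
    unfolding mp.A_def fr.A_def using that by (simp add: map_mat_mult_emb map_mat_adjoint_emb)
  have "mp.Q = mat_sum N {1..n} (\<lambda>k. map_mat emb (fr.M k * mat_adjoint (fr.M k)))"
    unfolding mp.Q_def
  proof (rule mat_sum_cong)
    fix k assume k: "k \<in> {1..n}"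
    have "mp.M k = map_mat emb (fr.M k)"
      unfolding mp.M_def fr.M_def using fr.t_in[OF k] by (simp add: map_mat_mult_emb)
    thus "mp.M k * mat_adjoint (mp.M k) = map_mat emb (fr.M k * mat_adjoint (fr.M k))"
      by (simp add: map_mat_mult_emb map_mat_adjoint_emb)
  qed
  also have "\<dots> = map_mat emb fr.Q"
    unfolding fr.Q_def mat_sum_def
  proof (rule eq_matI)
    fix i j assume "i < dim_row (map_mat emb (mat N N (\<lambda>(i, j). \<Sum>k\<in>{1..n}. (fr.M k * mat_adjoint (fr.M k)) $$ (i, j))))"
      "j < dim_col (map_mat emb (mat N N (\<lambda>(i, j). \<Sum>k\<in>{1..n}. (fr.M k * mat_adjoint (fr.M k)) $$ (i, j))))"
    hence ij: "i < N" "j < N" by auto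
    have "map_mat emb (fr.M k * mat_adjoint (fr.M k)) $$ (i, j) = emb ((fr.M k * mat_adjoint (fr.M k)) $$ (i, j))"
      if "k \<in> {1..n}" for k using fr.M_dims(1)[OF that] ij by (subst index_map_mat) auto
    thus "mat N N (\<lambda>(i, j). \<Sum>k\<in>{1..n}. map_mat emb (fr.M k * mat_adjoint (fr.M k)) $$ (i, j)) $$ (i, j) =
        map_mat emb (mat N N (\<lambda>(i, j). \<Sum>k\<in>{1..n}. (fr.M k * mat_adjoint (fr.M k)) $$ (i, j))) $$ (i, j)"
      using ij by (simp add: emb_sum del: index_mult_mat atLeastAtMost_iff)
  qed auto
  finally show "mp.Q = map_mat emb fr.Q" .
qed

end

text \<open>Describes the coefficients of \<open>Psi_sum\<close> by agreement on the boxes of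
  \<open>\<mu>\<close> and by the shape alone, without naming the partition. This form is visibly
  invariant under reflecting both tableaux, and nonzero coefficients join tableaux of equal
  sign.\<close>

lemma (in up_rep) psi_agree:
  assumes T: "T \<in> Tabs L" and R: "R \<in> Tab \<mu>"
  shows "psi T R = (if \<forall>b\<in>diagram \<mu>. T b = R b then sqrt (real (num_ST (shape T)) / real (d_sum L)) else 0)"
    and "\<forall>b\<in>diagram \<mu>. T b = R b \<Longrightarrow> sig (diagram \<mu>) T = sig (diagram \<mu>) R"
proof -
  obtain \<nu> where \<nu>: "\<nu> \<in> L" "T \<in> ST n (diagram \<nu>)" using T by (auto simp: Tabs_eq)
  have T': "T \<in> SYT n" "shape T = diagram \<nu>" using \<nu> by (auto simp: ST_def)
  have R': "R \<in> SYT m" "shape R = diagram \<mu>" using R by (auto simp: Tab_mu ST_def)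
  note ab = abox[OF \<nu>(1)]
  have ext: "T = ext \<nu> R" if ag: "\<forall>b\<in>diagram \<mu>. T b = R b"
  proof
    fix b
    consider "b \<in> diagram \<mu>" | "b = abox \<nu>" | "b \<notin> diagram \<nu>" using ab by auto
    thus "T b = ext \<nu> R b"
    proof cases
      case 1
      thus ?thesis using ag ab(1) by (auto simp: ext_def)
    next
      case 2
      \<comment> \<open>The entries 1, ..., m are used up on the boxes of \<open>\<mu>\<close>, so
        the added box must hold n.\<close>
      have rg: "1 \<le> T b \<and> T b \<le> n" using SYT_range[OF T'(1), of b] T'(2) ab(2) 2 by simp
      have "T b \<noteq> a" if "1 \<le> a" "a \<le> m" for a
      proof
        assume "T b = a"
        moreover have w: "R (box_of R a) = a" "box_of R a \<in> diagram \<mu>" using box_of_works[OF R'(1) that] R'(2) by auto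
        ultimately have "T b = T (box_of R a)" using ag by simp
        hence "b = box_of R a" using SYT_inj[OF T'(1), of b] T'(2) ab(2) 2 by simp
        thus False using w(2) ab(1) 2 by simp
      qed
      hence "T b = n" using rg by (metis le_SucE)
      thus ?thesis using 2 by (simp add: ext_def)
    next
      case 3
      hence "T b = 0" "R b = 0" "b \<noteq> abox \<nu>" using not_in_shape[of b T] not_in_shape[of b R] T'(2) R'(2) ab by auto
      thus ?thesis by (simp add: ext_def)
    qed
  qed
  show "psi T R = (if \<forall>b\<in>diagram \<mu>. T b = R b then sqrt (real (num_ST (shape T)) / real (d_sum L)) else 0)"
  proof (cases "\<forall>b\<in>diagram \<mu>. T b = R b")
    case True
    have "psi T R = sqrt (real (d_tab \<nu>) / real (d_sum L))" using psi_ext[OF R R \<nu>(1)] ext[OF True] by simp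
    thus ?thesis using True d_tab_num_ST[OF L_part[OF \<nu>(1)]] T'(2) by simp
  next
    case False
    then obtain b where b: "b \<in> diagram \<mu>" "T b \<noteq> R b" by blast
    have "T \<noteq> ext \<kappa> R" if "\<kappa> \<in> L" for \<kappa>
    proof
      assume "T = ext \<kappa> R"
      moreover have "b \<noteq> abox \<kappa>" using b(1) abox(1)[OF that] by metis
      ultimately show False using b(2) by (simp add: ext_def)
    qed
    hence "psi T R = 0" unfolding psi_def by (intro sum.neutral) auto
    thus ?thesis unfolding if_not_P[OF False] .
  qed
  show "sig (diagram \<mu>) T = sig (diagram \<mu>) R" if "\<forall>b\<in>diagram \<mu>. T b = R b"
    unfolding ext[OF that] ext_def
    using sig_extend[of R m "diagram \<mu>" "abox \<nu>"] R ab(1) abox_young[OF \<nu>(1)] by (simp add: Tab_mu)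
qed

text \<open>Transposition negates the contents of the added boxes and hence reverses their
  enumeration. Its length is the number of distinct parts plus one, which is odd, so i and M - 1 - i
  have the same parity.\<close>

lemma L_parity_tr:
  assumes p: "is_partition m \<mu>" and sym: "prod.swap ` diagram \<mu> = diagram \<mu>" and ev: "even (card (set \<mu>))"
    and \<nu>: "\<nu> \<in> L_parity \<delta> \<mu>"
  obtains \<nu>' where "\<nu>' \<in> L_parity \<delta> \<mu>" "diagram \<nu>' = prod.swap ` diagram \<nu>"
proof -
  define ls where "ls = up_enum \<mu>"
  define M where "M = length ls"
  note ep = up_enum_props[OF p, folded ls_def, folded M_def]
  let ?f = "\<lambda>\<nu>. superdiagonal (added_box \<nu> \<mu>)"
  have flip: "\<exists>\<kappa>\<in>up_set \<mu>. diagram \<kappa> = prod.swap ` diagram \<nu> \<and> ?f \<kappa> = - ?f \<nu>" if \<nu>: "\<nu> \<in> up_set \<mu>" for \<nu>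
  proof -
    note u = up_setD[OF p \<nu>]
    let ?b = "prod.swap (added_box \<nu> \<mu>)"
    have nb: "?b \<notin> diagram \<mu>" using u(2) sym mem_swap_image'[of ?b "diagram \<mu>"] by auto
    have e: "insert ?b (diagram \<mu>) = prod.swap ` diagram \<nu>" using u(3) sym by (metis image_insert)
    hence "?b \<in> addable (diagram \<mu>)"
      using nb young_swap[OF young_diagram[OF u(1)]] by (simp add: addable_def)
    then obtain \<kappa> where \<kappa>: "\<kappa> \<in> up_set \<mu>" "added_box \<kappa> \<mu> = ?b"
      using up_set_added[OF p] by (metis (no_types, lifting) bij_betw_def imageE)
    have "diagram \<kappa> = prod.swap ` diagram \<nu>" using up_setD(3)[OF p \<kappa>(1)] \<kappa>(2) e by simp
    moreover have "?f \<kappa> = - ?f \<nu>" using \<kappa>(2) by (simp add: superdiagonal_def)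
    ultimately show ?thesis using \<kappa>(1) by blast
  qed
  define C where "C = map ?f ls"
  have st: "sorted_wrt (<) (rev C)"
    unfolding C_def sorted_wrt_iff_nth_less using ep(2) by (auto simp: rev_nth M_def)
  have st': "sorted_wrt (<) (map uminus C)"
    unfolding C_def sorted_wrt_iff_nth_less using ep(2) by (auto simp: M_def)
  have "set (map uminus C) = set (rev C)"
  proof -
    have s: "set C = ?f ` up_set \<mu>" by (simp add: C_def ep(1))
    have sub: "uminus ` set C \<subseteq> set C" unfolding s using flip by force
    hence "uminus ` uminus ` set C \<subseteq> uminus ` set C" by (rule image_mono)
    thus ?thesis using sub by (auto simp: image_image)
  qed
  \<comment> \<open>Two strictly increasing lists with the same elements are equal; the set of
    contents is symmetric about 0.\<close>
  hence revC: "map uminus C = rev C" by (rule strict_sorted_equal[OF st st'])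
  have Cn: "?f (ls ! (M - 1 - i)) = - ?f (ls ! i)" if "i < M" for i
  proof -
    have "map uminus C ! i = rev C ! i" by (simp only: revC)
    thus ?thesis using that by (simp add: C_def rev_nth M_def)
  qed
  obtain i where i: "i < M" "(i + 1) mod 2 = \<delta>" "\<nu> = ls ! i"
    using \<nu> unfolding L_parity_eq ls_def[symmetric] M_def[symmetric] by blast
  have lsin: "ls ! i \<in> up_set \<mu>" if "i < M" for i using that ep(1) nth_mem[of i ls] by (simp add: M_def)
  obtain \<kappa> where \<kappa>: "\<kappa> \<in> up_set \<mu>" "diagram \<kappa> = prod.swap ` diagram \<nu>" "?f \<kappa> = - ?f \<nu>"
    using flip lsin[OF i(1)] i(3) by blast
  obtain j where j: "j < M" "\<kappa> = ls ! j" using \<kappa>(1) ep(1) by (metis M_def in_set_conv_nth)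
  have "?f (ls ! j) = ?f (ls ! (M - 1 - i))" using Cn[OF i(1)] \<kappa>(3) i(3) j(2) by simp
  moreover have a: "M - 1 - i < M" using i(1) by simp
  ultimately have ji: "j = M - 1 - i"
    using ep(2)[of j "M - 1 - i"] ep(2)[OF _ j(1), of "M - 1 - i"] by (cases j "M - 1 - i" rule: linorder_cases) auto
  have "even (M - 1)" using ev ep(4) by simp
  moreover have "M - 1 = j + i" using ji i(1) by simp
  ultimately have "even (j + i)" by (simp only:)
  hence "even (j + 1) = even (i + 1)" by simp
  hence "(j + 1) mod 2 = (i + 1) mod 2" by (simp add: mod_2_eq_odd)
  hence "(j + 1) mod 2 = \<delta>" using i(2) by (simp only:)
  hence "j \<in> {i. i < M \<and> (i + 1) mod 2 = \<delta>}" using j(1) by simp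
  hence "ls ! j \<in> L_parity \<delta> \<mu>" unfolding L_parity_eq ls_def M_def by (rule imageI)
  hence "\<kappa> \<in> L_parity \<delta> \<mu>" by (simp only: j(2))
  thus ?thesis using \<kappa>(2) by (rule that)
qed

text \<open>The boxes on the diagonal form an initial segment, so their number is the maximum in
  \<open>durfee\<close>; the boxes above and below the diagonal correspond by reflection.\<close>

lemma durfee_eq:
  assumes p: "is_partition m \<mu>" and m: "1 \<le> m" and sym: "prod.swap ` diagram \<mu> = diagram \<mu>"
  shows "m = durfee \<mu> + 2 * card {b \<in> diagram \<mu>. fst b < snd b}"
proof -
  let ?Y = "diagram \<mu>"
  let ?D = "{b \<in> ?Y. fst b = snd b}" and ?U = "{b \<in> ?Y. fst b < snd b}" and ?L = "{b \<in> ?Y. snd b < fst b}"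
  have fin: "finite ?Y" by (rule finite_diagram)
  have "?L = prod.swap ` ?U"
  proof (intro Set.set_eqI)
    fix b show "b \<in> ?L \<longleftrightarrow> b \<in> prod.swap ` ?U"
      using sym mem_swap_image'[of b ?Y] by (simp add: mem_swap_image')
  qed
  hence LU: "card ?L = card ?U" by (simp add: card_image)
  have "?Y = ?D \<union> (?U \<union> ?L)" by auto
  hence "card ?Y = card (?D \<union> (?U \<union> ?L))" by simp
  also have "\<dots> = card ?D + (card ?U + card ?L)"
    using fin by (subst card_Un_disjoint) (auto simp: card_Un_disjoint disjoint_iff intro!: card_Un_disjoint)
  finally have cY: "m = card ?D + 2 * card ?U" using LU card_diagram[of \<mu>] p by (simp add: is_partition_def)
  define S where "S = {i \<in> {1..length \<mu>}. i \<le> part \<mu> i}"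
  have "?D = (\<lambda>i. (i, i)) ` S"
    by (auto simp: S_def mem_diagram part_def split: if_splits)
  hence cD: "card ?D = card S" by (simp add: card_image inj_on_def)
  have S: "S = {1..card S}"
  proof (rule initial_segment)
    fix x y assume "x \<in> S" "1 \<le> y" "y \<le> x"
    thus "y \<in> S" using part_mono[OF p, of y x] by (auto simp: S_def)
  qed (auto simp: S_def)
  have "\<mu> \<noteq> []" using p m by (auto simp: is_partition_def)
  hence "1 \<in> S" using part_pos[OF p, of 1] by (cases \<mu>) (auto simp: S_def)
  hence "card S \<ge> 1" using S by auto
  hence "Max S = card S" by (subst S) (simp add: Max_eq_iff)
  thus ?thesis using cY cD by (simp add: durfee_def S_def)
qed

text \<open>The projections for \<open>L\<close> and for \<open>\<mu>\<close> use the same \<theta>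
  and the same boxes. Their compatibility with the two actions is the triviality of the sign twist
  on even permutations, and that with \<open>Psi_sum\<close> is the symmetry expressed by
  \<open>psi_agree\<close>.\<close>

lemma alternating_frame:
  fixes emb :: "real \<Rightarrow> 'a::conjugatable_field" and \<theta> :: 'a
  assumes p: "is_partition m \<mu>" and sym: "prod.swap ` diagram \<mu> = diagram \<mu>" and iso: "isoclinic \<mu>"
    and ev: "even (card (set \<mu>))" and \<delta>: "\<delta> \<in> {0, 1}" and emb: "real_embedding emb"
    and \<theta>: "\<theta> * conjugate \<theta> = 1" "\<theta> * \<theta> = emb ((- 1) ^ card {b \<in> diagram \<mu>. fst b < snd b})"
  defines "L \<equiv> L_parity \<delta> \<mu>"
  shows "even (d_tab \<mu>) \<and> even (d_sum L) \<and> (\<exists>W :: nat \<Rightarrow> 'a vec set.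
    equi_isoclinic_tff (Suc m) (d_tab \<mu> div 2) (d_sum L div 2) W \<and>
    carrier (alt_group (Suc m)) \<subseteq> fusion_aut (Suc m) (d_sum L div 2) W)"
proof -
  note li = L_parity_isoclinic[OF p iso \<delta>, folded L_def]
  have "\<mu> \<noteq> []" using li(1) p by (auto simp: is_partition_def)
  moreover obtain q where "card (set \<mu>) = 2 * q" using ev by (elim evenE)
  \<comment> \<open>The number of distinct parts is even and nonzero, so m is at least 2; this
    provides an entry 2 and lets the transposition of 1 and 2 fix m + 1.\<close>
  ultimately have "2 \<le> card (set \<mu>)" by (cases q) auto
  also have "\<dots> \<le> length \<mu>" by (rule card_length)
  also have "\<dots> \<le> m" using length_le_sum_list[of \<mu>] p by (simp add: is_partition_def)
  finally have m2: "2 \<le> m" .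
  interpret E: real_embedding emb by (rule emb)
  have Lsub: "L \<subseteq> up_set \<mu>" unfolding L_def by (rule L_parity_subset[OF p])
  interpret U: up_rep m \<mu> L by (intro up_rep.intro p Lsub li(2))
  have finY: "finite (diagram \<mu>)" by (rule finite_diagram)
  interpret TL: sym_tabs_field "Suc m" "Tabs L" "diagram \<mu>" emb \<theta>
  proof (intro sym_tabs_field.intro sym_tabs_field_axioms.intro emb)
    show st: "sym_tabs (Suc m) (Tabs L) (diagram \<mu>)"
    proof
      show "2 \<le> Suc m" using m2 by simp
      show "finite (Tabs L)" by (rule U.finite_Tabs)
      show "T \<in> SYT (Suc m)" if "T \<in> Tabs L" for T by (rule U.Tabs_SYT[OF that])
      show "ST (Suc m) (shape T) \<subseteq> Tabs L" if "T \<in> Tabs L" for T by (rule U.Tabs_ST[OF that])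
      show "tr T \<in> Tabs L" if T: "T \<in> Tabs L" for T
      proof -
        obtain \<nu> where \<nu>: "\<nu> \<in> L" "T \<in> ST (Suc m) (diagram \<nu>)" using T by (auto simp: U.Tabs_eq)
        obtain \<nu>' where "\<nu>' \<in> L" "diagram \<nu>' = prod.swap ` diagram \<nu>"
          using L_parity_tr[OF p sym ev \<nu>(1)[unfolded L_def], folded L_def] by blast
        thus ?thesis unfolding U.Tabs_eq using tr_ST[OF \<nu>(2)] by (metis UN_I)
      qed
      show "\<exists>b0. shape T - diagram \<mu> \<subseteq> {b0}" "diagram \<mu> \<subseteq> shape T" if T: "T \<in> Tabs L" for T
      proof -
        obtain \<nu> where \<nu>: "\<nu> \<in> L" "shape T = diagram \<nu>" using T by (auto simp: U.Tabs_eq ST_def)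
        have e: "shape T = insert (U.abox \<nu>) (diagram \<mu>)" using U.abox(2)[OF \<nu>(1)] \<nu>(2) by simp
        show "\<exists>b0. shape T - diagram \<mu> \<subseteq> {b0}" unfolding e by (rule exI[of _ "U.abox \<nu>"]) blast
        show "diagram \<mu> \<subseteq> shape T" unfolding e by blast
      qed
    qed (use finY sym in auto)
    show "\<theta> * conjugate \<theta> = 1" by (rule \<theta>(1))
    show "\<theta> * \<theta> = emb (sym_tabs.eps (diagram \<mu>))" unfolding sym_tabs.eps_def[OF st] by (rule \<theta>(2))
  qed
  interpret TM: sym_tabs_field m "Tab \<mu>" "diagram \<mu>" emb \<theta>
  proof (intro sym_tabs_field.intro sym_tabs_field_axioms.intro emb)
    show st: "sym_tabs m (Tab \<mu>) (diagram \<mu>)"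
    proof
      show "tr T \<in> Tab \<mu>" if "T \<in> Tab \<mu>" for T using tr_ST[of T m "diagram \<mu>"] that sym by (simp add: U.Tab_mu)
      show "2 \<le> m" by (rule m2)
      show "finite (Tab \<mu>)" by (rule U.finite_Tab_mu)
    qed (use finY sym in \<open>auto simp: U.Tab_mu ST_def\<close>)
    show "\<theta> * conjugate \<theta> = 1" by (rule \<theta>(1))
    show "\<theta> * \<theta> = emb (sym_tabs.eps (diagram \<mu>))" unfolding sym_tabs.eps_def[OF st] by (rule \<theta>(2))
  qed
  have dL: "d_sum L = 2 * card TL.X" using TL.card_TT U.card_Tabs by simp
  have dM: "d_tab \<mu> = 2 * card TM.X" using TM.card_TT by (simp add: d_tab_def)
  \<comment> \<open>The transposition of k and m + 1 is odd; composing with that of 1 and 2, which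
    fixes m + 1, gives a coset representative inside the alternating group.\<close>
  define t where "t k = (if k = Suc m then id else Transposition.transpose k (Suc m) \<circ> Transposition.transpose 1 2)" for k :: nat
  have t: "t k permutes {1..Suc m}" "t k (Suc m) = k" "evenperm (t k)" if "k \<in> {1..Suc m}" for k
  proof -
    have s: "Transposition.transpose k (Suc m) permutes {1..Suc m}" "Transposition.transpose 1 2 permutes {1..Suc m}"
      using that m2 by (auto intro!: permutes_swap_id)
    show "t k permutes {1..Suc m}" using permutes_compose[OF s(2,1)] permutes_id by (simp add: t_def)
    show "t k (Suc m) = k" using m2 by (simp add: t_def transpose_apply_other)
    show "evenperm (t k)"
      using evenperm_comp[OF permutation_swap_id[of k "Suc m"] permutation_swap_id[of 1 2]]
      by (simp add: t_def evenperm_swap evenperm_id)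
  qed
  interpret fr: frame_data "Suc m" "d_sum L" "d_tab \<mu>" "{\<sigma>. \<sigma> permutes {1..Suc m}}" "rep_sum L" "young_rep \<mu>" "Psi_sum L \<mu>" t
    by (rule U.frame[OF t(1,2)])
  note mp = E.frame_data_map[OF fr.frame_data_axioms]
  obtain \<alpha> where \<alpha>: "\<And>R. R \<in> Tab \<mu> \<Longrightarrow> (U.hval R)\<^sup>2 = \<alpha>" using li(3) by blast
  define c where "c = real (Suc m) * real (d_tab \<mu>) / real (d_sum L)"
  have Qe: "fr.Q = c \<cdot>\<^sub>m 1\<^sub>m (d_sum L)" unfolding c_def by (rule U.tight[OF t(1,2)])
  define H where "H = carrier (alt_group (Suc m))"
  have Hmem: "g \<in> H \<longleftrightarrow> g permutes {1..Suc m} \<and> evenperm g" for g by (simp only: H_def alt_group_carrier)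
  have repe: "map_mat emb (rep_sum L g) = kmat (Tabs L) (Tabs L) (\<lambda>S T. emb (yker (Suc m) g S T))"
    if "g permutes {1..Suc m}" for g unfolding U.rep_eq[OF that] map_mat_kmat ..
  have "\<exists>W :: nat \<Rightarrow> 'a vec set. equi_isoclinic_tff (Suc m) (card TM.X) (card TL.X) W \<and> H \<subseteq> fusion_aut (Suc m) (card TL.X) W"
  proof (rule frame_data.compressed_frame[OF mp(1), where E = "kmat (Tabs L) TL.X TL.e" and F = "kmat (Tab \<mu>) TM.X TM.e"
      and \<alpha> = "emb \<alpha>" and c = "emb c"])
    show "kmat (Tabs L) TL.X TL.e \<in> carrier_mat (d_sum L) (card TL.X)" unfolding U.card_Tabs[symmetric] by (rule kmat_carrier)
    show "mat_adjoint (kmat (Tabs L) TL.X TL.e) * kmat (Tabs L) TL.X TL.e = 1\<^sub>m (card TL.X)" by (rule TL.E_isometry)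
    show "kmat (Tab \<mu>) TM.X TM.e \<in> carrier_mat (d_tab \<mu>) (card TM.X)" unfolding d_tab_def by (rule kmat_carrier)
    show "mat_adjoint (kmat (Tab \<mu>) TM.X TM.e) * kmat (Tab \<mu>) TM.X TM.e = 1\<^sub>m (card TM.X)" by (rule TM.E_isometry)
    show "H \<subseteq> {\<sigma>. \<sigma> permutes {1..Suc m}}" using Hmem by blast
    show "g \<circ> h \<in> H" if "g \<in> H" "h \<in> H" for g h
      using that subgroup.m_closed[OF alt_group_is_subgroup, of g "Suc m" h] by (simp add: H_def sym_group_mult)
    show "inv' g \<in> H" if "g \<in> H" for g using that alt_group_inv_closed by (simp only: H_def)
    show "t k \<in> H" if "k \<in> {1..Suc m}" for k using t[OF that] Hmem by blast
    show "kmat (Tabs L) TL.X TL.e * mat_adjoint (kmat (Tabs L) TL.X TL.e) * map_mat emb (rep_sum L g) =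
        map_mat emb (rep_sum L g) * (kmat (Tabs L) TL.X TL.e * mat_adjoint (kmat (Tabs L) TL.X TL.e))" if "g \<in> H" for g
    proof -
      have g: "g permutes {1..Suc m}" "evenperm g" using that Hmem by blast+
      show ?thesis unfolding repe[OF g(1)] by (rule TL.projection_commutes[OF g])
    qed
    show "kmat (Tab \<mu>) TM.X TM.e * mat_adjoint (kmat (Tab \<mu>) TM.X TM.e) * map_mat emb (young_rep \<mu> h) =
        map_mat emb (young_rep \<mu> h) * (kmat (Tab \<mu>) TM.X TM.e * mat_adjoint (kmat (Tab \<mu>) TM.X TM.e))"
      if "h \<in> H" "h (Suc m) = Suc m" for h
    proof -
      have h: "h permutes {1..m}" "evenperm h" using perm_fixing_top[of h m] that Hmem by blast+
      show ?thesis unfolding young_rep_eq[OF p h(1)] map_mat_kmat by (rule TM.projection_commutes[OF h])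
    qed
    show "kmat (Tabs L) TL.X TL.e * mat_adjoint (kmat (Tabs L) TL.X TL.e) * map_mat emb (Psi_sum L \<mu>) =
        map_mat emb (Psi_sum L \<mu>) * (kmat (Tab \<mu>) TM.X TM.e * mat_adjoint (kmat (Tab \<mu>) TM.X TM.e))"
      unfolding U.Psi_eq map_mat_kmat TL.E_projection TM.E_projection kmat_mult[OF U.finite_Tabs] kmat_mult[OF U.finite_Tab_mu]
    proof (rule kmat_cong)
      fix T R assume T: "T \<in> Tabs L" and R: "R \<in> Tab \<mu>"
      have trR: "tr R \<in> Tab \<mu>" and trT: "tr T \<in> Tabs L" using TM.trc[OF R] TL.trc[OF T] .
      have swY: "prod.swap b \<in> diagram \<mu> \<longleftrightarrow> b \<in> diagram \<mu>" for b using mem_swap_image'[of b "diagram \<mu>"] sym by simp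
      have ag: "(\<forall>b\<in>diagram \<mu>. tr T b = R b) \<longleftrightarrow> (\<forall>b\<in>diagram \<mu>. T b = tr R b)"
      proof
        assume a: "\<forall>b\<in>diagram \<mu>. tr T b = R b"
        show "\<forall>b\<in>diagram \<mu>. T b = tr R b"
        proof
          fix b assume "b \<in> diagram \<mu>"
          hence "tr T (prod.swap b) = R (prod.swap b)" using a swY by blast
          thus "T b = tr R b" by (simp add: tr_apply)
        qed
      next
        assume a: "\<forall>b\<in>diagram \<mu>. T b = tr R b"
        show "\<forall>b\<in>diagram \<mu>. tr T b = R b"
        proof
          fix b assume "b \<in> diagram \<mu>"
          hence "T (prod.swap b) = tr R (prod.swap b)" using a swY by blast
          thus "tr T b = R b" by (simp add: tr_apply)
        qed
      qed
      \<comment> \<open>Both expansions consist of a direct and a reflected term. The direct ones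
        agree; for the reflected ones the coefficients agree by symmetry, and the signs agree
        wherever the coefficient is nonzero.\<close>
      have "U.psi (tr T) R = U.psi T (tr R)"
        unfolding U.psi_agree(1)[OF trT R] U.psi_agree(1)[OF T trR] ag shape_tr num_ST_swap ..
      moreover have "sig (diagram \<mu>) T * U.psi T (tr R) = sig (diagram \<mu>) (tr R) * U.psi T (tr R)"
        using U.psi_agree[OF T trR] by (cases "\<forall>b\<in>diagram \<mu>. T b = tr R b") simp_all
      ultimately have "emb (sig (diagram \<mu>) T * U.psi (tr T) R) = emb (sig (diagram \<mu>) (tr R) * U.psi T (tr R))" by (simp only:)
      hence k: "emb (sig (diagram \<mu>) T) * emb (U.psi (tr T) R) = emb (sig (diagram \<mu>) (tr R)) * emb (U.psi T (tr R))"
        by (simp only: E.emb_mult)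
      show "(\<Sum>S\<in>Tabs L. TL.pe T S * emb (U.psi S R)) = (\<Sum>S\<in>Tab \<mu>. emb (U.psi T S) * TM.pe S R)"
        unfolding TL.sum_pe_left[OF T] TM.sum_pe_right[OF R] mult.assoc k ..
    qed
    show "mat_adjoint (frame_data.A (\<lambda>g. map_mat emb (rep_sum L g)) (map_mat emb (Psi_sum L \<mu>)) g) *
        frame_data.A (\<lambda>g. map_mat emb (rep_sum L g)) (map_mat emb (Psi_sum L \<mu>)) g = emb \<alpha> \<cdot>\<^sub>m 1\<^sub>m (d_tab \<mu>)"
      if g: "g \<in> {\<sigma>. \<sigma> permutes {1..Suc m}}" "g (Suc m) \<noteq> Suc m" for g
    proof -
      have gp: "g permutes {1..Suc m}" using g(1) by blast
      have "mat_adjoint (fr.A g) * fr.A g = \<alpha> \<cdot>\<^sub>m 1\<^sub>m (d_tab \<mu>)"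
        unfolding fr.A_def by (rule U.hval_isoclinic[OF li(1) t(1,2) \<alpha> gp g(2)])
      hence "map_mat emb (mat_adjoint (fr.A g) * fr.A g) = emb \<alpha> \<cdot>\<^sub>m 1\<^sub>m (d_tab \<mu>)"
        by (simp only: E.map_mat_smult_emb E.map_mat_one_emb)
      thus ?thesis unfolding mp(2)[OF g(1)] E.map_mat_adjoint_emb by (simp add: E.map_mat_mult_emb)
    qed
    show "frame_data.Q (Suc m) (d_sum L) (\<lambda>g. map_mat emb (rep_sum L g)) (map_mat emb (Psi_sum L \<mu>)) t = emb c \<cdot>\<^sub>m 1\<^sub>m (d_sum L)"
      unfolding mp(3) Qe E.map_mat_smult_emb E.map_mat_one_emb ..
  qed
  thus ?thesis unfolding dL dM H_def by simp
qed

theorem theorem7p2: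
  fixes n \<delta> :: nat and \<mu> :: "nat list"
  assumes "n \<ge> 1" and "is_partition (n - 1) \<mu>"
    and "isoclinic \<mu>"
    and "transpose_partition \<mu> = \<mu>"
    and "even (card (set \<mu>))"
    and "\<delta> \<in> {0, 1}"
  shows "even (d_tab \<mu>) \<and> even (d_sum (L_parity \<delta> \<mu>)) \<and>
    (if \<exists>q::int. even q \<and> (real n - 1 - real (durfee \<mu>)) / 2 = of_int q
     then \<exists>W :: nat \<Rightarrow> real vec set.
            equi_isoclinic_tff n (d_tab \<mu> div 2) (d_sum (L_parity \<delta> \<mu>) div 2) W \<and>
            carrier (alt_group n) \<subseteq> fusion_aut n (d_sum (L_parity \<delta> \<mu>) div 2) W
     else \<exists>W :: nat \<Rightarrow> complex vec set.
            equi_isoclinic_tff n (d_tab \<mu> div 2) (d_sum (L_parity \<delta> \<mu>) div 2) W \<and>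
            carrier (alt_group n) \<subseteq> fusion_aut n (d_sum (L_parity \<delta> \<mu>) div 2) W)"
proof -
  define m where "m = n - 1"
  have n: "n = Suc m" using assms(1) by (simp add: m_def)
  have p: "is_partition m \<mu>" using assms(2) by (simp add: m_def)
  have sym: "prod.swap ` diagram \<mu> = diagram \<mu>" using diagram_transpose[OF p] assms(4) by simp
  define e where "e = card {b \<in> diagram \<mu>. fst b < snd b}"
  have "m = durfee \<mu> + 2 * e"
    unfolding e_def by (rule durfee_eq[OF p L_parity_isoclinic(1)[OF p assms(3,6)] sym])
  \<comment> \<open>The quotient in the statement is thus an integer, and its parity is that of the
    exponent in J^2.\<close>
  hence val: "(real n - 1 - real (durfee \<mu>)) / 2 = of_int (int e)" by (simp add: n)
  have cond: "(\<exists>q::int. even q \<and> (real n - 1 - real (durfee \<mu>)) / 2 = of_int q) \<longleftrightarrow> even e"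
    unfolding val of_int_eq_iff by simp
  \<comment> \<open>What remains is a square root of (-1)^e of modulus one in the chosen field: 1
    for even e, the imaginary unit for odd e.\<close>
  show ?thesis
  proof (cases "even e")
    case True
    have "real_embedding (\<lambda>x::real. x)" by unfold_locales auto
    from alternating_frame[OF p sym assms(3,5,6) this, of 1] show ?thesis
      using True unfolding cond by (simp add: n flip: e_def)
  next
    case False
    have "real_embedding complex_of_real" by unfold_locales auto
    from alternating_frame[OF p sym assms(3,5,6) this, of \<i>] show ?thesis
      using False unfolding cond by (simp add: n flip: e_def)
  qed
qed

end
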